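(* Let $\mathbbm{k}$ be a field of characteristic $0$ and let $N \geqslant 3$. Then the defining ideal $I \subseteq \mathbbm{k}[x_0,\dots,x_N]$ of a general set of $s$ points in $\mathbb{P}^N_{\mathbbm{k}}$ (for any $s \geqslant 1$) has expected resurgence, i.e. $\rho(I) < N$.
   Context: For a homogeneous ideal $I$ in $R=\mathbbm{k}[x_0,\dots,x_N]$ and $m \in \mathbb{N}$, the $m$-th symbolic power is $I^{(m)} = \bigcap_{\mathfrak{p} \in \operatorname{Ass}(I)} (I^m R_{\mathfrak{p}} \cap R)$; for the ideal of a finite set of points with point ideals $\mathfrak{p}_1,\dots,\mathfrak{p}_s$, $I^{(m)} = \mathfrak{p}_1^m \cap \dots \cap \mathfrak{p}_s^m$. The resurgence of $I$ is $\rho(I) = \sup\{a/b : I^{(a)} \not\subseteq I^b\}$. The big height of $I$ is the maximal height of a minimal prime of $I$ (it equals $N$ for the ideal of a finite set of points in $\mathbb{P}^N$); $I$ is said to have expected resurgence if $\rho(I)$ is strictly less than its big height. A property holds for a general set of $s$ points in $\mathbb{P}^N_{\mathbbm{k}}$ if there is a nonempty Zariski open (dense) subset $U$ of the parameter space of $s$ points (e.g. of $\mathbb{A}^{s(N+1)}_{\mathbbm{k}}$, where $\mathbf{a}=(a_{ij})$ gives the points $[a_{i0}:\dots:a_{iN}]$, $1\le i\le s$, which are distinct for $\mathbf a$ in $U$) such that the property holds for every set of points corresponding to a point of $U$. *)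

theory Defs
  imports Complex_Main "HOL-Library.Poly_Mapping" "HOL-Library.Extended_Real"
begin

(* Multivariate polynomials over 'k in the variables x_0, x_1, ...:
  finitely supported maps from monomials (exponent vectors nat =>0 nat) to
  coefficients, with the convolution ring structure of Poly_Mapping. *)
type_synonym 'k mpoly = "(nat \<Rightarrow>\<^sub>0 nat) \<Rightarrow>\<^sub>0 'k"

definition poly_ring :: "nat \<Rightarrow> ('k::field) mpoly set" where
  "poly_ring N = {p. \<forall>m\<in>Poly_Mapping.keys p. Poly_Mapping.keys m \<subseteq> {..N}}"

definition mon_deg :: "(nat \<Rightarrow>\<^sub>0 nat) \<Rightarrow> nat" where
  "mon_deg m = (\<Sum>i\<in>Poly_Mapping.keys m. Poly_Mapping.lookup m i)"

definition mon_eval :: "(nat \<Rightarrow> 'k::field) \<Rightarrow> (nat \<Rightarrow>\<^sub>0 nat) \<Rightarrow> 'k" where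
  "mon_eval a m = (\<Prod>i\<in>Poly_Mapping.keys m. a i ^ Poly_Mapping.lookup m i)"

definition poly_eval :: "(nat \<Rightarrow> 'k::field) \<Rightarrow> 'k mpoly \<Rightarrow> 'k" where
  "poly_eval a p = (\<Sum>m\<in>Poly_Mapping.keys p. Poly_Mapping.lookup p m * mon_eval a m)"

(* Every homogeneous component of p vanishes at (a representative of) the
  projective point with coordinates a. *)
definition hom_vanish :: "'k::field mpoly \<Rightarrow> (nat \<Rightarrow> 'k) \<Rightarrow> bool" where
  "hom_vanish p a \<longleftrightarrow>
     (\<forall>d. (\<Sum>m\<in>Poly_Mapping.keys p. if mon_deg m = d then Poly_Mapping.lookup p m * mon_eval a m else 0) = 0)"

definition points_ideal :: "nat \<Rightarrow> (nat \<Rightarrow> 'k::field) set \<Rightarrow> 'k mpoly set" where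
  "points_ideal N P = {p \<in> poly_ring N. \<forall>a\<in>P. hom_vanish p a}"

inductive_set ideal_span :: "nat \<Rightarrow> 'k::field mpoly set \<Rightarrow> 'k mpoly set"
  for N S where
  zero: "0 \<in> ideal_span N S"
| gen: "s \<in> S \<Longrightarrow> r \<in> poly_ring N \<Longrightarrow> r * s \<in> ideal_span N S"
| add: "p \<in> ideal_span N S \<Longrightarrow> q \<in> ideal_span N S \<Longrightarrow> p + q \<in> ideal_span N S"

fun ideal_pow :: "nat \<Rightarrow> 'k::field mpoly set \<Rightarrow> nat \<Rightarrow> 'k mpoly set" where
  "ideal_pow N I 0 = poly_ring N"
| "ideal_pow N I (Suc b) = ideal_span N {p * q | p q. p \<in> I \<and> q \<in> ideal_pow N I b}"

(* The points given by a parameter A: point i (i < s) has coordinates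
  [A i 0 : ... : A i N]. *)
definition pts_set :: "nat \<Rightarrow> (nat \<Rightarrow> nat \<Rightarrow> 'k) \<Rightarrow> (nat \<Rightarrow> 'k) set" where
  "pts_set s A = A ` {..<s}"

definition symb_pow :: "nat \<Rightarrow> nat \<Rightarrow> (nat \<Rightarrow> nat \<Rightarrow> 'k::field) \<Rightarrow> nat \<Rightarrow> 'k mpoly set" where
  "symb_pow N s A m = (\<Inter>i\<in>{..<s}. ideal_pow N (points_ideal N {A i}) m)"

(* Resurgence (as an extended real, so that the supremum is the true one). *)
definition resurgence :: "nat \<Rightarrow> nat \<Rightarrow> (nat \<Rightarrow> nat \<Rightarrow> 'k::field) \<Rightarrow> ereal" where
  "resurgence N s A = Sup {ereal (real a / real b) | a b. b \<ge> 1 \<and>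
       \<not> symb_pow N s A a \<subseteq> ideal_pow N (points_ideal N (pts_set s A)) b}"

definition distinct_proj_points :: "nat \<Rightarrow> nat \<Rightarrow> (nat \<Rightarrow> nat \<Rightarrow> 'k::field) \<Rightarrow> bool" where
  "distinct_proj_points N s A \<longleftrightarrow>
     (\<forall>i<s. \<exists>j\<le>N. A i j \<noteq> 0) \<and>
     (\<forall>i<s. \<forall>i'<s. i \<noteq> i' \<longrightarrow> \<not> (\<exists>c. \<forall>j\<le>N. A i j = c * A i' j))"

(* Points of the parameter space A^{s(N+1)} are functions b :: nat => 'k, of
  which only the coordinates < s(N+1) matter; coordinate i*(N+1)+j is a_{ij}. *)
definition param_pts :: "nat \<Rightarrow> (nat \<Rightarrow> 'k) \<Rightarrow> nat \<Rightarrow> nat \<Rightarrow> 'k" where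
  "param_pts N b i j = b (i * (N + 1) + j)"

definition zariski_open :: "nat \<Rightarrow> (nat \<Rightarrow> 'k::field) set \<Rightarrow> bool" where
  "zariski_open n U \<longleftrightarrow>
     (\<exists>F. (\<forall>f\<in>F. \<forall>m\<in>Poly_Mapping.keys f. Poly_Mapping.keys m \<subseteq> {..<n}) \<and>
          U = {b. \<exists>f\<in>F. poly_eval b f \<noteq> 0})"

end

theory Submission
  imports Defs "HOL-Computational_Algebra.Polynomial" "HOL-Library.FuncSet"
begin

text \<open>
  Let forms of degree \<open>r\<close> separate the \<open>s\<close> points. Then \<open>I\<^sup>(\<^sup>b\<^sup>)\<close> and \<open>I\<^sup>b\<close> agree in degrees at least \<open>b(r + 1)\<close>:
  with \<open>u\<^sub>p\<close> of degree \<open>r\<close> vanishing at all points but \<open>p\<close>, every form of such a degree is a sum of an element of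
  \<open>I\<^sup>b\<close> and multiples of the \<open>u\<^sub>p\<^sup>b\<close>, and membership in \<open>I\<^sup>(\<^sup>b\<^sup>)\<close> forces the cofactor of \<open>u\<^sub>p\<^sup>b\<close> into the \<open>b\<close>-th power
  of the ideal of \<open>p\<close>. Hence the resurgence is less than \<open>N\<close> as soon as nonzero forms in \<open>I\<^sup>(\<^sup>a\<^sup>)\<close> have degree at least
  \<open>c a\<close> for a constant \<open>c\<close> with \<open>r + 1 < N c\<close>.

  If forms of degree \<open>d\<close> separate the \<open>m\<close>-jets at \<open>S\<close> of the points, then products of \<open>M\<close> such forms separate the
  \<open>mM\<close>-jets in degree \<open>dM\<close>; counting dimensions for \<open>M \<rightarrow> \<infinity>\<close> gives \<open>c = S (m / d)\<^sup>N\<^sup>-\<^sup>1\<close>. So the single open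
  condition of separating \<open>m\<close>-jets controls all symbolic powers at once. It holds at any \<open>S \<le> k\<^sup>N\<close> points of the grid
  \<open>{0, \<dots>, k - 1}\<^sup>N\<close> with \<open>d = k (m + N)\<close>, so that \<open>c\<close> comes close to \<open>S / k\<^sup>N\<^sup>-\<^sup>1\<close>, which is enough for suitable \<open>k\<close>.
\<close>

subsection \<open>Substitution\<close>

text \<open>If F lies in the a-th symbolic power but not in I^b, and a >= b, then some term of F has
  degree t < b (r + 1). Since t >= c a, this gives a / b < (r + 1) / c. Bounding degrees separately
  for each a would impose countably many open conditions, which over a countable field may have no
  common point. Hence a bound for all a has to follow from jets of one fixed order m. For S = k^N
  grid points, c tends to k as m grows, so the target is r + 1 < N k; on the other hand there must
  be at least s monomials of degree r. Both hold when k is the integer N-th root of s and r = N k -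
  2, except for N = 3 and 5 <= s <= 7, where five points of the grid with k = 2 do the job. The two
  open conditions are checked at different special configurations, and irreducibility of the
  parameter space makes them compatible. Characteristic 0 provides distinct integer coordinates for
  both configurations, and an infinite field.\<close>

lemma poly_mapping_sum_single:
  "p = (\<Sum>m\<in>Poly_Mapping.keys p. Poly_Mapping.single m (Poly_Mapping.lookup p m))"
proof (rule poly_mapping_eqI)
  fix k
  show "Poly_Mapping.lookup p k = Poly_Mapping.lookup (\<Sum>m\<in>Poly_Mapping.keys p. Poly_Mapping.single m (Poly_Mapping.lookup p m)) k"
    by (simp add: lookup_sum lookup_single when_def sum.delta in_keys_iff)
qed

lemma poly_mapping_additive_induct:
  fixes p :: "'a \<Rightarrow>\<^sub>0 'b::comm_monoid_add"
  assumes "P 0" "\<And>p q. P p \<Longrightarrow> P q \<Longrightarrow> P (p + q)"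
    and "\<And>m. m \<in> Poly_Mapping.keys p \<Longrightarrow> P (Poly_Mapping.single m (Poly_Mapping.lookup p m))"
  shows "P p"
proof -
  have "P (\<Sum>m\<in>S. Poly_Mapping.single m (Poly_Mapping.lookup p m))" if "S \<subseteq> Poly_Mapping.keys p" for S
    using finite_subset[OF that finite_keys] that
    by (induction S rule: finite_induct) (auto intro: assms)
  then show ?thesis
    using poly_mapping_sum_single[of p] by (metis order_refl)
qed

lemma keys_mult_imp:
  assumes "k \<in> Poly_Mapping.keys (p * q)"
  obtains m n where "m \<in> Poly_Mapping.keys p" "n \<in> Poly_Mapping.keys q" "k = m + n"
  using keys_mult[of p q] assms by auto

lemma keys_add_nat: "Poly_Mapping.keys (m + n :: 'a \<Rightarrow>\<^sub>0 nat) = Poly_Mapping.keys m \<union> Poly_Mapping.keys n"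
  by (auto simp: in_keys_iff lookup_add)

lemma lookup_single_mult_add:
  fixes p :: "('a::cancel_comm_monoid_add) \<Rightarrow>\<^sub>0 ('b::comm_semiring_1)"
  shows "Poly_Mapping.lookup (Poly_Mapping.single k c * p) (k + m) = c * Poly_Mapping.lookup p m"
proof (rule poly_mapping_additive_induct[of _ p])
  fix n
  show "Poly_Mapping.lookup (Poly_Mapping.single k c * Poly_Mapping.single n (Poly_Mapping.lookup p n)) (k + m) =
    c * Poly_Mapping.lookup (Poly_Mapping.single n (Poly_Mapping.lookup p n)) m"
    by (simp add: mult_single lookup_single when_def)
qed (simp_all add: lookup_add distrib_left)

definition monom_val :: "(nat \<Rightarrow> 'r::comm_ring_1) \<Rightarrow> (nat \<Rightarrow>\<^sub>0 nat) \<Rightarrow> 'r" where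
  "monom_val \<sigma> m = (\<Prod>i\<in>Poly_Mapping.keys m. \<sigma> i ^ Poly_Mapping.lookup m i)"

lemma monom_val_superset:
  "finite S \<Longrightarrow> Poly_Mapping.keys m \<subseteq> S \<Longrightarrow> monom_val \<sigma> m = (\<Prod>i\<in>S. \<sigma> i ^ Poly_Mapping.lookup m i)"
  unfolding monom_val_def by (rule prod.mono_neutral_left) (auto simp: in_keys_iff)

lemma monom_val_0 [simp]: "monom_val \<sigma> 0 = 1"
  by (simp add: monom_val_def)

lemma monom_val_single [simp]: "monom_val \<sigma> (Poly_Mapping.single i n) = \<sigma> i ^ n"
  by (cases "n = 0") (simp_all add: monom_val_def)

lemma monom_val_add: "monom_val \<sigma> (m + n) = monom_val \<sigma> m * monom_val \<sigma> n"
proof -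
  let ?S = "Poly_Mapping.keys m \<union> Poly_Mapping.keys n"
  show ?thesis
    by (subst (1 2 3) monom_val_superset[of ?S])
      (auto simp: keys_add_nat lookup_add power_add prod.distrib)
qed

lemma mon_eval_eq: "mon_eval = monom_val"
  by (intro ext) (simp add: mon_eval_def monom_val_def)

text \<open>Used with three coefficient maps: \<open>Const\<close> for substituting polynomials, the
  identity for evaluation, and constant univariate polynomials for restriction to a line.\<close>

definition psubst :: "('k::field \<Rightarrow> 'r::comm_ring_1) \<Rightarrow> (nat \<Rightarrow> 'r) \<Rightarrow> 'k mpoly \<Rightarrow> 'r" where
  "psubst h \<sigma> p = (\<Sum>m\<in>Poly_Mapping.keys p. h (Poly_Mapping.lookup p m) * monom_val \<sigma> m)"

locale coeff_hom =
  fixes h :: "'k::field \<Rightarrow> 'r::comm_ring_1"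
  assumes h_add: "h (x + y) = h x + h y" and h_mult: "h (x * y) = h x * h y" and h_1: "h 1 = 1"
begin

lemma h_0: "h 0 = 0"
  using h_add[of 0 0] by simp

lemma psubst_superset:
  "finite S \<Longrightarrow> Poly_Mapping.keys p \<subseteq> S \<Longrightarrow> psubst h \<sigma> p = (\<Sum>m\<in>S. h (Poly_Mapping.lookup p m) * monom_val \<sigma> m)"
  unfolding psubst_def by (rule sum.mono_neutral_left) (auto simp: in_keys_iff h_0)

lemma psubst_0 [simp]: "psubst h \<sigma> 0 = 0"
  by (simp add: psubst_def)

lemma psubst_single: "psubst h \<sigma> (Poly_Mapping.single m c) = h c * monom_val \<sigma> m"
  by (cases "c = 0") (simp_all add: psubst_def h_0)

lemma psubst_1 [simp]: "psubst h \<sigma> 1 = 1"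
  by (simp add: psubst_single h_1 flip: single_one)

lemma psubst_add: "psubst h \<sigma> (p + q) = psubst h \<sigma> p + psubst h \<sigma> q"
proof -
  let ?S = "Poly_Mapping.keys p \<union> Poly_Mapping.keys q"
  show ?thesis
    by (subst (1 2 3) psubst_superset[of ?S])
      (use keys_add[of p q] in \<open>auto simp: lookup_add h_add sum.distrib distrib_right\<close>)
qed

lemma psubst_sum: "psubst h \<sigma> (\<Sum>i\<in>S. f i) = (\<Sum>i\<in>S. psubst h \<sigma> (f i))"
  by (induction S rule: infinite_finite_induct) (simp_all add: psubst_add)

lemma psubst_mult: "psubst h \<sigma> (p * q) = psubst h \<sigma> p * psubst h \<sigma> q"
proof (rule poly_mapping_additive_induct[of _ p])
  fix m
  let ?s = "Poly_Mapping.single m (Poly_Mapping.lookup p m)"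
  show "psubst h \<sigma> (?s * q) = psubst h \<sigma> ?s * psubst h \<sigma> q"
    by (rule poly_mapping_additive_induct[of _ q])
      (simp_all add: distrib_left psubst_add mult_single psubst_single h_mult monom_val_add)
qed (simp_all add: distrib_right psubst_add)

lemma psubst_power: "psubst h \<sigma> (p ^ n) = psubst h \<sigma> p ^ n"
  by (induction n) (simp_all add: psubst_mult)

lemma psubst_prod: "psubst h \<sigma> (\<Prod>i\<in>S. f i) = (\<Prod>i\<in>S. psubst h \<sigma> (f i))"
  by (induction S rule: infinite_finite_induct) (simp_all add: psubst_mult)

lemma psubst_uminus: "psubst h \<sigma> (- p) = - psubst h \<sigma> p"
  using psubst_add[of \<sigma> p "- p"] by (simp add: eq_neg_iff_add_eq_0 add.commute)

lemma psubst_diff: "psubst h \<sigma> (p - q) = psubst h \<sigma> p - psubst h \<sigma> q"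
  using psubst_add[of \<sigma> p "- q"] by (simp add: psubst_uminus)

end

abbreviation Const :: "'k::field \<Rightarrow> 'k mpoly" where
  "Const \<equiv> Poly_Mapping.single 0"

definition Var :: "nat \<Rightarrow> 'k::field mpoly" where
  "Var i = Poly_Mapping.single (Poly_Mapping.single i 1) 1"

lemma (in coeff_hom) psubst_Var_eq [simp]: "psubst h \<sigma> (Var i) = \<sigma> i"
  by (simp add: Var_def psubst_single h_1)

lemma (in coeff_hom) psubst_Const [simp]: "psubst h \<sigma> (Const c) = h c"
  by (simp add: psubst_single)

interpretation Const: coeff_hom "Const :: 'k::field \<Rightarrow> 'k mpoly"
  by standard (simp_all add: single_add mult_single)

interpretation id_hom: coeff_hom "\<lambda>x::'k::field. x"
  by standard simp_all

lemma poly_eval_eq: "poly_eval b = psubst (\<lambda>x. x) b"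
  by (rule ext) (simp add: poly_eval_def psubst_def mon_eval_eq)

lemma (in coeff_hom) psubst_psubst:
  "psubst h \<tau> (psubst Const \<sigma> p) = psubst h (\<lambda>i. psubst h \<tau> (\<sigma> i)) p"
  unfolding psubst_def[of Const]
  by (simp add: psubst_sum psubst_mult psubst_single monom_val_def psubst_prod psubst_power)
    (simp add: psubst_def monom_val_def)

lemma monom_val_Var: "monom_val Var m = Poly_Mapping.single m 1"
proof -
  have p: "(Var i :: 'a mpoly) ^ n = Poly_Mapping.single (Poly_Mapping.single i n) 1" for i n
    by (induction n) (simp_all add: Var_def mult_single flip: single_add)
  have "(\<Prod>i\<in>S. Poly_Mapping.single (f i) (1::'a)) = Poly_Mapping.single (\<Sum>i\<in>S. f i) 1"
    if "finite S" for S and f :: "nat \<Rightarrow> nat \<Rightarrow>\<^sub>0 nat"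
    using that by (induction S rule: finite_induct) (simp_all add: mult_single)
  then show ?thesis
    by (simp only: monom_val_def p finite_keys poly_mapping_sum_single[of m, symmetric])
qed

lemma psubst_Var: "psubst Const Var p = p"
  by (rule poly_mapping_additive_induct[of _ p])
    (simp_all add: Const.psubst_add Const.psubst_single monom_val_Var mult_single)

subsection \<open>Degrees\<close>

lemma mon_deg_superset:
  "finite S \<Longrightarrow> Poly_Mapping.keys m \<subseteq> S \<Longrightarrow> mon_deg m = (\<Sum>i\<in>S. Poly_Mapping.lookup m i)"
  unfolding mon_deg_def by (rule sum.mono_neutral_left) (auto simp: in_keys_iff)

lemma mon_deg_add [simp]: "mon_deg (m + n) = mon_deg m + mon_deg n"
proof -
  let ?S = "Poly_Mapping.keys m \<union> Poly_Mapping.keys n"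
  show ?thesis
    by (subst (1 2 3) mon_deg_superset[of ?S]) (auto simp: keys_add_nat lookup_add sum.distrib)
qed

lemma mon_deg_0 [simp]: "mon_deg 0 = 0"
  by (simp add: mon_deg_def)

lemma mon_deg_single [simp]: "mon_deg (Poly_Mapping.single i n) = n"
  by (cases "n = 0") (simp_all add: mon_deg_def)

lemma lookup_le_mon_deg: "Poly_Mapping.lookup m i \<le> mon_deg m"
  by (cases "i \<in> Poly_Mapping.keys m") (auto simp: mon_deg_def in_keys_iff intro: member_le_sum)

definition ydeg :: "(nat \<Rightarrow>\<^sub>0 nat) \<Rightarrow> nat" where
  "ydeg m = mon_deg m - Poly_Mapping.lookup m 0"

lemma mon_deg_eq_ydeg: "mon_deg m = ydeg m + Poly_Mapping.lookup m 0"
  using lookup_le_mon_deg[of m 0] by (simp add: ydeg_def)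

lemma ydeg_add [simp]: "ydeg (m + n) = ydeg m + ydeg n"
  using lookup_le_mon_deg[of m 0] lookup_le_mon_deg[of n 0] by (simp add: ydeg_def lookup_add)

lemma ydeg_0 [simp]: "ydeg 0 = 0"
  by (simp add: ydeg_def)

lemma ydeg_single [simp]: "ydeg (Poly_Mapping.single i n) = (if i = 0 then 0 else n)"
  by (simp add: ydeg_def lookup_single when_def)

lemma ydeg_eq_sum: "Poly_Mapping.keys m \<subseteq> {..N} \<Longrightarrow> ydeg m = (\<Sum>i\<in>{1..N}. Poly_Mapping.lookup m i)"
proof -
  assume "Poly_Mapping.keys m \<subseteq> {..N}"
  then have "mon_deg m = (\<Sum>i\<in>{..N}. Poly_Mapping.lookup m i)"
    by (intro mon_deg_superset) auto
  also have "{..N} = insert 0 {1..N}" by auto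
  finally show ?thesis by (simp add: ydeg_def)
qed

lemma monomial_split:
  assumes "i \<in> Poly_Mapping.keys m"
  obtains m' where "m = Poly_Mapping.single i (1::nat) + m'"
proof
  show "m = Poly_Mapping.single i 1 + (m - Poly_Mapping.single i 1)"
    using assms by (intro poly_mapping_eqI) (auto simp: lookup_add lookup_minus lookup_single when_def in_keys_iff)
qed

lemma mon_deg_split1:
  assumes "mon_deg m \<ge> Suc c"
  obtains i m' where "i \<in> Poly_Mapping.keys m" "m = Poly_Mapping.single i (1::nat) + m'" "mon_deg m' \<ge> c"
proof -
  have "m \<noteq> 0" using assms by auto
  then obtain i where i: "i \<in> Poly_Mapping.keys m"
    by (meson equals0I keys_eq_empty)
  then obtain m' where "m = Poly_Mapping.single i (1::nat) + m'" by (rule monomial_split)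
  with assms show ?thesis by (intro that[OF i]) auto
qed

lemma ydeg_split1:
  assumes "ydeg m \<ge> Suc c"
  obtains i m' where "i \<in> Poly_Mapping.keys m" "i \<noteq> 0" "m = Poly_Mapping.single i (1::nat) + m'" "ydeg m' \<ge> c"
proof -
  have "\<exists>i\<in>Poly_Mapping.keys m. i \<noteq> 0"
  proof (rule ccontr)
    assume "\<not> ?thesis"
    then have "mon_deg m = (\<Sum>i\<in>{0}. Poly_Mapping.lookup m i)"
      by (intro mon_deg_superset) auto
    with assms show False by (simp add: ydeg_def)
  qed
  then obtain i where i: "i \<in> Poly_Mapping.keys m" "i \<noteq> 0" by auto
  then obtain m' where "m = Poly_Mapping.single i (1::nat) + m'" using monomial_split by metis
  with assms i show ?thesis by (intro that[OF i]) auto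
qed

lemma mon_deg_split:
  assumes "mon_deg m \<ge> d"
  obtains m1 m2 where "m = m1 + m2" "mon_deg m1 = d"
  using assms
proof (induction d arbitrary: m thesis)
  case 0
  then show ?case by (metis add_0 mon_deg_0)
next
  case (Suc d)
  obtain i m' where m': "m = Poly_Mapping.single i (1::nat) + m'" "mon_deg m' \<ge> d"
    using mon_deg_split1[OF Suc.prems(2)] by metis
  obtain m1 m2 where "m' = m1 + m2" "mon_deg m1 = d"
    using Suc.IH[OF _ m'(2)] by metis
  then show ?case
    using Suc.prems(1)[of "Poly_Mapping.single i 1 + m1" m2] m'(1) by (simp add: add.assoc)
qed

section \<open>Monomials of fixed degree and their number\<close>

definition monomials :: "nat \<Rightarrow> nat \<Rightarrow> (nat \<Rightarrow>\<^sub>0 nat) set" where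
  "monomials N d = {m. Poly_Mapping.keys m \<subseteq> {..N} \<and> mon_deg m = d}"

lemma bij_betw_monomials_lists:
  "bij_betw (\<lambda>m. map (Poly_Mapping.lookup m) [0..<Suc N]) (monomials N d) {l. length l = Suc N \<and> sum_list l = d}"
proof (rule bij_betw_imageI)
  show "inj_on (\<lambda>m. map (Poly_Mapping.lookup m) [0..<Suc N]) (monomials N d)"
  proof (rule inj_onI)
    fix m n assume mn: "m \<in> monomials N d" "n \<in> monomials N d"
      and eq: "map (Poly_Mapping.lookup m) [0..<Suc N] = map (Poly_Mapping.lookup n) [0..<Suc N]"
    show "m = n"
    proof (rule poly_mapping_eqI)
      fix k
      show "Poly_Mapping.lookup m k = Poly_Mapping.lookup n k"
      proof (cases "k \<le> N")
        case True
        with eq show ?thesis by (auto simp del: upt_Suc)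
      next
        case False
        then have "k \<notin> Poly_Mapping.keys m" "k \<notin> Poly_Mapping.keys n" using mn by (auto simp: monomials_def)
        then show ?thesis by (simp add: in_keys_iff)
      qed
    qed
  qed
  have deg: "sum_list (map (Poly_Mapping.lookup m) [0..<Suc N]) = mon_deg m" if "Poly_Mapping.keys m \<subseteq> {..N}" for m
    using mon_deg_superset[of "{..N}" m] that
    by (simp add: sum_list_distinct_conv_sum_set atLeast0LessThan lessThan_Suc_atMost del: upt_Suc)
  show "(\<lambda>m. map (Poly_Mapping.lookup m) [0..<Suc N]) ` monomials N d = {l. length l = Suc N \<and> sum_list l = d}"
  proof (intro equalityI subsetI)
    fix l assume l: "l \<in> {l. length l = Suc N \<and> sum_list l = d}"
    define m where "m = Abs_poly_mapping (\<lambda>i. if i \<le> N then l ! i else 0)"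
    have lm: "Poly_Mapping.lookup m i = (if i \<le> N then l ! i else 0)" for i
      unfolding m_def by (subst lookup_Abs_poly_mapping) (auto intro: finite_subset[of _ "{..N}"])
    have lst: "map (Poly_Mapping.lookup m) [0..<Suc N] = l"
      using l by (intro nth_equalityI) (auto simp: lm simp del: upt_Suc)
    moreover have "Poly_Mapping.keys m \<subseteq> {..N}" by (auto simp: in_keys_iff lm split: if_splits)
    ultimately have "m \<in> monomials N d" using deg[of m] l by (simp add: monomials_def)
    with lst show "l \<in> (\<lambda>m. map (Poly_Mapping.lookup m) [0..<Suc N]) ` monomials N d" by (metis image_eqI)
  qed (auto simp: monomials_def deg simp del: upt_Suc)
qed

lemma card_monomials: "card (monomials N d) = (d + N) choose N"
proof -
  have "card (monomials N d) = (d + Suc N - 1) choose d"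
    using bij_betw_same_card[OF bij_betw_monomials_lists[of N d]] card_length_sum_list[of "Suc N" d] by simp
  also have "\<dots> = (d + N) choose N" by (simp add: binomial_symmetric[of d])
  finally show ?thesis .
qed

text \<open>An infinite set would have cardinality 0, but the binomial coefficient is
  positive.\<close>

lemma finite_monomials: "finite (monomials N d)"
proof (rule ccontr)
  assume "infinite (monomials N d)"
  then have "card (monomials N d) = 0" by simp
  then show False by (simp add: card_monomials)
qed

lemma keys_add_subset:
  "Poly_Mapping.keys p \<subseteq> A \<Longrightarrow> Poly_Mapping.keys q \<subseteq> A \<Longrightarrow> Poly_Mapping.keys (p + q) \<subseteq> A"
  using keys_add[of p q] by blast

lemma keys_sum_subset:
  "(\<And>i. i \<in> S \<Longrightarrow> Poly_Mapping.keys (f i) \<subseteq> A) \<Longrightarrow> Poly_Mapping.keys (\<Sum>i\<in>S. f i) \<subseteq> A"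
  by (induction S rule: infinite_finite_induct) (auto dest!: subsetD[OF keys_add])

lemma keys_uminus_eq: "Poly_Mapping.keys (- p :: 'a \<Rightarrow>\<^sub>0 'b::ab_group_add) = Poly_Mapping.keys p"
  by (auto simp: in_keys_iff)

lemma keys_diff_subset:
  fixes p q :: "'a \<Rightarrow>\<^sub>0 'b::ab_group_add"
  shows "Poly_Mapping.keys p \<subseteq> A \<Longrightarrow> Poly_Mapping.keys q \<subseteq> A \<Longrightarrow> Poly_Mapping.keys (p - q) \<subseteq> A"
  using keys_add_subset[of p A "- q"] by (simp add: keys_uminus_eq)

lemma keys_mult_subset:
  assumes "Poly_Mapping.keys p \<subseteq> A" "Poly_Mapping.keys q \<subseteq> B" "\<And>m n. m \<in> A \<Longrightarrow> n \<in> B \<Longrightarrow> m + n \<in> C"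
  shows "Poly_Mapping.keys (p * q) \<subseteq> C"
  using assms by (blast elim: keys_mult_imp)

subsection \<open>Graded pieces\<close>

lemma poly_ring_iff: "p \<in> poly_ring N \<longleftrightarrow> Poly_Mapping.keys p \<subseteq> {m. Poly_Mapping.keys m \<subseteq> {..N}}"
  by (auto simp: poly_ring_def)

lemma poly_ring_0 [simp]: "0 \<in> poly_ring N"
  by (simp add: poly_ring_def)

lemma poly_ring_Const [simp]: "Const c \<in> poly_ring N"
  by (cases "c = 0") (simp_all add: poly_ring_def)

lemma poly_ring_1 [simp]: "1 \<in> poly_ring N"
  by (simp add: poly_ring_def)

lemma poly_ring_add: "p \<in> poly_ring N \<Longrightarrow> q \<in> poly_ring N \<Longrightarrow> p + q \<in> poly_ring N"
  unfolding poly_ring_iff by (rule keys_add_subset)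

lemma poly_ring_mult: "p \<in> poly_ring N \<Longrightarrow> q \<in> poly_ring N \<Longrightarrow> p * q \<in> poly_ring N"
  unfolding poly_ring_iff by (rule keys_mult_subset) (auto simp: keys_add_nat)

definition form :: "nat \<Rightarrow> nat \<Rightarrow> 'k::field mpoly set" where
  "form N d = {p. Poly_Mapping.keys p \<subseteq> monomials N d}"

lemma form_poly_ring: "p \<in> form N d \<Longrightarrow> p \<in> poly_ring N"
  by (auto simp: form_def poly_ring_def monomials_def)

lemma form_0 [simp]: "0 \<in> form N d"
  by (simp add: form_def)

lemma form_1 [simp]: "1 \<in> form N 0"
  by (simp add: form_def monomials_def)

lemma form_Const [simp]: "Const c \<in> form N 0"
  by (cases "c = 0") (simp_all add: form_def monomials_def)

lemma form_single: "m \<in> monomials N d \<Longrightarrow> Poly_Mapping.single m c \<in> form N d"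
  by (cases "c = 0") (simp_all add: form_def)

lemma form_Var: "i \<le> N \<Longrightarrow> Var i \<in> form N 1"
  unfolding Var_def by (rule form_single) (simp add: monomials_def)

lemma form_add: "p \<in> form N d \<Longrightarrow> q \<in> form N d \<Longrightarrow> p + q \<in> form N d"
  unfolding form_def by (blast dest!: subsetD[OF keys_add])

lemma form_diff: "p \<in> form N d \<Longrightarrow> q \<in> form N d \<Longrightarrow> p - q \<in> form N d"
  unfolding form_def using keys_diff_subset by blast

lemma form_sum: "(\<And>i. i \<in> S \<Longrightarrow> f i \<in> form N d) \<Longrightarrow> (\<Sum>i\<in>S. f i) \<in> form N d"
  unfolding form_def using keys_sum_subset[of S f "monomials N d"] by blast

lemma monomials_add: "m \<in> monomials N d \<Longrightarrow> n \<in> monomials N e \<Longrightarrow> m + n \<in> monomials N (d + e)"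
  by (auto simp: monomials_def keys_add_nat)

lemma form_mult: "p \<in> form N d \<Longrightarrow> q \<in> form N e \<Longrightarrow> p * q \<in> form N (d + e)"
  unfolding form_def using keys_mult_subset[of p "monomials N d" q "monomials N e" "monomials N (d + e)"]
  by (auto intro: monomials_add)

lemma form_Const_mult: "p \<in> form N d \<Longrightarrow> Const c * p \<in> form N d"
  using form_mult[of "Const c" N 0 p d] by simp

lemma form_power: "p \<in> form N d \<Longrightarrow> p ^ n \<in> form N (n * d)"
  by (induction n) (auto dest: form_mult)

lemma form_prod: "(\<And>i. i \<in> S \<Longrightarrow> f i \<in> form N (d i)) \<Longrightarrow> (\<Prod>i\<in>S. f i) \<in> form N (\<Sum>i\<in>S. d i)"
  by (induction S rule: infinite_finite_induct) (auto intro: form_mult)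

lemma form_monom_val:
  assumes "\<And>i. i \<in> Poly_Mapping.keys m \<Longrightarrow> \<sigma> i \<in> form N 1"
  shows "monom_val \<sigma> m \<in> form N (mon_deg m)"
  unfolding monom_val_def mon_deg_def
proof (rule form_prod)
  fix i assume "i \<in> Poly_Mapping.keys m"
  then show "\<sigma> i ^ Poly_Mapping.lookup m i \<in> form N (Poly_Mapping.lookup m i)"
    using form_power[OF assms, of i "Poly_Mapping.lookup m i"] by simp
qed

lemma psubst_form:
  assumes "\<And>i. i \<le> N \<Longrightarrow> \<sigma> i \<in> form N 1" "p \<in> form N d"
  shows "psubst Const \<sigma> p \<in> form N d"
proof (rule poly_mapping_additive_induct[of _ p])
  fix m assume "m \<in> Poly_Mapping.keys p"
  then have m: "Poly_Mapping.keys m \<subseteq> {..N}" "mon_deg m = d"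
    using assms(2) by (auto simp: form_def monomials_def)
  then have "monom_val \<sigma> m \<in> form N d"
    using form_monom_val[of m \<sigma> N] assms(1) by auto
  then show "psubst Const \<sigma> (Poly_Mapping.single m (Poly_Mapping.lookup p m)) \<in> form N d"
    by (simp add: Const.psubst_single form_Const_mult)
qed (simp_all add: Const.psubst_add form_add)

text \<open>An ideal of the polynomial ring, unlike \<open>form\<close>: with it, degrees can be
  tracked through sums and products without splitting into homogeneous components.\<close>

definition high :: "nat \<Rightarrow> nat \<Rightarrow> 'k::field mpoly set" where
  "high N c = {p. Poly_Mapping.keys p \<subseteq> {m. Poly_Mapping.keys m \<subseteq> {..N} \<and> c \<le> mon_deg m}}"

lemma high_poly_ring: "p \<in> high N c \<Longrightarrow> p \<in> poly_ring N"
  by (auto simp: high_def poly_ring_def)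

lemma high_0_eq: "high N 0 = poly_ring N"
  by (auto simp: high_def poly_ring_def)

lemma high_0 [simp]: "0 \<in> high N c"
  by (simp add: high_def)

lemma high_add: "p \<in> high N c \<Longrightarrow> q \<in> high N c \<Longrightarrow> p + q \<in> high N c"
  unfolding high_def by (blast dest!: subsetD[OF keys_add])

lemma high_sum: "(\<And>i. i \<in> S \<Longrightarrow> f i \<in> high N d) \<Longrightarrow> (\<Sum>i\<in>S. f i) \<in> high N d"
  by (induction S rule: infinite_finite_induct) (auto intro: high_add)

lemma high_mult: "p \<in> high N c \<Longrightarrow> q \<in> high N d \<Longrightarrow> p * q \<in> high N (c + d)"
  unfolding high_def mem_Collect_eq by (rule keys_mult_subset) (auto simp: keys_add_nat)

lemma high_mult_left: "p \<in> poly_ring N \<Longrightarrow> q \<in> high N c \<Longrightarrow> p * q \<in> high N c"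
  using high_mult[of p N 0 q c] by (simp add: high_0_eq)

lemma form_high: "p \<in> form N d \<Longrightarrow> c \<le> d \<Longrightarrow> p \<in> high N c"
  by (auto simp: form_def high_def monomials_def)

lemma high_single: "Poly_Mapping.keys m \<subseteq> {..N} \<Longrightarrow> c \<le> mon_deg m \<Longrightarrow> Poly_Mapping.single m x \<in> high N c"
  by (cases "x = 0") (auto simp: high_def)

lemma psubst_high:
  assumes "\<And>i. i \<le> N \<Longrightarrow> \<sigma> i \<in> form N 1" "p \<in> high N d"
  shows "psubst Const \<sigma> p \<in> high N d"
proof (rule poly_mapping_additive_induct[of _ p])
  fix m assume "m \<in> Poly_Mapping.keys p"
  then have m: "Poly_Mapping.keys m \<subseteq> {..N}" "d \<le> mon_deg m"
    using assms(2) by (auto simp: high_def)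
  then have "Poly_Mapping.single m (Poly_Mapping.lookup p m) \<in> form N (mon_deg m)"
    by (intro form_single) (simp add: monomials_def)
  then show "psubst Const \<sigma> (Poly_Mapping.single m (Poly_Mapping.lookup p m)) \<in> high N d"
    using psubst_form[where \<sigma> = \<sigma>, OF assms(1)] m(2) form_high by blast
qed (simp_all add: Const.psubst_add high_add)

definition hom_comp :: "nat \<Rightarrow> 'k::field mpoly \<Rightarrow> 'k mpoly" where
  "hom_comp d p = (\<Sum>m\<in>{m\<in>Poly_Mapping.keys p. mon_deg m = d}. Poly_Mapping.single m (Poly_Mapping.lookup p m))"

lemma lookup_hom_comp:
  "Poly_Mapping.lookup (hom_comp d p) m = (if mon_deg m = d then Poly_Mapping.lookup p m else 0)"
  by (auto simp: hom_comp_def lookup_sum lookup_single when_def sum.delta in_keys_iff)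

lemma hom_comp_add: "hom_comp d (p + q) = hom_comp d p + hom_comp d q"
  by (rule poly_mapping_eqI) (simp add: lookup_hom_comp lookup_add)

lemma hom_comp_form: "p \<in> poly_ring N \<Longrightarrow> hom_comp d p \<in> form N d"
  by (auto simp: form_def monomials_def poly_ring_def in_keys_iff lookup_hom_comp split: if_splits)

lemma hom_comp_form_eq: "p \<in> form N e \<Longrightarrow> hom_comp d p = (if d = e then p else 0)"
  by (rule poly_mapping_eqI)
    (auto simp: lookup_hom_comp form_def monomials_def in_keys_iff)

lemma hom_comp_psubst:
  assumes "\<And>i. i \<le> N \<Longrightarrow> \<sigma> i \<in> form N 1" "p \<in> poly_ring N"
  shows "hom_comp d (psubst Const \<sigma> p) = psubst Const \<sigma> (hom_comp d p)"
proof (rule poly_mapping_additive_induct[of _ p])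
  fix m assume "m \<in> Poly_Mapping.keys p"
  then have f: "Poly_Mapping.single m (Poly_Mapping.lookup p m) \<in> form N (mon_deg m)"
    using assms(2) by (intro form_single) (auto simp: monomials_def poly_ring_def)
  show "hom_comp d (psubst Const \<sigma> (Poly_Mapping.single m (Poly_Mapping.lookup p m))) =
     psubst Const \<sigma> (hom_comp d (Poly_Mapping.single m (Poly_Mapping.lookup p m)))"
    using hom_comp_form_eq[OF f, of d] hom_comp_form_eq[OF psubst_form[where \<sigma> = \<sigma>, OF assms(1) f], of d] by simp
qed (simp_all add: Const.psubst_add hom_comp_add, simp add: hom_comp_def)

subsection \<open>Order of vanishing at a point\<close>

text \<open>The factor \<open>a 0\<close> is put on x_0 instead of normalising the point by
  division. The coefficients of a shifted polynomial are therefore polynomials in the coordinates of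
  \<open>a\<close>, as the open conditions need; division occurs only in
  \<open>unshift_var\<close>.\<close>

definition shift_var :: "(nat \<Rightarrow> 'k::field) \<Rightarrow> nat \<Rightarrow> 'k mpoly" where
  "shift_var a i = (if i = 0 then Const (a 0) * Var 0 else Var i + Const (a i) * Var 0)"

definition unshift_var :: "(nat \<Rightarrow> 'k::field) \<Rightarrow> nat \<Rightarrow> 'k mpoly" where
  "unshift_var a i = (if i = 0 then Const (1 / a 0) * Var 0 else Var i - Const (a i / a 0) * Var 0)"

text \<open>The substitution \<open>shift a\<close> moves the point \<open>a\<close> to \<open>[1 : 0 : \<dots> : 0]\<close>; the order of vanishing at that
  point is read off from the degrees in \<open>x\<^sub>1, x\<^sub>2, \<dots>\<close>.\<close>
definition shift :: "(nat \<Rightarrow> 'k::field) \<Rightarrow> 'k mpoly \<Rightarrow> 'k mpoly" where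
  "shift a = psubst Const (shift_var a)"

definition unshift :: "(nat \<Rightarrow> 'k::field) \<Rightarrow> 'k mpoly \<Rightarrow> 'k mpoly" where
  "unshift a = psubst Const (unshift_var a)"

lemma form_shift_var: "i \<le> N \<Longrightarrow> shift_var a i \<in> form N 1"
  unfolding shift_var_def by (auto intro!: form_add form_Const_mult form_Var[unfolded One_nat_def])

lemma form_unshift_var: "i \<le> N \<Longrightarrow> unshift_var a i \<in> form N 1"
  unfolding unshift_var_def by (auto intro!: form_diff form_Const_mult form_Var[unfolded One_nat_def])

lemma shift_form: "p \<in> form N d \<Longrightarrow> shift a p \<in> form N d"
  unfolding shift_def by (rule psubst_form) (rule form_shift_var)

lemma shift_high: "p \<in> high N d \<Longrightarrow> shift a p \<in> high N d"
  unfolding shift_def by (rule psubst_high) (rule form_shift_var)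

lemma unshift_high: "p \<in> high N d \<Longrightarrow> unshift a p \<in> high N d"
  unfolding unshift_def by (rule psubst_high) (rule form_unshift_var)

lemma shift_poly_ring: "p \<in> poly_ring N \<Longrightarrow> shift a p \<in> poly_ring N"
  using shift_high[of p N 0] by (simp add: high_0_eq)

lemma hom_comp_shift: "p \<in> poly_ring N \<Longrightarrow> hom_comp d (shift a p) = shift a (hom_comp d p)"
  unfolding shift_def by (rule hom_comp_psubst[where N = N]) (rule form_shift_var)

lemma unshift_shift: "a 0 \<noteq> 0 \<Longrightarrow> unshift a (shift a p) = p"
proof -
  assume a: "a 0 \<noteq> 0"
  have "unshift a (shift_var a i) = Var i" for i
  proof (cases "i = 0")
    case True
    have "Const (a 0) * Const (1 / a 0) = (1 :: 'a mpoly)"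
      using a by (simp add: mult_single)
    then show ?thesis using True
      by (simp add: unshift_def shift_var_def unshift_var_def Const.psubst_mult flip: mult.assoc)
  next
    case False
    have "Const (a i) * Const (1 / a 0) = (Const (a i / a 0) :: 'a mpoly)"
      using a by (simp add: mult_single)
    then show ?thesis using False
      by (simp add: unshift_def shift_var_def unshift_var_def Const.psubst_mult Const.psubst_add flip: mult.assoc)
  qed
  then show ?thesis
    unfolding unshift_def shift_def Const.psubst_psubst by (simp add: psubst_Var)
qed

lemmas shift_simps = Const.psubst_add[of "shift_var a" for a, folded shift_def]
  Const.psubst_mult[of "shift_var a" for a, folded shift_def]
  Const.psubst_power[of "shift_var a" for a, folded shift_def]
  Const.psubst_sum[of "shift_var a" for a, folded shift_def]
  Const.psubst_prod[of "shift_var a" for a, folded shift_def]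
  Const.psubst_diff[of "shift_var a" for a, folded shift_def]

lemma shift_0 [simp]: "shift a 0 = 0"
  by (simp add: shift_def)

lemma shift_1 [simp]: "shift a 1 = 1"
  by (simp add: shift_def)

lemma shift_Const [simp]: "shift a (Const c) = Const c"
  by (simp add: shift_def)

lemma shift_Var [simp]: "shift a (Var i) = shift_var a i"
  by (simp add: shift_def)

section \<open>Order of vanishing at [1 : 0 : ... : 0]\<close>

definition yord :: "nat \<Rightarrow> 'k::field mpoly \<Rightarrow> bool" where
  "yord c p \<longleftrightarrow> Poly_Mapping.keys p \<subseteq> {m. c \<le> ydeg m}"

lemma yord_lookup: "yord c p \<longleftrightarrow> (\<forall>m. ydeg m < c \<longrightarrow> Poly_Mapping.lookup p m = 0)"
  by (auto simp: yord_def in_keys_iff subset_iff not_less[symmetric])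

lemma yord_0_left [simp]: "yord 0 p"
  by (simp add: yord_def)

lemma yord_0 [simp]: "yord c 0"
  by (simp add: yord_def)

lemma yord_add: "yord c p \<Longrightarrow> yord c q \<Longrightarrow> yord c (p + q)"
  unfolding yord_def by (rule keys_add_subset)

lemma yord_diff: "yord c p \<Longrightarrow> yord c q \<Longrightarrow> yord c (p - q)"
  unfolding yord_def by (rule keys_diff_subset)

lemma yord_sum: "(\<And>i. i \<in> S \<Longrightarrow> yord c (f i)) \<Longrightarrow> yord c (\<Sum>i\<in>S. f i)"
  unfolding yord_def by (rule keys_sum_subset)

lemma yord_mult: "yord c p \<Longrightarrow> yord d q \<Longrightarrow> yord (c + d) (p * q)"
  unfolding yord_def by (rule keys_mult_subset) auto

lemma yord_mult_left: "yord c q \<Longrightarrow> yord c (p * q)"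
  using yord_mult[of 0 p c q] by simp

lemma yord_power: "yord c p \<Longrightarrow> yord (n * c) (p ^ n)"
  by (induction n) (auto dest: yord_mult)

lemma yord_mono: "yord c p \<Longrightarrow> d \<le> c \<Longrightarrow> yord d p"
  unfolding yord_def by fastforce

lemma yord_single: "c \<le> ydeg m \<Longrightarrow> yord c (Poly_Mapping.single m x)"
  by (cases "x = 0") (simp_all add: yord_def)

lemma yord_hom_comp: "yord c p \<Longrightarrow> yord c (hom_comp d p)"
  by (simp add: yord_lookup lookup_hom_comp)

text \<open>Restriction to the line through the origin and \<open>a\<close>: the coefficients are the values at \<open>a\<close> of the
  homogeneous components.\<close>
definition restr :: "(nat \<Rightarrow> 'k::field) \<Rightarrow> 'k mpoly \<Rightarrow> 'k poly" where
  "restr a = psubst (\<lambda>c. [:c:]) (\<lambda>i. [:0, a i:])"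

interpretation poly_hom: coeff_hom "\<lambda>c::'k::field. [:c:]"
  by standard simp_all

lemmas restr_simps = poly_hom.psubst_add[of "\<lambda>i. [:0, a i:]" for a, folded restr_def]
  poly_hom.psubst_mult[of "\<lambda>i. [:0, a i:]" for a, folded restr_def]
  poly_hom.psubst_power[of "\<lambda>i. [:0, a i:]" for a, folded restr_def]
  poly_hom.psubst_sum[of "\<lambda>i. [:0, a i:]" for a, folded restr_def]
  poly_hom.psubst_diff[of "\<lambda>i. [:0, a i:]" for a, folded restr_def]

lemma restr_0 [simp]: "restr a 0 = 0"
  by (simp add: restr_def)

lemma restr_Var [simp]: "restr a (Var i) = [:0, a i:]"
  by (simp add: restr_def)

lemma restr_Const [simp]: "restr a (Const c) = [:c:]"
  by (simp add: restr_def)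

lemma monom_val_line: "monom_val (\<lambda>i. [:0, a i:]) m = monom (mon_eval a m) (mon_deg m)"
proof -
  have "(\<Prod>i\<in>S. [:0, a i:] ^ f i) = monom (\<Prod>i\<in>S. a i ^ f i) (\<Sum>i\<in>S. f i)" if "finite S" for S and f :: "nat \<Rightarrow> nat"
    using that
  proof (induction S rule: finite_induct)
    case (insert x F)
    have "[:0, a x:] ^ f x = monom (a x ^ f x) (f x)"
      using monom_power[of "a x" 1 "f x"] by (simp add: monom_Suc monom_0)
    then show ?case using insert by (simp add: mult_monom)
  qed simp
  then show ?thesis by (simp add: monom_val_def mon_eval_def mon_deg_def)
qed

lemma restr_single: "restr a (Poly_Mapping.single m c) = monom (c * mon_eval a m) (mon_deg m)"
  by (simp add: restr_def poly_hom.psubst_single monom_val_line smult_monom)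

lemma hom_vanish_iff: "hom_vanish p a \<longleftrightarrow> restr a p = 0"
proof -
  have "coeff (restr a p) d =
    (\<Sum>m\<in>Poly_Mapping.keys p. if mon_deg m = d then Poly_Mapping.lookup p m * mon_eval a m else 0)" for d
    unfolding restr_def psubst_def monom_val_line
    by (simp add: coeff_sum if_distrib cong: if_cong)
  then show ?thesis by (simp add: hom_vanish_def poly_eq_iff)
qed

lemma restr_eq_shift:
  "restr a p = psubst (\<lambda>c. [:c:]) (\<lambda>i. if i = 0 then [:0, 1:] else 0) (shift a p)"
proof -
  have "psubst (\<lambda>c. [:c:]) (\<lambda>i. if i = 0 then [:0, 1:] else 0) (shift_var a i) = [:0, a i:]" for i
    by (simp add: shift_var_def poly_hom.psubst_add poly_hom.psubst_mult)
  then show ?thesis by (simp add: restr_def shift_def poly_hom.psubst_psubst)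
qed

lemma ydeg_eq_0_iff: "ydeg m = 0 \<longleftrightarrow> m = Poly_Mapping.single 0 (Poly_Mapping.lookup m 0)"
proof
  assume "ydeg m = 0"
  then have "i \<notin> Poly_Mapping.keys m" if "i \<noteq> 0" for i
    using monomial_split[of i m] that by force
  then show "m = Poly_Mapping.single 0 (Poly_Mapping.lookup m 0)"
    by (intro poly_mapping_eqI) (auto simp: lookup_single when_def in_keys_iff)
next
  assume "m = Poly_Mapping.single 0 (Poly_Mapping.lookup m 0)"
  then show "ydeg m = 0" by (metis ydeg_single)
qed

text \<open>After the shift, the line consists of multiples of (1, 0, ..., 0), so every monomial
  containing some x_i with i > 0 dies and only powers of x_0 survive.\<close>

lemma coeff_restr: "coeff (restr a p) d = Poly_Mapping.lookup (shift a p) (Poly_Mapping.single 0 d)"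
proof -
  have "coeff (psubst (\<lambda>c. [:c:]) (\<lambda>i. if i = 0 then [:0, 1:] else 0) q) d = Poly_Mapping.lookup q (Poly_Mapping.single 0 d)"
    for q :: "'a mpoly"
  proof (rule poly_mapping_additive_induct[of _ q])
    fix m
    let ?c = "Poly_Mapping.lookup q m"
    have mv: "monom_val (\<lambda>i. if i = 0 then [:0, 1:] else 0 :: 'a poly) m =
      (if ydeg m = 0 then monom 1 (Poly_Mapping.lookup m 0) else 0)"
    proof (cases "ydeg m = 0")
      case True
      have m: "m = Poly_Mapping.single 0 (Poly_Mapping.lookup m 0)"
        using True ydeg_eq_0_iff by blast
      show ?thesis
        by (subst m, subst monom_val_single) (simp add: True monom_altdef)
    next
      case False
      then obtain i where "i \<in> Poly_Mapping.keys m" "i \<noteq> 0"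
        using ydeg_split1[of 0 m] by (metis Suc_leI bot_nat_0.not_eq_extremum)
      then have "\<exists>i\<in>Poly_Mapping.keys m. (if i = 0 then [:0, 1:] else 0 :: 'a poly) ^ Poly_Mapping.lookup m i = 0"
        by (auto simp: in_keys_iff)
      then show ?thesis using False by (simp add: monom_val_def)
    qed
    show "coeff (psubst (\<lambda>c. [:c:]) (\<lambda>i. if i = 0 then [:0, 1:] else 0) (Poly_Mapping.single m ?c)) d =
      Poly_Mapping.lookup (Poly_Mapping.single m ?c) (Poly_Mapping.single 0 d)"
    proof (cases "ydeg m = 0")
      case True
      then have m: "m = Poly_Mapping.single 0 (Poly_Mapping.lookup m 0)"
        using ydeg_eq_0_iff by blast
      then have "m = Poly_Mapping.single 0 d \<longleftrightarrow> Poly_Mapping.lookup m 0 = d"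
        by (metis lookup_single_eq)
      then show ?thesis by (simp add: poly_hom.psubst_single mv True lookup_single when_def)
    next
      case False
      then have "m \<noteq> Poly_Mapping.single 0 d" by auto
      then show ?thesis by (simp add: poly_hom.psubst_single mv False lookup_single when_def)
    qed
  qed (simp_all add: poly_hom.psubst_add lookup_add)
  then show ?thesis by (simp add: restr_eq_shift)
qed

lemma restr_eq_0_iff: "restr a p = 0 \<longleftrightarrow> yord 1 (shift a p)"
proof -
  have "yord 1 q \<longleftrightarrow> (\<forall>d. Poly_Mapping.lookup q (Poly_Mapping.single 0 d) = 0)" for q :: "'a mpoly"
    unfolding yord_lookup by (metis less_one ydeg_eq_0_iff ydeg_single)
  then show ?thesis by (simp add: poly_eq_iff coeff_restr)
qed

subsection \<open>Powers of ideals\<close>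

lemma ideal_span_mult: "p \<in> ideal_span N S \<Longrightarrow> r \<in> poly_ring N \<Longrightarrow> r * p \<in> ideal_span N S"
proof (induction rule: ideal_span.induct)
  case (gen s r')
  then show ?case using ideal_span.gen[of s S "r * r'" N] by (simp add: poly_ring_mult mult.assoc)
qed (auto simp: distrib_left intro: ideal_span.intros)

lemma ideal_span_mono: "p \<in> ideal_span N S \<Longrightarrow> S \<subseteq> T \<Longrightarrow> p \<in> ideal_span N T"
  by (induction rule: ideal_span.induct) (auto intro: ideal_span.intros)

lemma ideal_span_poly_ring: "p \<in> ideal_span N S \<Longrightarrow> S \<subseteq> poly_ring N \<Longrightarrow> p \<in> poly_ring N"
  by (induction rule: ideal_span.induct) (auto intro: poly_ring_add poly_ring_mult)

lemma ideal_pow_0 [simp]: "0 \<in> ideal_pow N I b"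
  by (cases b) (auto intro: ideal_span.intros)

lemma ideal_pow_add: "p \<in> ideal_pow N I b \<Longrightarrow> q \<in> ideal_pow N I b \<Longrightarrow> p + q \<in> ideal_pow N I b"
  by (cases b) (auto intro: ideal_span.intros poly_ring_add)

lemma ideal_pow_sum: "(\<And>i. i \<in> S \<Longrightarrow> f i \<in> ideal_pow N I b) \<Longrightarrow> (\<Sum>i\<in>S. f i) \<in> ideal_pow N I b"
  by (induction S rule: infinite_finite_induct) (auto intro: ideal_pow_add)

lemma ideal_pow_mult: "r \<in> poly_ring N \<Longrightarrow> p \<in> ideal_pow N I b \<Longrightarrow> r * p \<in> ideal_pow N I b"
  by (cases b) (auto intro: ideal_span_mult poly_ring_mult)

lemma ideal_pow_Suc_mult: "p \<in> I \<Longrightarrow> q \<in> ideal_pow N I b \<Longrightarrow> p * q \<in> ideal_pow N I (Suc b)"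
  using ideal_span.gen[of "p * q" "{p * q |p q. p \<in> I \<and> q \<in> ideal_pow N I b}" 1 N] by auto

lemma ideal_pow_mono:
  assumes "I \<subseteq> J"
  shows "ideal_pow N I b \<subseteq> ideal_pow N J b"
proof (induction b)
  case (Suc b)
  then show ?case using assms by (auto elim!: ideal_span_mono)
qed simp

lemma ideal_pow_poly_ring:
  assumes "I \<subseteq> poly_ring N"
  shows "ideal_pow N I b \<subseteq> poly_ring N"
proof (induction b)
  case (Suc b)
  then show ?case using assms by (auto elim!: ideal_span_poly_ring intro!: poly_ring_mult)
qed simp

lemma ideal_pow_induct [consumes 1, case_names zero prod add]:
  assumes "p \<in> ideal_pow N I (Suc b)"
    and "P 0" "\<And>x q. x \<in> I \<Longrightarrow> q \<in> ideal_pow N I b \<Longrightarrow> P (x * q)" "\<And>p q. P p \<Longrightarrow> P q \<Longrightarrow> P (p + q)"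
  shows "P p"
proof -
  have "p \<in> ideal_span N {p * q |p q. p \<in> I \<and> q \<in> ideal_pow N I b}"
    using assms(1) by simp
  then show ?thesis
  proof (induction rule: ideal_span.induct)
    case (gen s r)
    then obtain x q where "s = x * q" "x \<in> I" "q \<in> ideal_pow N I b" by auto
    then show ?case using assms(3)[of x "r * q"] ideal_pow_mult[OF gen(2)] by (simp add: mult_ac)
  qed (auto intro: assms)
qed

lemma yord_ideal_pow:
  assumes "\<And>p. p \<in> I \<Longrightarrow> yord 1 (shift a p)" "p \<in> ideal_pow N I c"
  shows "yord c (shift a p)"
  using assms(2)
proof (induction c arbitrary: p)
  case (Suc c)
  show ?case using Suc.prems
  proof (induction rule: ideal_pow_induct)
    case (prod x q)
    then show ?case
      using yord_mult[OF assms(1) Suc.IH, of x q] by (simp add: shift_simps)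
  qed (simp_all add: shift_simps yord_add)
qed simp

lemma points_ideal_iff: "p \<in> points_ideal N P \<longleftrightarrow> p \<in> poly_ring N \<and> (\<forall>a\<in>P. restr a p = 0)"
  by (simp add: points_ideal_def hom_vanish_iff)

lemma unshift_var_vanish: "a 0 \<noteq> 0 \<Longrightarrow> i \<noteq> 0 \<Longrightarrow> restr a (unshift_var a i) = 0"
  by (simp add: unshift_var_def restr_simps)

text \<open>Converse of \<open>yord_ideal_pow\<close> for a single point. A monomial of the shifted
  polynomial contains at least c variables x_i with i > 0, and \<open>unshift\<close> turns each of
  them into a linear form vanishing at \<open>a\<close>.\<close>

lemma ideal_pow_point:
  assumes "a 0 \<noteq> 0" "p \<in> poly_ring N" "yord c (shift a p)"
  shows "p \<in> ideal_pow N (points_ideal N {a}) c"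
proof -
  let ?I = "points_ideal N {a}"
  have mon: "monom_val (unshift_var a) m \<in> ideal_pow N ?I c" if "Poly_Mapping.keys m \<subseteq> {..N}" "c \<le> ydeg m" for m c
    using that
  proof (induction c arbitrary: m)
    case 0
    then show ?case using form_poly_ring[OF form_monom_val[of m "unshift_var a" N]] form_unshift_var by auto
  next
    case (Suc c)
    obtain i m' where m': "i \<in> Poly_Mapping.keys m" "i \<noteq> 0" "m = Poly_Mapping.single i 1 + m'" "c \<le> ydeg m'"
      using ydeg_split1[OF Suc.prems(2)] by metis
    have "monom_val (unshift_var a) m' \<in> ideal_pow N ?I c"
      using Suc.prems m' by (intro Suc.IH) (auto simp: keys_add_nat)
    moreover have "unshift_var a i \<in> ?I"
      using m'(1,2) Suc.prems(1) assms(1)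
      by (auto simp: points_ideal_iff unshift_var_vanish intro!: form_poly_ring[OF form_unshift_var])
    ultimately show ?case unfolding m'(3) monom_val_add
      using ideal_pow_Suc_mult by (simp del: ideal_pow.simps)
  qed
  have "unshift a (shift a p) \<in> ideal_pow N ?I c"
  proof (rule poly_mapping_additive_induct[of _ "shift a p"])
    fix m assume m: "m \<in> Poly_Mapping.keys (shift a p)"
    then have "monom_val (unshift_var a) m \<in> ideal_pow N ?I c"
      using assms(3) shift_poly_ring[OF assms(2), of a]
      by (intro mon) (auto simp: yord_def poly_ring_iff)
    then show "unshift a (Poly_Mapping.single m (Poly_Mapping.lookup (shift a p) m)) \<in> ideal_pow N ?I c"
      by (simp add: unshift_def Const.psubst_single ideal_pow_mult)
  qed (simp_all add: unshift_def Const.psubst_add ideal_pow_add)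
  then show ?thesis using unshift_shift[of a p, OF assms(1)] by simp
qed

declare ideal_pow.simps(2) [simp del]

lemma mon_eval_0 [simp]: "mon_eval a 0 = 1"
  by (simp add: mon_eval_eq)

subsection \<open>Symbolic powers in high degree\<close>

lemma high_Var: "i \<le> N \<Longrightarrow> Var i \<in> high N 1"
  by (rule form_high[OF form_Var]) simp_all

lemma single_add_eq_Var_mult:
  "Poly_Mapping.single (Poly_Mapping.single i 1 + m) c = Var i * Poly_Mapping.single m c"
  by (simp add: Var_def mult_single)

lemma high_Suc_induct [consumes 1, case_names zero add var]:
  assumes "h \<in> high N (Suc c)" "P 0" "\<And>p q. P p \<Longrightarrow> P q \<Longrightarrow> P (p + q)"
    and "\<And>i h'. i \<le> N \<Longrightarrow> h' \<in> high N c \<Longrightarrow> P (Var i * h')"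
  shows "P h"
proof (rule poly_mapping_additive_induct[of _ h])
  fix m assume "m \<in> Poly_Mapping.keys h"
  then have m: "Poly_Mapping.keys m \<subseteq> {..N}" "Suc c \<le> mon_deg m"
    using assms(1) by (auto simp: high_def)
  obtain i m' where i: "i \<in> Poly_Mapping.keys m" "m = Poly_Mapping.single i 1 + m'" "c \<le> mon_deg m'"
    using mon_deg_split1[OF m(2)] by metis
  have "Poly_Mapping.keys m' \<subseteq> {..N}"
    using m(1) unfolding i(2) keys_add_nat by blast
  then have "P (Var i * Poly_Mapping.single m' (Poly_Mapping.lookup h m))"
    using i m(1) by (intro assms(4) high_single) auto
  then show "P (Poly_Mapping.single m (Poly_Mapping.lookup h m))"
    unfolding i(2) single_add_eq_Var_mult .
qed (use assms in auto)

text \<open>After the shift every monomial contains some x_i with i > 0; split it off and shift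
  back. The cofactors lose exactly one degree, so \<open>decompose\<close> still applies to them
  when e = r.\<close>

lemma split_at_point:
  assumes p: "p \<in> high N (Suc e)" and a: "a 0 \<noteq> 0" and van: "restr a p = 0"
  obtains G where "\<And>i. G i \<in> high N e" "p = (\<Sum>i\<in>{1..N}. unshift_var a i * G i)"
proof -
  let ?P = "\<lambda>q. \<exists>G. (\<forall>i. G i \<in> high N e) \<and> unshift a q = (\<Sum>i\<in>{1..N}. unshift_var a i * G i)"
  have "?P (shift a p)"
  proof (rule poly_mapping_additive_induct[of _ "shift a p"])
    show "?P 0"
      by (intro exI[of _ "\<lambda>_. 0"]) (simp add: unshift_def)
  next
    fix p q assume "?P p" "?P q"
    then obtain G H where "\<forall>i. G i \<in> high N e" "unshift a p = (\<Sum>i\<in>{1..N}. unshift_var a i * G i)"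
      "\<forall>i. H i \<in> high N e" "unshift a q = (\<Sum>i\<in>{1..N}. unshift_var a i * H i)" by auto
    then show "?P (p + q)"
      by (intro exI[of _ "\<lambda>i. G i + H i"])
        (simp add: unshift_def Const.psubst_add high_add distrib_left sum.distrib)
  next
    fix m assume m: "m \<in> Poly_Mapping.keys (shift a p)"
    let ?c = "Poly_Mapping.lookup (shift a p) m"
    have "Suc 0 \<le> ydeg m" using m van by (auto simp: restr_eq_0_iff yord_def)
    then obtain i m' where i: "i \<in> Poly_Mapping.keys m" "i \<noteq> 0" "m = Poly_Mapping.single i 1 + m'"
      using ydeg_split1[of 0 m] by metis
    have k: "Poly_Mapping.keys m \<subseteq> {..N}" "Suc e \<le> mon_deg m"
      using m shift_high[OF p, of a] by (auto simp: high_def)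
    have "Poly_Mapping.single m' ?c \<in> high N e"
      using k unfolding i(3) keys_add_nat by (intro high_single) simp_all
    then have G: "unshift a (Poly_Mapping.single m' ?c) \<in> high N e" (is "?G \<in> _") by (rule unshift_high)
    have "unshift a (Poly_Mapping.single m ?c) = unshift_var a i * ?G"
      unfolding i(3) single_add_eq_Var_mult by (simp add: unshift_def Const.psubst_mult)
    also have "\<dots> = (\<Sum>j\<in>{1..N}. unshift_var a j * (if j = i then ?G else 0))"
    proof -
      have "i \<in> {1..N}" using i(1,2) k(1) by auto
      then show ?thesis by (simp add: if_distrib sum.delta cong: if_cong)
    qed
    finally show "?P (Poly_Mapping.single m ?c)"
      using G by (intro exI[of _ "\<lambda>j. if j = i then ?G else 0"]) auto
  qed
  then show ?thesis using that unshift_shift[of a p, OF a] by auto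
qed

lemma ideal_pow_mult_pow:
  "x \<in> ideal_pow N I a \<Longrightarrow> y \<in> ideal_pow N I b \<Longrightarrow> x * y \<in> ideal_pow N I (a + b)"
proof (induction a arbitrary: x)
  case 0
  then show ?case by (simp add: ideal_pow_mult)
next
  case (Suc a)
  from Suc.prems(1) show ?case
  proof (induction rule: ideal_pow_induct)
    case (prod z q)
    then show ?case using ideal_pow_Suc_mult[OF prod(1) Suc.IH[OF prod(2) Suc.prems(2)]]
      by (simp add: mult.assoc)
  qed (simp_all add: distrib_right ideal_pow_add)
qed

lemma ideal_pow_gen: "x \<in> I \<Longrightarrow> x \<in> ideal_pow N I (Suc 0)"
  using ideal_pow_Suc_mult[of x I 1 N 0] by simp

text \<open>Such a u is a unit near the point. If h has order e, then u h and x_0^r h agree up to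
  order e + 1, and multiplication by x_0^r does not change \<open>ydeg\<close>; so the order of h
  can be raised step by step up to b.\<close>

lemma yord_cancel:
  assumes u: "yord 1 (u - Poly_Mapping.single (Poly_Mapping.single 0 r) 1)" and uh: "yord b (u * h)"
  shows "yord b h"
proof -
  have "e \<le> b \<Longrightarrow> yord e h" for e
  proof (induction e)
    case (Suc e)
    let ?x = "Poly_Mapping.single (Poly_Mapping.single 0 r) (1::'a)"
    have "yord (Suc e) (u * h)" by (rule yord_mono[OF uh Suc.prems])
    moreover have "yord (1 + e) ((u - ?x) * h)" using Suc by (intro yord_mult[OF u]) simp
    ultimately have "yord (Suc e) (u * h - (u - ?x) * h)" by (simp add: yord_diff)
    then have x: "yord (Suc e) (?x * h)" by (simp add: algebra_simps)
    show ?case unfolding yord_lookup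
    proof (intro allI impI)
      fix m assume "ydeg m < Suc e"
      then have "Poly_Mapping.lookup (?x * h) (Poly_Mapping.single 0 r + m) = 0"
        using x by (simp add: yord_lookup)
      then show "Poly_Mapping.lookup h m = 0" by (simp add: lookup_single_mult_add)
    qed
  qed simp
  then show ?thesis by simp
qed

lemma yord_1_power_diff:
  assumes "yord 1 (u - Poly_Mapping.single (Poly_Mapping.single 0 r) 1)"
  shows "yord 1 (u ^ n - Poly_Mapping.single (Poly_Mapping.single 0 (n * r)) (1::'k::field))"
proof (induction n)
  case (Suc n)
  let ?x = "\<lambda>r. Poly_Mapping.single (Poly_Mapping.single 0 r) (1::'k)"
  have x: "?x (r + n * r) = ?x r * ?x (n * r)" by (simp add: mult_single flip: single_add)
  have "u ^ Suc n - ?x (Suc n * r) = u * (u ^ n - ?x (n * r)) + ?x (n * r) * (u - ?x r)"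
    by (simp add: x algebra_simps)
  then show ?case using assms Suc by (simp only: yord_add yord_mult_left)
qed simp

text \<open>By \<open>coeff_restr\<close>, the coefficient in \<open>u_val\<close> is the value of
  \<open>u i\<close> at the representative \<open>A j\<close>.\<close>

locale separated_points =
  fixes N s r :: nat and A :: "nat \<Rightarrow> nat \<Rightarrow> 'k::field" and u :: "nat \<Rightarrow> 'k mpoly"
  assumes A0: "i < s \<Longrightarrow> A i 0 \<noteq> 0"
    and u_form: "i < s \<Longrightarrow> u i \<in> form N r"
    and u_val: "i < s \<Longrightarrow> j < s \<Longrightarrow>
      Poly_Mapping.lookup (shift (A j) (u i)) (Poly_Mapping.single 0 r) = (if i = j then 1 else 0)"
begin

lemma restr_u: "i < s \<Longrightarrow> j < s \<Longrightarrow> restr (A j) (u i) = (if i = j then monom 1 r else 0)"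
proof (rule poly_eqI)
  fix d assume ij: "i < s" "j < s"
  show "coeff (restr (A j) (u i)) d = coeff (if i = j then monom 1 r else 0) d"
  proof (cases "d = r")
    case False
    have "Poly_Mapping.single 0 d \<notin> Poly_Mapping.keys (shift (A j) (u i))"
      using shift_form[OF u_form[OF ij(1)], of "A j"] False by (auto simp: form_def monomials_def)
    then show ?thesis using False by (simp add: coeff_restr in_keys_iff)
  qed (use u_val ij in \<open>simp add: coeff_restr\<close>)
qed

lemma u_poly_ring: "i < s \<Longrightarrow> u i \<in> poly_ring N"
  using u_form form_poly_ring by blast

text \<open>The values of a form of degree r at proportional vectors differ by the factor c^r,
  whereas \<open>u j\<close> is 1 at \<open>A j\<close> and 0 at \<open>A i\<close>.\<close>

lemma not_proportional:
  assumes "i < s" "j < s" "i \<noteq> j"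
  shows "\<not> (\<exists>c. \<forall>k\<le>N. A i k = c * A j k)"
proof
  assume "\<exists>c. \<forall>k\<le>N. A i k = c * A j k"
  then obtain c where c: "\<And>k. k \<le> N \<Longrightarrow> A i k = c * A j k" by auto
  have "c \<noteq> 0" using c[of 0] A0[OF assms(1)] by auto
  have "restr (A i) (u j) = [:c ^ r:] * restr (A j) (u j)"
    unfolding restr_def psubst_def monom_val_line sum_distrib_left
  proof (rule sum.cong[OF refl])
    fix m assume "m \<in> Poly_Mapping.keys (u j)"
    then have m: "Poly_Mapping.keys m \<subseteq> {..N}" "mon_deg m = r"
      using u_form[OF assms(2)] by (auto simp: form_def monomials_def)
    have "mon_eval (A i) m = (\<Prod>k\<in>Poly_Mapping.keys m. c ^ Poly_Mapping.lookup m k * A j k ^ Poly_Mapping.lookup m k)"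
      unfolding mon_eval_def using m(1) c by (intro prod.cong) (auto simp: power_mult_distrib)
    also have "\<dots> = c ^ mon_deg m * mon_eval (A j) m"
      by (simp add: prod.distrib mon_eval_def mon_deg_def power_sum)
    finally show "[:Poly_Mapping.lookup (u j) m:] * monom (mon_eval (A i) m) (mon_deg m) =
      [:c ^ r:] * ([:Poly_Mapping.lookup (u j) m:] * monom (mon_eval (A j) m) (mon_deg m))"
      using m(2) by (simp add: smult_monom mult_ac)
  qed
  then show False using restr_u assms \<open>c \<noteq> 0\<close> by (simp add: smult_monom)
qed

lemma split_Var:
  assumes "i < s" "j < s" "i \<noteq> j" "k \<le> N"
  obtains \<alpha> \<beta> where "\<alpha> \<in> high N 1" "\<beta> \<in> high N 1" "restr (A i) \<alpha> = 0" "restr (A j) \<beta> = 0" "Var k = \<alpha> + \<beta>"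
proof -
  have "\<not> (\<forall>l\<le>N. A j l = (A j 0 / A i 0) * A i l)"
    using not_proportional[OF assms(2,1)] assms(3) by metis
  then obtain l where l: "l \<le> N" "A j l \<noteq> (A j 0 / A i 0) * A i l" by auto
  define \<delta> where "\<delta> = A i 0 * A j l - A i l * A j 0"
  have \<delta>: "\<delta> \<noteq> 0" using l(2) A0[OF assms(1)] by (auto simp: \<delta>_def field_simps)
  \<comment> \<open>A linear form vanishing at \<open>A i\<close> with value \<open>\<delta>\<close>
    at \<open>A j\<close>; scaled, it takes the value of x_k at \<open>A j\<close>.\<close>
  define \<tau> where "\<tau> = Const (A i 0) * Var l - Const (A i l) * Var 0"
  have \<tau>: "\<tau> \<in> form N 1"
    unfolding \<tau>_def using l by (intro form_diff form_Const_mult form_Var) auto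
  have \<alpha>: "Const (A j k / \<delta>) * \<tau> \<in> form N 1" by (rule form_Const_mult[OF \<tau>])
  show ?thesis
  proof (rule that)
    show "Const (A j k / \<delta>) * \<tau> \<in> high N 1" using form_high[OF \<alpha>] by simp
    show "Var k - Const (A j k / \<delta>) * \<tau> \<in> high N 1"
      using form_high[OF form_diff[OF form_Var[OF assms(4)] \<alpha>]] by simp
    show "restr (A i) (Const (A j k / \<delta>) * \<tau>) = 0" by (simp add: restr_simps \<tau>_def)
    have "restr (A j) \<tau> = [:0, \<delta>:]" by (simp add: restr_simps \<tau>_def \<delta>_def)
    then show "restr (A j) (Var k - Const (A j k / \<delta>) * \<tau>) = 0" using \<delta> by (simp add: restr_simps)
  qed simp
qed

abbreviation I where "I \<equiv> points_ideal N (A ` {..<s})"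

text \<open>The degree bound lets \<open>split_at_point\<close> produce cofactors of degree at least
  r, to which \<open>decompose\<close> applies. This is what makes \<open>V_mult_u\<close>
  work.\<close>

definition V where "V = I \<inter> high N (r + 1)"

lemma I_iff: "p \<in> I \<longleftrightarrow> p \<in> poly_ring N \<and> (\<forall>i<s. restr (A i) p = 0)"
  by (auto simp: points_ideal_iff)

lemma V_iff: "p \<in> V \<longleftrightarrow> p \<in> high N (r + 1) \<and> (\<forall>i<s. restr (A i) p = 0)"
  using high_poly_ring by (auto simp: V_def I_iff)

lemma u_mult_V: "i < s \<Longrightarrow> y \<in> high N 1 \<Longrightarrow> restr (A i) y = 0 \<Longrightarrow> u i * y \<in> V"
  using high_mult[OF form_high[OF u_form], of i r y 1] by (auto simp: V_iff restr_simps restr_u)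

text \<open>Interpolation: a monomial of degree r minus the combination of the \<open>u q\<close>
  weighted by its values at the points vanishes at all of them. Split such a monomial off every
  term; the remaining factor goes into v and c.\<close>

lemma decompose:
  assumes "p \<in> high N (r + e)"
  obtains v c where "v \<in> I" "v \<in> high N (r + e)" "\<And>q. c q \<in> high N e" "p = v + (\<Sum>q<s. u q * c q)"
proof -
  let ?P = "\<lambda>p. \<exists>v c. v \<in> I \<and> v \<in> high N (r + e) \<and> (\<forall>q. c q \<in> high N e) \<and> p = v + (\<Sum>q<s. u q * c q)"
  have "?P p"
  proof (rule poly_mapping_additive_induct[of _ p])
    show "?P 0" by (intro exI[of _ 0] exI[of _ "\<lambda>_. 0"]) (simp add: I_iff)
  next
    fix p q assume "?P p" "?P q"
    from \<open>?P p\<close> obtain v c where "v \<in> I" "v \<in> high N (r + e)" "\<forall>q. c q \<in> high N e" "p = v + (\<Sum>q<s. u q * c q)"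
      by blast
    moreover from \<open>?P q\<close> obtain v' c' where "v' \<in> I" "v' \<in> high N (r + e)" "\<forall>q. c' q \<in> high N e"
      "q = v' + (\<Sum>q<s. u q * c' q)"
      by blast
    ultimately show "?P (p + q)"
      by (intro exI[of _ "v + v'"] exI[of _ "\<lambda>q. c q + c' q"])
        (auto simp: I_iff restr_simps distrib_left sum.distrib intro: high_add poly_ring_add)
  next
    fix m assume "m \<in> Poly_Mapping.keys p"
    then have m: "Poly_Mapping.keys m \<subseteq> {..N}" "r + e \<le> mon_deg m"
      using assms by (auto simp: high_def)
    obtain m1 m2 where m12: "m = m1 + m2" "mon_deg m1 = r"
      using mon_deg_split[of r m] m(2) by auto
    have m1: "m1 \<in> monomials N r" and m2: "Poly_Mapping.keys m2 \<subseteq> {..N}" "e \<le> mon_deg m2"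
      using m m12 by (auto simp: monomials_def keys_add_nat)
    define k where "k q = mon_eval (A q) m1" for q
    let ?s = "Poly_Mapping.single m2 (Poly_Mapping.lookup p m)"
    define w where "w = Poly_Mapping.single m1 1 - (\<Sum>q<s. Const (k q) * u q)"
    have w: "w \<in> form N r"
      unfolding w_def using m1 u_form by (intro form_diff form_single form_sum form_Const_mult) auto
    have "restr (A i) w = 0" if "i < s" for i
      using that m12(2)
      by (simp add: w_def restr_simps restr_single restr_u k_def if_distrib sum.delta mult_monom cong: if_cong)
    then have wI: "w \<in> I" using form_poly_ring[OF w] by (auto simp: I_iff)
    have s: "?s \<in> high N e" by (rule high_single[OF m2])
    show "?P (Poly_Mapping.single m (Poly_Mapping.lookup p m))"
    proof (intro exI conjI allI)
      show "w * ?s \<in> I" using wI high_poly_ring[OF s] by (auto simp: I_iff restr_simps poly_ring_mult)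
      show "w * ?s \<in> high N (r + e)" by (rule high_mult[OF form_high[OF w] s]) simp
      show "Const (k q) * ?s \<in> high N e" for q by (rule high_mult_left[OF _ s]) simp
      have "Poly_Mapping.single m (Poly_Mapping.lookup p m) = Poly_Mapping.single m1 1 * ?s"
        by (simp add: mult_single m12(1))
      also have "\<dots> = w * ?s + (\<Sum>q<s. Const (k q) * u q) * ?s"
        by (simp add: w_def left_diff_distrib)
      finally show "Poly_Mapping.single m (Poly_Mapping.lookup p m) = w * ?s + (\<Sum>q<s. u q * (Const (k q) * ?s))"
        by (simp add: sum_distrib_left sum_distrib_right mult_ac)
    qed
  qed
  then show ?thesis using that by blast
qed

text \<open>Write \<open>g\<close> as a combination of forms vanishing at \<open>A p\<close>, and reduce the coefficients modulo \<open>I\<close> by means of the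
  \<open>u q\<close>. The mixed terms lie in \<open>V\<^sup>2\<close>, since every linear form is a sum of two that vanish at \<open>A p\<close> and \<open>A q\<close>.\<close>
lemma V_mult_u:
  assumes g: "g \<in> V" and p: "p < s" and k: "k \<le> N"
  obtains S lam where "S \<in> ideal_pow N V 2" "lam \<in> high N 1" "restr (A p) lam = 0"
    "g * (u p * Var k) = S + (u p * lam) * (u p * Var k)"
proof -
  let ?y = "unshift_var (A p)"
  obtain G where G: "\<And>i. G i \<in> high N r" "g = (\<Sum>i\<in>{1..N}. ?y i * G i)"
    using split_at_point[of g N r "A p"] g A0[OF p] p by (auto simp: V_iff)
  have "\<exists>v c. v \<in> I \<and> v \<in> high N r \<and> (\<forall>q. c q \<in> poly_ring N) \<and> G i = v + (\<Sum>q<s. u q * c q)" for i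
  proof -
    have "G i \<in> high N (r + 0)" using G(1) by simp
    then obtain v c where "v \<in> I" "v \<in> high N (r + 0)" "\<And>q. c q \<in> high N 0" "G i = v + (\<Sum>q<s. u q * c q)"
      by (rule decompose) blast
    then show ?thesis by (intro exI[of _ v] exI[of _ c]) (simp add: high_0_eq)
  qed
  then have "\<forall>i. \<exists>v c. v \<in> I \<and> v \<in> high N r \<and> (\<forall>q. c q \<in> poly_ring N) \<and> G i = v + (\<Sum>q<s. u q * c q)"
    by blast
  from choice[OF this] obtain v where
    "\<forall>i. \<exists>c. v i \<in> I \<and> v i \<in> high N r \<and> (\<forall>q. c q \<in> poly_ring N) \<and> G i = v i + (\<Sum>q<s. u q * c q)"
    by blast
  from choice[OF this] obtain c where
    "\<forall>i. v i \<in> I \<and> v i \<in> high N r \<and> (\<forall>q. c i q \<in> poly_ring N) \<and> G i = v i + (\<Sum>q<s. u q * c i q)"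
    by blast
  then have vc: "\<And>i. v i \<in> I" "\<And>i. v i \<in> high N r" "\<And>i q. c i q \<in> poly_ring N"
    "\<And>i. G i = v i + (\<Sum>q<s. u q * c i q)" by blast+
  define lam where "lam q = (\<Sum>i\<in>{1..N}. ?y i * c i q)" for q
  have y: "?y i \<in> high N 1" if "i \<in> {1..N}" for i
    using that by (intro form_high[OF form_unshift_var]) auto
  have lam_high: "lam q \<in> high N 1" for q
    unfolding lam_def by (intro high_sum) (subst mult.commute, rule high_mult_left[OF vc(3) y])
  have y_van: "restr (A p) (?y i) = 0" if "i \<in> {1..N}" for i
    using that unshift_var_vanish[of "A p" i] A0[OF p] by simp
  have lam_p: "restr (A p) (lam q) = 0" for q
    unfolding lam_def using y_van by (simp add: restr_simps)
  have g_eq: "g = (\<Sum>i\<in>{1..N}. ?y i * v i) + (\<Sum>q<s. u q * lam q)"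
  proof -
    have "(\<Sum>i\<in>{1..N}. ?y i * (\<Sum>q<s. u q * c i q)) = (\<Sum>q<s. u q * lam q)"
      unfolding lam_def sum_distrib_left by (subst sum.swap) (simp add: mult_ac)
    then show ?thesis unfolding G(2) vc(4) by (simp add: distrib_left sum.distrib)
  qed
  \<comment> \<open>At \<open>A q\<close> all \<open>v i\<close> and all other
    \<open>u\<close>-forms vanish, while \<open>u q\<close> restricts to a nonzero monomial, so its
    cofactor must vanish there as well.\<close>
  have lam_q: "restr (A q) (lam q) = 0" if "q < s" for q
  proof -
    have "0 = restr (A q) g" using g that by (simp add: V_iff)
    also have "\<dots> = monom 1 r * restr (A q) (lam q)"
      using vc(1) that
      by (simp add: g_eq restr_simps I_iff restr_u if_distrib[of "\<lambda>x. x * _"] sum.delta cong: if_cong)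
    finally show ?thesis by simp
  qed
  define S where "S = (\<Sum>i\<in>{1..N}. (u p * ?y i) * (Var k * v i)) + (\<Sum>q\<in>{..<s} - {p}. u p * u q * Var k * lam q)"
  have V2: "x * y \<in> ideal_pow N V 2" if "x \<in> V" "y \<in> V" for x y
    using ideal_pow_mult_pow[OF ideal_pow_gen[OF that(1)] ideal_pow_gen[OF that(2)]]
    by (simp add: numeral_2_eq_2)
  have "S \<in> ideal_pow N V 2"
    unfolding S_def
  proof (intro ideal_pow_add ideal_pow_sum)
    fix i assume i: "i \<in> {1..N}"
    show "u p * ?y i * (Var k * v i) \<in> ideal_pow N V 2"
    proof (rule V2)
      show "u p * ?y i \<in> V" by (rule u_mult_V[OF p y[OF i] y_van[OF i]])
      show "Var k * v i \<in> V"
        using high_mult[OF high_Var[OF k] vc(2)] vc(1) by (simp add: V_iff I_iff restr_simps)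
    qed
  next
    fix q assume q: "q \<in> {..<s} - {p}"
    obtain \<alpha> \<beta> where ab: "\<alpha> \<in> high N 1" "\<beta> \<in> high N 1" "restr (A p) \<alpha> = 0" "restr (A q) \<beta> = 0" "Var k = \<alpha> + \<beta>"
      using split_Var[of p q k] p q k by auto
    \<comment> \<open>\<open>lam q\<close> vanishes at both points, so it can be paired with either
      \<open>u p\<close> or \<open>u q\<close>, and the matching part of x_k goes with the
      other.\<close>
    have "(u p * \<alpha>) * (u q * lam q) + (u p * lam q) * (u q * \<beta>) \<in> ideal_pow N V 2"
      using ab lam_p lam_q lam_high p q by (intro ideal_pow_add V2 u_mult_V) auto
    then show "u p * u q * Var k * lam q \<in> ideal_pow N V 2"
      unfolding ab(5) by (simp add: algebra_simps)
  qed
  moreover have "g * (u p * Var k) = S + (u p * lam p) * (u p * Var k)"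
  proof -
    have "(\<Sum>q<s. u q * lam q) = (\<Sum>q\<in>{..<s} - {p}. u q * lam q) + u p * lam p"
      using p by (simp add: sum.remove[of "{..<s}" p] add.commute)
    then show ?thesis unfolding g_eq S_def
      by (simp add: distrib_left distrib_right sum_distrib_left sum_distrib_right mult_ac)
  qed
  ultimately show ?thesis using that lam_high lam_p by blast
qed

text \<open>The normal forms aimed at. The exponent of \<open>u p\<close> must reach n, since only
  then can n vanishing factors of h be distributed over the copies of \<open>u p\<close>. Degree at
  least n of h leaves a variable to go with each copy; these variables drive the rewriting by
  \<open>V_mult_u\<close> and \<open>split_Var\<close>.\<close>

definition Qp where
  "Qp p n x \<longleftrightarrow> (\<exists>v h. v \<in> ideal_pow N V n \<and> h \<in> high N n \<and> x = v + u p ^ n * h)"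

definition Q where
  "Q n x \<longleftrightarrow> (\<exists>v h. v \<in> ideal_pow N V n \<and> (\<forall>p. h p \<in> high N n) \<and> x = v + (\<Sum>p<s. u p ^ n * h p))"

lemma Qp_add: "Qp p n x \<Longrightarrow> Qp p n y \<Longrightarrow> Qp p n (x + y)"
  unfolding Qp_def
proof (elim exE conjE)
  fix v h v' h'
  assume "v \<in> ideal_pow N V n" "h \<in> high N n" "x = v + u p ^ n * h"
    "v' \<in> ideal_pow N V n" "h' \<in> high N n" "y = v' + u p ^ n * h'"
  then show "\<exists>v h. v \<in> ideal_pow N V n \<and> h \<in> high N n \<and> x + y = v + u p ^ n * h"
    by (intro exI[of _ "v + v'"] exI[of _ "h + h'"]) (simp add: ideal_pow_add high_add distrib_left)
qed

lemma Q_add: "Q n x \<Longrightarrow> Q n y \<Longrightarrow> Q n (x + y)"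
  unfolding Q_def
proof (elim exE conjE)
  fix v h v' h'
  assume "v \<in> ideal_pow N V n" "\<forall>p. h p \<in> high N n" "x = v + (\<Sum>p<s. u p ^ n * h p)"
    "v' \<in> ideal_pow N V n" "\<forall>p. h' p \<in> high N n" "y = v' + (\<Sum>p<s. u p ^ n * h' p)"
  then show "\<exists>v h. v \<in> ideal_pow N V n \<and> (\<forall>p. h p \<in> high N n) \<and> x + y = v + (\<Sum>p<s. u p ^ n * h p)"
    by (intro exI[of _ "v + v'"] exI[of _ "\<lambda>p. h p + h' p"])
      (simp add: ideal_pow_add high_add distrib_left sum.distrib)
qed

lemma Qp_pow: "v \<in> ideal_pow N V n \<Longrightarrow> Qp p n v"
  unfolding Qp_def by (intro exI[of _ v] exI[of _ 0]) simp

lemma Q_pow: "v \<in> ideal_pow N V n \<Longrightarrow> Q n v"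
  unfolding Q_def by (intro exI[of _ v] exI[of _ "\<lambda>_. 0"]) simp

lemma Q_sum: "(\<And>i. i \<in> T \<Longrightarrow> Q n (f i)) \<Longrightarrow> Q n (\<Sum>i\<in>T. f i)"
  by (induction T rule: infinite_finite_induct) (auto intro: Q_add Q_pow)

lemma Qp_imp_Q: "Qp p n x \<Longrightarrow> p < s \<Longrightarrow> Q n x"
  unfolding Qp_def Q_def
proof (elim exE conjE)
  fix v h assume "v \<in> ideal_pow N V n" "h \<in> high N n" "x = v + u p ^ n * h" "p < s"
  then show "\<exists>v h. v \<in> ideal_pow N V n \<and> (\<forall>p. h p \<in> high N n) \<and> x = v + (\<Sum>p<s. u p ^ n * h p)"
    by (intro exI[of _ v] exI[of _ "\<lambda>q. if q = p then h else 0"])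
      (simp add: if_distrib sum.delta cong: if_cong)
qed

text \<open>Take one factor x of g, one \<open>u p\<close> and one variable of h, and rewrite x (u
  p) x_k by \<open>V_mult_u\<close>. The part in V^2 trades a factor \<open>u p\<close> for a factor
  in V: same total j + c, smaller c. The other part splits off \<open>u p * lam\<close>, leaving a
  product of smaller total. Hence the nested induction on j + c and on c.\<close>

lemma Qp_V_pow_mult:
  assumes p: "p < s"
  shows "g \<in> ideal_pow N V j \<Longrightarrow> h \<in> high N c \<Longrightarrow> Qp p (j + c) (g * u p ^ c * h)"
proof (induction "j + c" arbitrary: j c g h)
  case 0
  then show ?case by (auto intro!: Qp_pow simp: poly_ring_mult high_0_eq)
next
  case (Suc n)
  note outer = Suc.hyps(1)
  from Suc.hyps(2) Suc.prems show ?case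
  proof (induction c arbitrary: j g h)
    case 0
    then show ?case using ideal_pow_mult[of h N g V j] by (simp add: Qp_pow high_0_eq mult.commute)
  next
    case (Suc c)
    note inner = Suc.IH
    show ?case
    proof (cases j)
      case 0
      then have "g * h \<in> high N (j + Suc c)" using Suc.prems high_mult_left by simp
      then show ?thesis unfolding Qp_def 0
        by (intro exI[of _ 0] exI[of _ "g * h"]) (simp add: 0 mult_ac)
    next
      case (Suc j')
      note j = this
      show ?thesis using Suc.prems(3)
      proof (induction rule: high_Suc_induct)
        case zero
        then show ?case by (simp add: Qp_pow)
      next
        case (add x y)
        then show ?case by (simp add: distrib_left Qp_add)
      next
        case (var k h')
        note k = var(1) and h' = var(2)
        have "g \<in> ideal_pow N V (Suc j')" using Suc.prems j by simp
        then show ?case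
        proof (induction rule: ideal_pow_induct)
          case zero
          then show ?case by (simp add: Qp_pow)
        next
          case (add x y)
          then show ?case by (simp add: distrib_right Qp_add)
        next
          case (prod x q)
          obtain S lam where S: "S \<in> ideal_pow N V 2" "lam \<in> high N 1" "restr (A p) lam = 0"
            "x * (u p * Var k) = S + (u p * lam) * (u p * Var k)"
            using V_mult_u[OF prod(1) p k] by metis
          have 1: "Qp p (j + Suc c) (q * S * u p ^ c * h')"
            using inner[of "j' + 2" "q * S" h'] ideal_pow_mult_pow[OF prod(2) S(1)] h' Suc.prems(1) j by simp
          have "Var k * h' \<in> high N (Suc c)" using high_mult[OF high_Var[OF k] h'] by simp
          then have "Qp p (j' + Suc c) (q * u p ^ Suc c * (Var k * h'))"
            using Suc.prems(1) j by (intro outer[OF _ prod(2)]) simp_all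
          then obtain v w where vw: "v \<in> ideal_pow N V (j' + Suc c)" "w \<in> high N (j' + Suc c)"
            "q * u p ^ Suc c * (Var k * h') = v + u p ^ (j' + Suc c) * w"
            unfolding Qp_def by blast
          \<comment> \<open>The factor \<open>u p * lam\<close> plays both roles: it lies in V,
            which lifts the V-part by one power, and it supplies one more \<open>u p\<close>, with
            \<open>lam\<close> raising the degree of the cofactor.\<close>
          have "(u p * lam) * (q * u p ^ Suc c * (Var k * h')) = (u p * lam) * v + u p ^ (j + Suc c) * (lam * w)"
            unfolding vw(3) j by (simp add: algebra_simps)
          moreover have "(u p * lam) * v \<in> ideal_pow N V (j + Suc c)"
            using ideal_pow_Suc_mult[OF u_mult_V[OF p S(2,3)] vw(1)] j by (simp)
          moreover have "lam * w \<in> high N (j + Suc c)" using high_mult[OF S(2) vw(2)] j by simp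
          ultimately have 2: "Qp p (j + Suc c) ((u p * lam) * (q * u p ^ Suc c * (Var k * h')))"
            unfolding Qp_def by blast
          have "x * q * u p ^ Suc c * (Var k * h') = (x * (u p * Var k)) * (q * u p ^ c * h')"
            by (simp add: mult_ac)
          also have "\<dots> = q * S * u p ^ c * h' + (u p * lam) * (q * u p ^ Suc c * (Var k * h'))"
            unfolding S(4) by (simp add: algebra_simps)
          finally show ?case using Qp_add[OF 1 2] by simp
        qed
      qed
    qed
  qed
qed

text \<open>Split a variable of h into a part vanishing at \<open>A p\<close> and one vanishing at
  \<open>A q\<close>. The first turns a \<open>u p\<close> into an element of V and lowers c; the
  second turns \<open>u q\<close> into an element of V, and then only \<open>u p\<close> is left, as
  in \<open>Qp_V_pow_mult\<close>.\<close>

lemma Q_mixed_mult: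
  assumes pq: "p < s" "q < s" "p \<noteq> q" and w: "w \<in> high N 1"
  shows "g \<in> ideal_pow N V j \<Longrightarrow> h \<in> high N c \<Longrightarrow> Q (Suc (j + c)) (g * (u q * w) * (u p ^ c * h))"
proof (induction c arbitrary: j g h)
  case 0
  then have "w * h \<in> high N (Suc 0)" using high_mult[OF w 0(2)] by simp
  then show ?case
    using Qp_imp_Q[OF Qp_V_pow_mult[OF pq(2) 0(1)] pq(2), of "w * h" "Suc 0"] by (simp add: mult_ac)
next
  case (Suc c)
  show ?case using Suc.prems(2)
  proof (induction rule: high_Suc_induct)
    case zero
    then show ?case by (simp add: Q_pow)
  next
    case (add x y)
    then show ?case by (simp add: distrib_left Q_add)
  next
    case (var k h')
    obtain \<alpha> \<beta> where ab: "\<alpha> \<in> high N 1" "\<beta> \<in> high N 1" "restr (A p) \<alpha> = 0" "restr (A q) \<beta> = 0" "Var k = \<alpha> + \<beta>"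
      using split_Var[of p q k] pq var(1) by auto
    have gV: "g * y \<in> ideal_pow N V (Suc j)" if "y \<in> V" for y
      using ideal_pow_Suc_mult[OF that Suc.prems(1)] by (simp add: mult.commute)
    have 1: "Q (Suc (j + Suc c)) (g * (u p * \<alpha>) * (u q * w) * (u p ^ c * h'))"
      using Suc.IH[OF gV[OF u_mult_V[OF pq(1) ab(1,3)]] var(2)] by simp
    have "w * h' \<in> high N (Suc c)" using high_mult[OF w var(2)] by simp
    from Qp_imp_Q[OF Qp_V_pow_mult[OF pq(1) gV[OF u_mult_V[OF pq(2) ab(2,4)]] this] pq(1)]
    have 2: "Q (Suc (j + Suc c)) (g * (u q * \<beta>) * u p ^ Suc c * (w * h'))"
      by (simp only: add_Suc)
    have "g * (u q * w) * (u p ^ Suc c * (Var k * h')) =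
      g * (u p * \<alpha>) * (u q * w) * (u p ^ c * h') + g * (u q * \<beta>) * u p ^ Suc c * (w * h')"
      unfolding ab(5) by (simp add: algebra_simps)
    then show ?case using Q_add[OF 1 2] by simp
  qed
qed

text \<open>Split a monomial of degree r + 1 off every term and decompose it. Multiplied by the
  normal form of the rest it gives four kinds of products, of which only those with two different
  points call for \<open>Q_mixed_mult\<close>.\<close>

lemma high_imp_Q: "x \<in> high N (b * (r + 1)) \<Longrightarrow> Q b x"
proof (induction b arbitrary: x)
  case 0
  then show ?case by (simp add: Q_pow high_0_eq)
next
  case (Suc b)
  show ?case
  proof (rule poly_mapping_additive_induct[of _ x])
    fix m assume "m \<in> Poly_Mapping.keys x"
    then have m: "Poly_Mapping.keys m \<subseteq> {..N}" "Suc b * (r + 1) \<le> mon_deg m"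
      using Suc.prems by (auto simp: high_def)
    have "r + 1 \<le> mon_deg m" using m(2) by simp
    then obtain m1 m2 where m12: "m = m1 + m2" "mon_deg m1 = r + 1" by (rule mon_deg_split)
    then have "Poly_Mapping.single m1 (1::'k) \<in> high N (r + 1)" (is "?e \<in> _")
      using m by (intro high_single) (auto simp: keys_add_nat)
    then obtain v0 w where e: "v0 \<in> I" "v0 \<in> high N (r + 1)" "\<And>q. w q \<in> high N 1" "?e = v0 + (\<Sum>q<s. u q * w q)"
      by (rule decompose) blast
    have v0: "v0 \<in> V" using e by (simp add: V_def)
    have "Poly_Mapping.single m2 (Poly_Mapping.lookup x m) \<in> high N (b * (r + 1))" (is "?e' \<in> _")
      using m m12 by (intro high_single) (auto simp: keys_add_nat)
    from Suc.IH[OF this] obtain v h where e': "v \<in> ideal_pow N V b" "\<And>p. h p \<in> high N b"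
      "?e' = v + (\<Sum>p<s. u p ^ b * h p)" unfolding Q_def by blast
    have "Poly_Mapping.single m (Poly_Mapping.lookup x m) = ?e * ?e'"
      by (simp add: mult_single m12)
    also have "\<dots> = v0 * v + (\<Sum>p<s. v0 * u p ^ b * h p) + (\<Sum>q<s. v * u q ^ 1 * w q)
        + (\<Sum>q<s. \<Sum>p<s. (u q * w q) * (u p ^ b * h p))"
      unfolding e(4) e'(3) 
      by (simp add: distrib_left distrib_right sum_product sum_distrib_left sum_distrib_right sum.distrib mult_ac)
        (rule sum.swap)
    also have "Q (Suc b) \<dots>"
    proof (intro Q_add Q_sum)
      show "Q (Suc b) (v0 * v)" by (rule Q_pow[OF ideal_pow_Suc_mult[OF v0 e'(1)]])
    next
      fix p assume "p \<in> {..<s}"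
      then have p: "p < s" by simp
      show "Q (Suc b) (v0 * u p ^ b * h p)"
        using Qp_imp_Q[OF Qp_V_pow_mult[OF p ideal_pow_gen[OF v0] e'(2)] p] by simp
      show "Q (Suc b) (v * u p ^ 1 * w p)"
        using Qp_imp_Q[OF Qp_V_pow_mult[OF p e'(1) e(3)] p] by simp
      fix q assume "q \<in> {..<s}"
      then have q: "q < s" by simp
      show "Q (Suc b) (u p * w p * (u q ^ b * h q))"
      proof (cases "p = q")
        case True
        have "w p * h q \<in> high N (Suc b)" using high_mult[OF e(3) e'(2)] by simp
        then have "Qp p (0 + Suc b) (1 * u p ^ Suc b * (w p * h q))"
          by (intro Qp_V_pow_mult[OF p]) simp_all
        then show ?thesis using Qp_imp_Q[OF _ p] True by (simp add: mult_ac)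
      next
        case False
        show ?thesis
          using Q_mixed_mult[OF q p _ e(3), of 1 0 "h q" b] False e'(2) by simp
      qed
    qed
    finally show "Q (Suc b) (Poly_Mapping.single m (Poly_Mapping.lookup x m))" .
  qed (auto intro: Q_add Q_pow)
qed

text \<open>Each of the b factors of h takes one \<open>u p\<close>, and the product of
  \<open>u p\<close> with a polynomial vanishing at \<open>A p\<close> vanishes at all the
  points.\<close>

lemma u_pow_mult_ideal_pow:
  assumes "p < s" "h \<in> ideal_pow N (points_ideal N {A p}) b"
  shows "u p ^ b * h \<in> ideal_pow N I b"
  using assms(2)
proof (induction b arbitrary: h)
  case (Suc b)
  show ?case using Suc.prems
  proof (induction rule: ideal_pow_induct)
    case (prod x q)
    have "u p * x \<in> I"
      using prod(1) assms(1) u_poly_ring by (auto simp: points_ideal_iff I_iff restr_simps restr_u poly_ring_mult)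
    from ideal_pow_Suc_mult[OF this Suc.IH[OF prod(2)]] show ?case by (simp add: mult_ac)
  qed (simp_all add: distrib_left ideal_pow_add)
qed simp

text \<open>At \<open>A p\<close>, the polynomial F, the part v and the summands with q different
  from p all have order at least b, hence so does u_p^b h_p. Since \<open>u p\<close> is a local
  unit there, h_p itself has order at least b.\<close>

theorem symbolic_in_ordinary:
  assumes F: "F \<in> high N (b * (r + 1))" and ord: "\<And>i. i < s \<Longrightarrow> yord b (shift (A i) F)"
  shows "F \<in> ideal_pow N I b"
proof -
  obtain v h where v: "v \<in> ideal_pow N V b" "\<And>p. h p \<in> high N b" "F = v + (\<Sum>p<s. u p ^ b * h p)"
    using high_imp_Q[OF F] unfolding Q_def by blast
  have vI: "v \<in> ideal_pow N I b" using v(1) ideal_pow_mono[of V I N b] by (auto simp: V_def)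
  have "u p ^ b * h p \<in> ideal_pow N I b" if p: "p < s" for p
  proof -
    have u1: "yord 1 (shift (A p) (u q))" if "q < s" "q \<noteq> p" for q
      using restr_u[OF that(1) p] that by (simp add: restr_eq_0_iff)
    have "yord 1 (shift (A p) x)" if "x \<in> I" for x
      using that p by (simp add: I_iff restr_eq_0_iff)
    then have "yord b (shift (A p) v)" by (rule yord_ideal_pow[OF _ vI])
    moreover have "yord b (shift (A p) (\<Sum>q\<in>{..<s} - {p}. u q ^ b * h q))"
      unfolding shift_simps
      using yord_mult[OF yord_power[OF u1], of _ 0 _ b] by (intro yord_sum) simp
    ultimately have "yord b (shift (A p) F - shift (A p) v - shift (A p) (\<Sum>q\<in>{..<s} - {p}. u q ^ b * h q))"
      using ord[OF p] by (intro yord_diff)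
    also have "shift (A p) F - shift (A p) v - shift (A p) (\<Sum>q\<in>{..<s} - {p}. u q ^ b * h q)
      = shift (A p) (u p) ^ b * shift (A p) (h p)"
      unfolding v(3) using p by (simp add: sum.remove[of "{..<s}" p] shift_simps)
    finally have *: "yord b (shift (A p) (u p) ^ b * shift (A p) (h p))" .
    have "yord 1 (shift (A p) (u p) - Poly_Mapping.single (Poly_Mapping.single 0 r) 1)"
      unfolding yord_lookup
    proof (intro allI impI)
      fix m :: "nat \<Rightarrow>\<^sub>0 nat" assume "ydeg m < 1"
      then obtain d where m: "m = Poly_Mapping.single 0 d" using ydeg_eq_0_iff by (metis less_one)
      have "Poly_Mapping.lookup (shift (A p) (u p)) m = coeff (monom 1 r) d"
        using restr_u[OF p p] coeff_restr[of "A p" "u p" d] m by simp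
      moreover have "Poly_Mapping.single 0 r = m \<longleftrightarrow> r = d"
        unfolding m by (metis lookup_single_eq)
      ultimately show "Poly_Mapping.lookup (shift (A p) (u p) - Poly_Mapping.single (Poly_Mapping.single 0 r) 1) m = 0"
        by (simp add: lookup_minus lookup_single when_def)
    qed
    then have "yord b (shift (A p) (h p))"
      by (rule yord_cancel[OF yord_1_power_diff *])
    then show ?thesis
      using A0[OF p] high_poly_ring[OF v(2)[of p]] by (intro u_pow_mult_ideal_pow[OF p] ideal_pow_point)
  qed
  then show ?thesis unfolding v(3) by (intro ideal_pow_add vI ideal_pow_sum) simp
qed

end

subsection \<open>Jets\<close>

lemma underdetermined_system:
  fixes M :: "'a \<Rightarrow> 'b \<Rightarrow> 'k::field"
  assumes "finite B" "finite A" "card B < card A"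
  shows "\<exists>x. (\<exists>a\<in>A. x a \<noteq> 0) \<and> (\<forall>b\<in>B. (\<Sum>a\<in>A. x a * M a b) = 0)"
  using assms
proof (induction B arbitrary: A M rule: finite_induct)
  case empty
  then have "A \<noteq> {}" by auto
  then show ?case by (intro exI[of _ "\<lambda>_. 1"]) auto
next
  case (insert b B)
  show ?case
  proof (cases "\<forall>a\<in>A. M a b = 0")
    case True
    obtain x where "\<exists>a\<in>A. x a \<noteq> 0" "\<forall>b\<in>B. (\<Sum>a\<in>A. x a * M a b) = 0"
      using insert.IH[of A M] insert.prems insert.hyps by auto
    with True show ?thesis by (intro exI[of _ x]) auto
  next
    case False
    then obtain a0 where a0: "a0 \<in> A" "M a0 b \<noteq> 0" by auto
    define M' where "M' a c = M a c - M a b / M a0 b * M a0 c" for a c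
    have "card B < card (A - {a0})"
      using insert.prems insert.hyps a0 by (simp add: card_Diff_singleton)
    then obtain x where x: "\<exists>a\<in>A - {a0}. x a \<noteq> 0" "\<forall>c\<in>B. (\<Sum>a\<in>A - {a0}. x a * M' a c) = 0"
      using insert.IH[of "A - {a0}" M'] insert.prems by auto
    \<comment> \<open>The value at \<open>a0\<close> is the one solving the eliminated equation
      b.\<close>
    define y where "y = x(a0 := - (\<Sum>a\<in>A - {a0}. x a * M a b) / M a0 b)"
    have sum_y: "(\<Sum>a\<in>A. y a * M a c) = (\<Sum>a\<in>A - {a0}. x a * M a c) + y a0 * M a0 c" for c
    proof -
      have "(\<Sum>a\<in>A - {a0}. y a * M a c) = (\<Sum>a\<in>A - {a0}. x a * M a c)"
        by (rule sum.cong) (auto simp: y_def)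
      then show ?thesis using sum.remove[OF insert.prems(1) a0(1), of "\<lambda>a. y a * M a c"] by simp
    qed
    have "(\<Sum>a\<in>A. y a * M a c) = 0" if "c \<in> insert b B" for c
    proof (cases "c = b")
      case True
      then show ?thesis unfolding sum_y using a0(2) by (simp add: y_def)
    next
      case False
      have "(\<Sum>a\<in>A - {a0}. x a * M a c) + y a0 * M a0 c = (\<Sum>a\<in>A - {a0}. x a * M' a c)"
        by (simp add: M'_def y_def right_diff_distrib sum_subtractf sum_divide_distrib sum_distrib_left
            sum_distrib_right mult_ac sum_negf)
      then show ?thesis unfolding sum_y using x(2) that False by simp
    qed
    moreover have "\<exists>a\<in>A. y a \<noteq> 0" using x(1) by (auto simp: y_def)
    ultimately show ?thesis by blast
  qed
qed

lemma lookup_Const_mult: "Poly_Mapping.lookup (Const c * p) m = c * Poly_Mapping.lookup p m"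
  using lookup_single_mult_add[of 0 c p m] by simp

text \<open>Terms of order above \<open>ydeg \<nu>\<close> are left free: a product of two such
  polynomials is controlled only in its lowest order.\<close>

definition lead :: "(nat \<Rightarrow> 'k::field) \<Rightarrow> (nat \<Rightarrow>\<^sub>0 nat) \<Rightarrow> 'k \<Rightarrow> 'k mpoly \<Rightarrow> bool" where
  "lead a \<nu> \<kappa> E \<longleftrightarrow> yord (ydeg \<nu> + 1) (shift a E - Poly_Mapping.single \<nu> \<kappa>)"

lemma lead_yord: "lead a \<nu> \<kappa> E \<Longrightarrow> yord (ydeg \<nu>) (shift a E)"
  using yord_add[of "ydeg \<nu>" "shift a E - Poly_Mapping.single \<nu> \<kappa>" "Poly_Mapping.single \<nu> \<kappa>"]
  by (simp add: lead_def yord_mono[of "ydeg \<nu> + 1"] yord_single)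

lemma lead_lookup:
  assumes "lead a \<nu> \<kappa> E" "ydeg \<mu> \<le> ydeg \<nu>"
  shows "Poly_Mapping.lookup (shift a E) \<mu> = (if \<mu> = \<nu> then \<kappa> else 0)"
proof -
  have "Poly_Mapping.lookup (shift a E - Poly_Mapping.single \<nu> \<kappa>) \<mu> = 0"
    using assms by (simp add: lead_def yord_lookup)
  then show ?thesis by (auto simp: lookup_minus lookup_single when_def split: if_splits)
qed

lemma lead_mult:
  assumes "lead a \<nu> \<kappa> E" "lead a \<nu>' \<kappa>' E'"
  shows "lead a (\<nu> + \<nu>') (\<kappa> * \<kappa>') (E * E')"
proof -
  let ?s = "Poly_Mapping.single \<nu> \<kappa>" and ?s' = "Poly_Mapping.single \<nu>' \<kappa>'"
  have "yord ((ydeg \<nu> + 1) + ydeg \<nu>') ((shift a E - ?s) * shift a E')"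
    using assms by (intro yord_mult lead_yord) (simp_all add: lead_def)
  moreover have "yord (ydeg \<nu> + (ydeg \<nu>' + 1)) (?s * (shift a E' - ?s'))"
    using assms(2) by (intro yord_mult yord_single) (simp_all add: lead_def)
  ultimately have "yord (ydeg (\<nu> + \<nu>') + 1) ((shift a E - ?s) * shift a E' + ?s * (shift a E' - ?s'))"
    by (intro yord_add) (simp_all add: add_ac)
  then show ?thesis
    by (simp add: lead_def shift_simps algebra_simps mult_single)
qed

lemma lead_1: "lead a 0 1 1"
  by (simp add: lead_def)

text \<open>In a form of degree e, a monomial with \<open>ydeg\<close> at most j is divisible by
  x_0^(e - j), and the quotient has degree j. So the monomials of degree j index exactly the
  coefficients that have to vanish.\<close>

lemma yord_from_jets:
  assumes G: "G \<in> form N e" and je: "j \<le> e"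
    and jets: "\<And>\<kappa>. \<kappa> \<in> monomials N j \<Longrightarrow> Poly_Mapping.lookup G (\<kappa> + Poly_Mapping.single 0 (e - j)) = 0"
  shows "yord (j + 1) G"
  unfolding yord_lookup
proof (intro allI impI)
  fix m assume ym: "ydeg m < j + 1"
  show "Poly_Mapping.lookup G m = 0"
  proof (cases "m \<in> monomials N e")
    case True
    let ?\<kappa> = "m - Poly_Mapping.single 0 (e - j)"
    have m0: "e - j \<le> Poly_Mapping.lookup m 0"
      using True ym mon_deg_eq_ydeg[of m] by (auto simp: monomials_def)
    have m: "m = ?\<kappa> + Poly_Mapping.single 0 (e - j)"
      by (rule poly_mapping_eqI) (use m0 in \<open>auto simp: lookup_add lookup_minus lookup_single when_def\<close>)
    have "mon_deg m = mon_deg ?\<kappa> + (e - j)"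
      by (subst m) simp
    moreover have "Poly_Mapping.keys ?\<kappa> \<subseteq> Poly_Mapping.keys m"
      by (auto simp: in_keys_iff lookup_minus)
    ultimately have "?\<kappa> \<in> monomials N j" using True je by (auto simp: monomials_def)
    then show ?thesis using jets[of ?\<kappa>] m by simp
  next
    case False
    then show ?thesis using G by (auto simp: form_def in_keys_iff)
  qed
qed

text \<open>Forms of degree \<open>d\<close> prescribe the \<open>m\<close>-jets at the points \<open>A 0, \<dots>, A (S - 1)\<close> independently. A monomial
  \<open>\<mu>\<close> of degree \<open>m\<close> stands for the jet obtained by setting \<open>x\<^sub>0 = 1\<close>.\<close>
definition separates_jets :: "nat \<Rightarrow> nat \<Rightarrow> (nat \<Rightarrow> nat \<Rightarrow> 'k::field) \<Rightarrow> nat \<Rightarrow> nat \<Rightarrow> bool" where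
  "separates_jets N S A m d \<longleftrightarrow> (\<forall>i<S. \<forall>\<mu>\<in>monomials N m. \<exists>E\<in>form N d.
     lead (A i) (\<mu> + Poly_Mapping.single 0 (d - m)) 1 E \<and> (\<forall>j<S. j \<noteq> i \<longrightarrow> yord (m + 1) (shift (A j) E)))"

text \<open>Factor \<open>\<mu>\<close> into monomials of degree m and multiply the forms belonging
  to them. The jets obtained are prescribed only in triangular fashion with respect to
  \<open>ydeg\<close>, which still gives linear independence in \<open>jet_count\<close>.\<close>

lemma separates_jets_power:
  assumes sep: "separates_jets N S A m d" and md: "m \<le> d" and i: "i < S"
  shows "\<mu> \<in> monomials N (m * Suc M) \<Longrightarrow> \<exists>E\<in>form N (d * Suc M).
     lead (A i) (\<mu> + Poly_Mapping.single 0 (d * Suc M - m * Suc M)) 1 E \<and>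
     (\<forall>j<S. j \<noteq> i \<longrightarrow> yord (ydeg \<mu> + 1) (shift (A j) E))"
proof (induction M arbitrary: \<mu>)
  case 0
  then obtain E where E: "E \<in> form N d" "lead (A i) (\<mu> + Poly_Mapping.single 0 (d - m)) 1 E"
    "\<forall>j<S. j \<noteq> i \<longrightarrow> yord (m + 1) (shift (A j) E)"
    using sep i unfolding separates_jets_def by fastforce
  have "ydeg \<mu> \<le> m" using 0 mon_deg_eq_ydeg[of \<mu>] by (simp add: monomials_def)
  with E show ?case by (intro bexI[of _ E]) (auto intro: yord_mono)
next
  case (Suc M)
  have "m \<le> mon_deg \<mu>" using Suc.prems by (simp add: monomials_def)
  then obtain \<mu>1 \<mu>2 where \<mu>: "\<mu> = \<mu>1 + \<mu>2" "mon_deg \<mu>1 = m" by (rule mon_deg_split)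
  have \<mu>12: "\<mu>1 \<in> monomials N m" "\<mu>2 \<in> monomials N (m * Suc M)"
    using Suc.prems \<mu> by (auto simp: monomials_def keys_add_nat)
  obtain E1 where E1: "E1 \<in> form N d" "lead (A i) (\<mu>1 + Poly_Mapping.single 0 (d - m)) 1 E1"
    "\<forall>j<S. j \<noteq> i \<longrightarrow> yord (m + 1) (shift (A j) E1)"
    using sep i \<mu>12(1) unfolding separates_jets_def by blast
  obtain E2 where E2: "E2 \<in> form N (d * Suc M)"
    "lead (A i) (\<mu>2 + Poly_Mapping.single 0 (d * Suc M - m * Suc M)) 1 E2"
    "\<forall>j<S. j \<noteq> i \<longrightarrow> yord (ydeg \<mu>2 + 1) (shift (A j) E2)"
    using Suc.IH[OF \<mu>12(2)] by blast
  have "m * Suc M \<le> d * Suc M" using md by (rule mult_le_mono1)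
  then have "d * Suc (Suc M) - m * Suc (Suc M) = (d - m) + (d * Suc M - m * Suc M)"
    using md by simp
  then have \<nu>: "\<mu> + Poly_Mapping.single 0 (d * Suc (Suc M) - m * Suc (Suc M)) =
    (\<mu>1 + Poly_Mapping.single 0 (d - m)) + (\<mu>2 + Poly_Mapping.single 0 (d * Suc M - m * Suc M))"
    unfolding \<mu>(1) by (simp only: single_add add_ac)
  show ?case
  proof (intro bexI conjI allI impI)
    show "E1 * E2 \<in> form N (d * Suc (Suc M))" using form_mult[OF E1(1) E2(1)] by simp
    show "lead (A i) (\<mu> + Poly_Mapping.single 0 (d * Suc (Suc M) - m * Suc (Suc M))) 1 (E1 * E2)"
      using lead_mult[OF E1(2) E2(2)] unfolding \<nu> by simp
    fix j assume j: "j < S" "j \<noteq> i"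
    have "ydeg \<mu>1 \<le> m" using \<mu>(2) mon_deg_eq_ydeg[of \<mu>1] by simp
    moreover have "yord ((m + 1) + (ydeg \<mu>2 + 1)) (shift (A j) E1 * shift (A j) E2)"
      using E1(3) E2(3) j by (intro yord_mult) auto
    ultimately show "yord (ydeg \<mu> + 1) (shift (A j) (E1 * E2))"
      unfolding \<mu>(1) by (auto simp: shift_simps elim: yord_mono)
  qed
qed

text \<open>Multiplication by \<open>F\<close> embeds the forms of degree \<open>D - t\<close> with order greater than \<open>c - a\<close> into those of degree
  \<open>D\<close> with order greater than \<open>c\<close>, whose dimension is known exactly.\<close>
lemma jet_count:
  assumes sep: "separates_jets N S A m d" and md: "m \<le> d"
    and F: "F \<in> form N t" "F \<noteq> 0" "\<And>i. i < S \<Longrightarrow> yord a (shift (A i) F)"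
    and D: "D = d * Suc M" "t \<le> D" and c: "c = m * Suc M" "a \<le> c" and Dc: "c - a \<le> D - t"
  shows "card (monomials N (D - t)) + S * card (monomials N c) \<le> card (monomials N D) + S * card (monomials N (c - a))"
proof (rule ccontr)
  assume neg: "\<not> ?thesis"
  have cD: "c \<le> D" unfolding c(1) D(1) using md by (rule mult_le_mono1)
  let ?s = "\<lambda>e. Poly_Mapping.single (0::nat) (e::nat)"
  have "\<exists>E. E \<in> form N D \<and> lead (A i) (\<mu> + ?s (D - c)) 1 E \<and>
     (\<forall>j<S. j \<noteq> i \<longrightarrow> yord (ydeg \<mu> + 1) (shift (A j) E))" if "i < S" "\<mu> \<in> monomials N c" for i \<mu>
    using separates_jets_power[OF sep md that(1), of \<mu> M] that(2) unfolding c(1) D(1) by blast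
  then obtain E where E: "\<And>i \<mu>. i < S \<Longrightarrow> \<mu> \<in> monomials N c \<Longrightarrow> E i \<mu> \<in> form N D"
    "\<And>i \<mu>. i < S \<Longrightarrow> \<mu> \<in> monomials N c \<Longrightarrow> lead (A i) (\<mu> + ?s (D - c)) 1 (E i \<mu>)"
    "\<And>i \<mu> j. i < S \<Longrightarrow> \<mu> \<in> monomials N c \<Longrightarrow> j < S \<Longrightarrow> j \<noteq> i \<Longrightarrow> yord (ydeg \<mu> + 1) (shift (A j) (E i \<mu>))"
    by metis
  let ?J = "{..<S} \<times> monomials N c"
  let ?X = "monomials N (D - t) <+> ?J"
  let ?Y = "monomials N D <+> ({..<S} \<times> monomials N (c - a))"
  \<comment> \<open>Unknowns: the coefficients of a form H of degree D - t and the weights of the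
    forms \<open>E i \<mu>\<close>. Equations: F H plus the weighted sum of the E is zero, and the
    (c - a)-jets of H vanish at all S points. If the inequality failed, there would be fewer
    equations than unknowns and hence a nontrivial solution.\<close>
  define M where "M v w = (case v of
      Inl \<mu> \<Rightarrow> (case w of Inl \<nu> \<Rightarrow> Poly_Mapping.lookup (F * Poly_Mapping.single \<mu> 1) \<nu>
        | Inr (j, \<kappa>) \<Rightarrow> Poly_Mapping.lookup (shift (A j) (Poly_Mapping.single \<mu> 1)) (\<kappa> + ?s (D - t - (c - a))))
    | Inr (i, \<mu>) \<Rightarrow> (case w of Inl \<nu> \<Rightarrow> Poly_Mapping.lookup (E i \<mu>) \<nu> | Inr _ \<Rightarrow> 0))" for v w
  have "card ?Y < card ?X" using neg by (simp add: card_Plus finite_monomials)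
  then obtain x where x: "\<exists>v\<in>?X. x v \<noteq> 0" "\<forall>w\<in>?Y. (\<Sum>v\<in>?X. x v * M v w) = 0"
    using underdetermined_system[of ?Y ?X M] by (auto simp: finite_monomials)
  have sum_X: "(\<Sum>v\<in>?X. f v) = (\<Sum>\<mu>\<in>monomials N (D - t). f (Inl \<mu>)) + (\<Sum>y\<in>?J. f (Inr y))"
    for f :: "_ \<Rightarrow> 'a"
    by (simp add: sum.Plus finite_monomials)
  define H where "H = (\<Sum>\<mu>\<in>monomials N (D - t). Const (x (Inl \<mu>)) * Poly_Mapping.single \<mu> 1)"
  have H: "H \<in> form N (D - t)"
    unfolding H_def by (intro form_sum form_Const_mult form_single)
  define G where "G = (\<Sum>y\<in>?J. Const (x (Inr y)) * E (fst y) (snd y))"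
  have G: "G \<in> form N D"
    unfolding G_def using E(1) by (intro form_sum form_Const_mult) auto
  have "F * H + G = 0"
  proof (rule poly_mapping_eqI)
    fix \<nu>
    show "Poly_Mapping.lookup (F * H + G) \<nu> = Poly_Mapping.lookup 0 \<nu>"
    proof (cases "\<nu> \<in> monomials N D")
      case True
      then have "(\<Sum>v\<in>?X. x v * M v (Inl \<nu>)) = 0" using x(2) by auto
      also have "(\<Sum>v\<in>?X. x v * M v (Inl \<nu>)) = Poly_Mapping.lookup (F * H + G) \<nu>"
        unfolding sum_X H_def G_def
        by (simp add: M_def sum_distrib_left lookup_add lookup_sum lookup_Const_mult mult.left_commute[of F]
            case_prod_beta)
      finally show ?thesis by simp
    next
      case False
      have "F * H + G \<in> form N D" using form_mult[OF F(1) H] G D(2) by (auto intro: form_add)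
      then show ?thesis using False by (auto simp: form_def in_keys_iff)
    qed
  qed
  then have FHG: "G = - (F * H)" by (simp add: eq_neg_iff_add_eq_0 add.commute)
  have ordG: "yord (c + 1) (shift (A j) G)" if j: "j < S" for j
  proof -
    have "yord (c - a + 1) (shift (A j) H)"
    proof (rule yord_from_jets[OF shift_form[OF H] Dc])
      fix \<kappa> assume "\<kappa> \<in> monomials N (c - a)"
      then have "(\<Sum>v\<in>?X. x v * M v (Inr (j, \<kappa>))) = 0" using x(2) j by auto
      then show "Poly_Mapping.lookup (shift (A j) H) (\<kappa> + ?s (D - t - (c - a))) = 0"
        unfolding sum_X H_def by (simp add: M_def shift_simps lookup_sum lookup_Const_mult case_prod_beta)
    qed
    from yord_mult[OF F(3)[OF j] this] have "yord (c + 1) (shift (A j) (F * H))"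
      using c(2) by (simp add: shift_simps)
    then have "yord (c + 1) (0 - shift (A j) (F * H))" by (intro yord_diff) simp_all
    then show ?thesis unfolding FHG by (simp add: shift_def Const.psubst_uminus)
  qed
  \<comment> \<open>All jets of G up to order c vanish. Reading off the one at \<open>\<mu>\<close>
    involves only \<open>\<mu>\<close> itself and forms of smaller \<open>ydeg\<close>, whose
    weights are already known to be zero.\<close>
  have x_J: "x (Inr y) = 0" if "y \<in> ?J" for y
    using that
  proof (induction "ydeg (snd y)" arbitrary: y rule: less_induct)
    case less
    obtain i \<mu> where y: "y = (i, \<mu>)" "i < S" "\<mu> \<in> monomials N c" using less.prems by auto
    let ?\<nu> = "\<mu> + ?s (D - c)"
    have y\<nu>: "ydeg ?\<nu> < c + 1"
      using y(3) mon_deg_eq_ydeg[of \<mu>] by (simp add: monomials_def)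
    have "0 = Poly_Mapping.lookup (shift (A i) G) ?\<nu>"
      using ordG[OF y(2)] y\<nu> by (simp add: yord_lookup)
    also have "\<dots> = (\<Sum>z\<in>?J. x (Inr z) * Poly_Mapping.lookup (shift (A i) (E (fst z) (snd z))) ?\<nu>)"
      unfolding G_def by (simp add: shift_simps lookup_sum lookup_Const_mult)
    also have "\<dots> = (\<Sum>z\<in>?J. if z = y then x (Inr y) else 0)"
    proof (rule sum.cong[OF refl])
      fix z assume z: "z \<in> ?J"
      obtain k \<kappa> where k: "z = (k, \<kappa>)" "k < S" "\<kappa> \<in> monomials N c" using z by auto
      show "x (Inr z) * Poly_Mapping.lookup (shift (A i) (E (fst z) (snd z))) ?\<nu> = (if z = y then x (Inr y) else 0)"
      proof (cases "ydeg \<kappa> < ydeg \<mu>")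
        case True
        then show ?thesis using less.hyps[of z] z k y by auto
      next
        case False
        show ?thesis
        proof (cases "k = i")
          case True
          have "?\<nu> = \<kappa> + ?s (D - c) \<longleftrightarrow> \<mu> = \<kappa>" by simp
          then show ?thesis
            using lead_lookup[OF E(2)[OF k(2,3)], of ?\<nu>] False True k y by auto
        next
          case ki: False
          have "Poly_Mapping.lookup (shift (A i) (E k \<kappa>)) ?\<nu> = 0"
            using E(3)[OF k(2,3) y(2)] ki False by (auto simp: yord_lookup)
          then show ?thesis using ki k y by auto
        qed
      qed
    qed
    also have "\<dots> = x (Inr y)" using less.prems by (simp add: sum.delta finite_monomials)
    finally show ?case by simp
  qed
  then have "G = 0" unfolding G_def by (intro sum.neutral) simp
  then have "H = 0" using FHG F(2) by simp
  have "x (Inl \<mu>) = 0" if "\<mu> \<in> monomials N (D - t)" for \<mu>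
  proof -
    have "Poly_Mapping.lookup H \<mu> = x (Inl \<mu>)"
      unfolding H_def using that
      by (simp add: lookup_sum lookup_Const_mult lookup_single when_def if_distrib sum.delta finite_monomials cong: if_cong)
    then show ?thesis using \<open>H = 0\<close> by simp
  qed
  with x_J x(1) show False by blast
qed

subsection \<open>Degree bounds\<close>

lemma power_le_fact_binomial: "x ^ k \<le> fact k * ((x + k) choose k :: nat)"
proof (induction k)
  case (Suc k)
  have "x ^ Suc k \<le> (x + Suc k) * (fact k * ((x + k) choose k))"
    unfolding power_Suc by (intro mult_le_mono Suc.IH) simp
  also have "\<dots> = fact (Suc k) * ((x + Suc k) choose Suc k)"
    using Suc_times_binomial_eq[of "x + k" k] by (simp add: algebra_simps del: binomial_Suc_Suc)
  finally show ?case .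
qed simp

text \<open>Pascal's rule t times, each increment bounded by the last and largest one;
  \<open>binomial_add_lower\<close> uses the smallest one instead.\<close>

lemma binomial_add_upper:
  "(n + t + Suc k) choose Suc k \<le> ((n + Suc k) choose Suc k) + t * ((n + t + k) choose k)"
proof (induction t)
  case (Suc t)
  have "(n + Suc t + Suc k) choose Suc k = ((n + t + Suc k) choose Suc k) + ((n + Suc t + k) choose k)"
    by (simp add: add_ac)
  also have "\<dots> \<le> ((n + Suc k) choose Suc k) + t * ((n + t + k) choose k) + ((n + Suc t + k) choose k)"
    using Suc by simp
  also have "t * ((n + t + k) choose k) \<le> t * ((n + Suc t + k) choose k)"
    by (intro mult_le_mono binomial_right_mono) simp_all
  finally show ?case by simp
qed simp

lemma binomial_add_lower:
  "((n + Suc k) choose Suc k) + a * ((n + k) choose k) \<le> (n + a + Suc k) choose Suc k"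
proof (induction a)
  case (Suc a)
  have "(n + k) choose k \<le> (n + Suc a + k) choose k"
    by (intro binomial_right_mono) simp
  moreover have "(n + Suc a + Suc k) choose Suc k = ((n + a + Suc k) choose Suc k) + ((n + Suc a + k) choose k)"
    by (simp add: add_ac)
  ultimately show ?case using Suc by (simp del: binomial_Suc_Suc)
qed simp

text \<open>Divide by the k-th power of \<open>Suc n\<close> and let n grow.\<close>

lemma linear_power_limit:
  fixes m d p q C B :: real
  assumes "\<And>n::nat. n \<ge> n0 \<Longrightarrow> C * (m * Suc n - p) ^ k \<le> B * (d * Suc n + q) ^ k"
  shows "C * m ^ k \<le> B * d ^ k"
proof -
  have 1: "(\<lambda>n. C * (m - p / real (Suc n)) ^ k) \<longlonglongrightarrow> C * (m - 0) ^ k"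
    by (intro tendsto_intros LIMSEQ_Suc[OF lim_const_over_n])
  have 2: "(\<lambda>n. B * (d + q / real (Suc n)) ^ k) \<longlonglongrightarrow> B * (d + 0) ^ k"
    by (intro tendsto_intros LIMSEQ_Suc[OF lim_const_over_n])
  have "C * (m - p / real (Suc n)) ^ k \<le> B * (d + q / real (Suc n)) ^ k" if "n \<ge> n0" for n
  proof -
    have "m - p / real (Suc n) = (m * Suc n - p) / real (Suc n)" "d + q / real (Suc n) = (d * Suc n + q) / real (Suc n)"
      by (simp_all add: diff_divide_distrib add_divide_distrib)
    then show ?thesis using assms[OF that] by (simp add: power_divide divide_right_mono)
  qed
  then have "C * (m - 0) ^ k \<le> B * (d + 0) ^ k"
    by (intro LIMSEQ_le[OF 1 2]) blast
  then show ?thesis by simp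
qed

text \<open>In \<open>jet_count\<close>, dropping from degree D to D - t loses at most about t D^k /
  k! monomials, whereas passing from c-jets to (c - a)-jets saves at least about S a c^k / k!
  conditions. Since c / D = m / d for every n, the comparison survives in the limit.\<close>

theorem degree_lower_bound:
  assumes sep: "separates_jets N S A m d" and N: "N = Suc k" and m: "1 \<le> m" "m < d"
    and F: "F \<in> form N t" "F \<noteq> 0" "\<And>i. i < S \<Longrightarrow> yord a (shift (A i) F)"
  shows "real S * real a * real m ^ k \<le> real t * real d ^ k"
proof (rule linear_power_limit)
  \<comment> \<open>From this size on, a <= c, t <= D and c - a <= D - t, as
    \<open>jet_count\<close> requires.\<close>
  fix n assume n: "n \<ge> a + t"
  define c where "c = m * Suc n"
  define D where "D = d * Suc n"
  have "a + t \<le> Suc n" using n by simp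
  also have "Suc n \<le> c" using mult_le_mono1[OF m(1), of "Suc n"] by (simp add: c_def)
  finally have ac: "a \<le> c" by simp
  have "c + Suc n \<le> D" using mult_le_mono1[of "Suc m" d "Suc n"] m by (simp add: c_def D_def)
  then have tD: "t \<le> D" "c - a \<le> D - t" using ac n by auto
  have "card (monomials N (D - t)) + S * card (monomials N c) \<le> card (monomials N D) + S * card (monomials N (c - a))"
    using m by (intro jet_count[OF sep _ F D_def tD(1) c_def ac tD(2)]) simp_all
  then have 1: "((D - t + Suc k) choose Suc k) + S * ((c + Suc k) choose Suc k)
      \<le> ((D + Suc k) choose Suc k) + S * ((c - a + Suc k) choose Suc k)"
    unfolding card_monomials N .
  have 2: "(D + Suc k) choose Suc k \<le> ((D - t + Suc k) choose Suc k) + t * ((D + k) choose k)"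
    using binomial_add_upper[of "D - t" t k] tD by simp
  have "((c - a + Suc k) choose Suc k) + a * ((c - a + k) choose k) \<le> (c + Suc k) choose Suc k"
    using binomial_add_lower[of "c - a" k a] ac by simp
  from mult_le_mono2[OF this, of S] have 3: "S * ((c - a + Suc k) choose Suc k) + S * (a * ((c - a + k) choose k))
      \<le> S * ((c + Suc k) choose Suc k)"
    by (simp only: distrib_left)
  from 1 2 3 have "S * (a * ((c - a + k) choose k)) \<le> t * ((D + k) choose k)" by linarith
  from mult_le_mono2[OF this, of "fact k"]
  have "S * a * (fact k * ((c - a + k) choose k)) \<le> t * (((D + k) choose k) * fact k)"
    by (simp only: mult_ac)
  also have "((D + k) choose k) * fact k \<le> (D + k) ^ k"
    using binomial_fact_pow[of "D + k" k] by simp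
  finally have "S * a * (fact k * ((c - a + k) choose k)) \<le> t * (D + k) ^ k" by simp
  moreover have "S * a * (c - a) ^ k \<le> S * a * (fact k * ((c - a + k) choose k))"
    by (intro mult_le_mono2 power_le_fact_binomial)
  ultimately have "S * a * (c - a) ^ k \<le> t * (D + k) ^ k" by linarith
  then have "real (S * a * (c - a) ^ k) \<le> real (t * (D + k) ^ k)" by (rule of_nat_mono)
  then show "real S * real a * (real m * real (Suc n) - real a) ^ k \<le> real t * (real d * real (Suc n) + real k) ^ k"
    using ac by (simp add: c_def D_def of_nat_diff del: of_nat_Suc mult_Suc_right)
qed

subsection \<open>Polynomial families\<close>

text \<open>The functions whose nonvanishing sets are basic open sets for
  \<open>zariski_open\<close>. Working with functions makes the closure properties usable without
  naming the polynomials behind them.\<close>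

definition polyfun :: "nat \<Rightarrow> ((nat \<Rightarrow> 'k::field) \<Rightarrow> 'k) \<Rightarrow> bool" where
  "polyfun n g \<longleftrightarrow> (\<exists>f. (\<forall>m\<in>Poly_Mapping.keys f. Poly_Mapping.keys m \<subseteq> {..<n}) \<and> (\<forall>b. g b = poly_eval b f))"

lemma polyfun_const: "polyfun n (\<lambda>_. c)"
  unfolding polyfun_def
  by (intro exI[of _ "Const c"] conjI) (cases "c = 0"; simp add: poly_eval_eq)+

lemma polyfun_coord: "i < n \<Longrightarrow> polyfun n (\<lambda>b. b i)"
  unfolding polyfun_def
  by (intro exI[of _ "Var i"] conjI) (simp_all add: poly_eval_eq, simp add: Var_def)

lemma polyfun_add: "polyfun n g \<Longrightarrow> polyfun n h \<Longrightarrow> polyfun n (\<lambda>b. g b + h b)"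
  unfolding polyfun_def
proof (elim exE conjE)
  fix p q :: "'a mpoly"
  assume "\<forall>m\<in>Poly_Mapping.keys p. Poly_Mapping.keys m \<subseteq> {..<n}" "\<forall>m\<in>Poly_Mapping.keys q. Poly_Mapping.keys m \<subseteq> {..<n}"
    "\<forall>b. g b = poly_eval b p" "\<forall>b. h b = poly_eval b q"
  moreover from this have "Poly_Mapping.keys (p + q) \<subseteq> {m. Poly_Mapping.keys m \<subseteq> {..<n}}"
    by (intro keys_add_subset) auto
  ultimately show "\<exists>f. (\<forall>m\<in>Poly_Mapping.keys f. Poly_Mapping.keys m \<subseteq> {..<n}) \<and> (\<forall>b. g b + h b = poly_eval b f)"
    by (intro exI[of _ "p + q"]) (auto simp: poly_eval_eq id_hom.psubst_add)
qed

lemma polyfun_mult: "polyfun n g \<Longrightarrow> polyfun n h \<Longrightarrow> polyfun n (\<lambda>b. g b * h b)"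
  unfolding polyfun_def
proof (elim exE conjE)
  fix p q :: "'a mpoly"
  assume *: "\<forall>m\<in>Poly_Mapping.keys p. Poly_Mapping.keys m \<subseteq> {..<n}" "\<forall>m\<in>Poly_Mapping.keys q. Poly_Mapping.keys m \<subseteq> {..<n}"
    "\<forall>b. g b = poly_eval b p" "\<forall>b. h b = poly_eval b q"
  have "Poly_Mapping.keys (p * q) \<subseteq> {m. Poly_Mapping.keys m \<subseteq> {..<n}}"
    by (rule keys_mult_subset[of p "{m. Poly_Mapping.keys m \<subseteq> {..<n}}" q "{m. Poly_Mapping.keys m \<subseteq> {..<n}}"])
      (use * in \<open>auto simp: keys_add_nat\<close>)
  then show "\<exists>f. (\<forall>m\<in>Poly_Mapping.keys f. Poly_Mapping.keys m \<subseteq> {..<n}) \<and> (\<forall>b. g b * h b = poly_eval b f)"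
    using * by (intro exI[of _ "p * q"]) (auto simp: poly_eval_eq id_hom.psubst_mult)
qed

lemma polyfun_diff: "polyfun n g \<Longrightarrow> polyfun n h \<Longrightarrow> polyfun n (\<lambda>b. g b - h b)"
  using polyfun_add[of n g "\<lambda>b. (- 1) * h b"] polyfun_mult[OF polyfun_const[of n "- 1"], of h] by simp

lemma polyfun_prod: "(\<And>i. i \<in> S \<Longrightarrow> polyfun n (g i)) \<Longrightarrow> polyfun n (\<lambda>b. \<Prod>i\<in>S. g i b)"
  by (induction S rule: infinite_finite_induct) (auto intro: polyfun_const polyfun_mult)

text \<open>Restrict to the line through two points of nonvanishing.\<close>
lemma polyfun_common_nonzero:
  assumes inf: "infinite (UNIV :: 'k::field set)"
    and g: "polyfun n g" "g b1 \<noteq> (0::'k)" and h: "polyfun n h" "h b2 \<noteq> 0"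
  shows "\<exists>b. g b * h b \<noteq> 0"
proof -
  have line: "\<exists>P. \<forall>t. g (\<lambda>i. b1 i + t * (b2 i - b1 i)) = poly P t" if g: "polyfun n g" for g :: "(nat \<Rightarrow> 'k) \<Rightarrow> 'k"
  proof -
    obtain f where f: "\<And>b. g b = poly_eval b f" using g unfolding polyfun_def by blast
    have "psubst (\<lambda>x. x) (\<lambda>i. b1 i + t * (b2 i - b1 i)) f = poly (psubst (\<lambda>c. [:c:]) (\<lambda>i. [:b1 i, b2 i - b1 i:]) f) t" for t
      by (simp add: psubst_def poly_sum monom_val_def poly_prod mult.commute)
    then show ?thesis by (auto simp: f poly_eval_eq)
  qed
  obtain P where P: "\<And>t. g (\<lambda>i. b1 i + t * (b2 i - b1 i)) = poly P t" using line[OF g(1)] by auto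
  obtain R where R: "\<And>t. h (\<lambda>i. b1 i + t * (b2 i - b1 i)) = poly R t" using line[OF h(1)] by auto
  have "P \<noteq> 0" using P[of 0] g(2) by auto
  moreover have "R \<noteq> 0" using R[of 1] h(2) by auto
  ultimately have "finite {t. poly (P * R) t = 0}" by (intro poly_roots_finite) simp
  then obtain t where "poly (P * R) t \<noteq> 0" using inf by (metis (mono_tags, lifting) UNIV_eq_I mem_Collect_eq)
  then show ?thesis using P R by (intro exI[of _ "\<lambda>i. b1 i + t * (b2 i - b1 i)"]) simp
qed

text \<open>Polynomials whose coefficients are polynomial functions of the parameter, built from
  finitely many terms with monomials independent of \<open>b\<close>.\<close>

inductive polyfam :: "nat \<Rightarrow> ((nat \<Rightarrow> 'k::field) \<Rightarrow> 'k mpoly) \<Rightarrow> bool" for n where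
  single: "polyfun n g \<Longrightarrow> polyfam n (\<lambda>b. Poly_Mapping.single \<nu> (g b))"
| add: "polyfam n \<Phi> \<Longrightarrow> polyfam n \<Psi> \<Longrightarrow> polyfam n (\<lambda>b. \<Phi> b + \<Psi> b)"

lemma polyfam_lookup: "polyfam n \<Phi> \<Longrightarrow> polyfun n (\<lambda>b. Poly_Mapping.lookup (\<Phi> b) \<nu>)"
proof (induction rule: polyfam.induct)
  case (single g \<nu>')
  then show ?case by (cases "\<nu>' = \<nu>") (simp_all add: lookup_single polyfun_const)
qed (simp add: lookup_add polyfun_add)

lemma polyfam_const: "polyfam n (\<lambda>_. p)"
  by (rule poly_mapping_additive_induct[of _ p])
    (auto intro: polyfam.intros polyfun_const polyfam.single[of n "\<lambda>_. 0", simplified])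

lemma polyfam_mult: "polyfam n \<Phi> \<Longrightarrow> polyfam n \<Psi> \<Longrightarrow> polyfam n (\<lambda>b. \<Phi> b * \<Psi> b)"
proof (induction rule: polyfam.induct)
  case (single g \<nu>)
  from single(2) show ?case
    by (induction rule: polyfam.induct)
      (simp_all add: mult_single distrib_left polyfam.intros polyfun_mult single(1))
qed (simp add: distrib_right polyfam.add)

lemma polyfam_power: "polyfam n \<Phi> \<Longrightarrow> polyfam n (\<lambda>b. \<Phi> b ^ k)"
  by (induction k) (auto intro: polyfam_const polyfam_mult)

lemma polyfam_prod: "(\<And>i. i \<in> S \<Longrightarrow> polyfam n (\<Phi> i)) \<Longrightarrow> polyfam n (\<lambda>b. \<Prod>i\<in>S. \<Phi> i b)"
  by (induction S rule: infinite_finite_induct) (auto intro: polyfam_const polyfam_mult)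

lemma polyfam_shift:
  assumes "i < s" "p \<in> poly_ring N"
  shows "polyfam (s * (N + 1)) (\<lambda>b. shift (param_pts N b i) p)"
proof (rule poly_mapping_additive_induct[of _ p])
  have idx: "polyfun (s * (N + 1)) (\<lambda>b. param_pts N b i j)" if "j \<le> N" for j
  proof -
    have "i * (N + 1) + j < Suc i * (N + 1)" using that by simp
    also have "\<dots> \<le> s * (N + 1)" using assms(1) by (intro mult_le_mono1) simp
    finally show ?thesis unfolding param_pts_def by (rule polyfun_coord)
  qed
  fix m assume "m \<in> Poly_Mapping.keys p"
  then have m: "Poly_Mapping.keys m \<subseteq> {..N}" using assms(2) by (auto simp: poly_ring_def)
  have "polyfam (s * (N + 1)) (\<lambda>b. shift_var (param_pts N b i) j)" if "j \<le> N" for j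
    unfolding shift_var_def using that idx[OF that]
    by (cases "j = 0") (auto intro!: polyfam.add polyfam_mult polyfam_const polyfam.single)
  then have "polyfam (s * (N + 1)) (\<lambda>b. Const (Poly_Mapping.lookup p m) * monom_val (shift_var (param_pts N b i)) m)"
    unfolding monom_val_def using m by (intro polyfam_mult polyfam_prod polyfam_power polyfam_const) auto
  then show "polyfam (s * (N + 1)) (\<lambda>b. shift (param_pts N b i) (Poly_Mapping.single m (Poly_Mapping.lookup p m)))"
    by (simp add: shift_def Const.psubst_single)
qed (simp_all add: polyfam_const shift_simps polyfam.add)

text \<open>Gaussian elimination, clearing denominators so that the entries stay polynomial.\<close>
lemma full_rank_open:
  fixes M :: "(nat \<Rightarrow> 'k::field) \<Rightarrow> 'a \<Rightarrow> 'j \<Rightarrow> 'k"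
  assumes "finite J" "finite A" "\<And>a j. a \<in> A \<Longrightarrow> j \<in> J \<Longrightarrow> polyfun n (\<lambda>b. M b a j)"
    and "\<And>x. (\<forall>a\<in>A. (\<Sum>j\<in>J. x j * M b0 a j) = 0) \<Longrightarrow> \<forall>j\<in>J. x j = 0"
  shows "\<exists>g. polyfun n g \<and> g b0 \<noteq> 0 \<and> (\<forall>b. g b \<noteq> 0 \<longrightarrow> (\<forall>y. \<exists>z. \<forall>j\<in>J. (\<Sum>a\<in>A. z a * M b a j) = y j))"
  using assms
proof (induction J arbitrary: M rule: finite_induct)
  case empty
  then show ?case by (intro exI[of _ "\<lambda>_. 1"]) (simp add: polyfun_const)
next
  case (insert i J)
  note sumi = sum.insert[OF insert.hyps]
  obtain e where e: "e \<in> A" "M b0 e i \<noteq> 0"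
  proof (rule ccontr)
    assume "\<not> thesis"
    then have zero: "M b0 a i = 0" if "a \<in> A" for a using that \<open>\<And>e. e \<in> A \<Longrightarrow> M b0 e i \<noteq> 0 \<Longrightarrow> thesis\<close> by blast
    have "(\<Sum>j\<in>insert i J. (if j = i then 1 else 0) * M b0 a j) = 0" if "a \<in> A" for a
      unfolding sumi using zero[OF that] insert.hyps by (intro add_eq_0_iff[THEN iffD2]) (auto intro: sum.neutral)
    then show False using insert.prems(3)[of "\<lambda>j. if j = i then 1 else 0"] by auto
  qed
  \<comment> \<open>Elimination with the pivot \<open>M b e i\<close>, multiplied through by the
    pivot; column i becomes zero.\<close>
  define M' where "M' b a j = M b e i * M b a j - M b a i * M b e j" for b a j
  have "\<exists>g. polyfun n g \<and> g b0 \<noteq> 0 \<and> (\<forall>b. g b \<noteq> 0 \<longrightarrow> (\<forall>y. \<exists>z. \<forall>j\<in>J. (\<Sum>a\<in>A. z a * M' b a j) = y j))"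
  proof (rule insert.IH[OF insert.prems(1)])
    show "polyfun n (\<lambda>b. M' b a j)" if "a \<in> A" "j \<in> J" for a j
      unfolding M'_def using that e(1) insert.prems(2) by (intro polyfun_diff polyfun_mult) auto
    fix x assume x: "\<forall>a\<in>A. (\<Sum>j\<in>J. x j * M' b0 a j) = 0"
    \<comment> \<open>Extends x so that row e is annihilated; any other row of \<open>M\<close>,
      times the pivot, then gives the row of \<open>M'\<close>.\<close>
    define y where "y = x(i := - (\<Sum>j\<in>J. x j * M b0 e j) / M b0 e i)"
    have "\<forall>a\<in>A. (\<Sum>j\<in>insert i J. y j * M b0 a j) = 0"
    proof
      fix a assume a: "a \<in> A"
      have "(\<Sum>j\<in>J. y j * M b0 a j) = (\<Sum>j\<in>J. x j * M b0 a j)"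
        using insert.hyps(2) by (intro sum.cong) (auto simp: y_def)
      then have "M b0 e i * (\<Sum>j\<in>insert i J. y j * M b0 a j)
          = M b0 e i * (\<Sum>j\<in>J. x j * M b0 a j) - (\<Sum>j\<in>J. x j * M b0 e j) * M b0 a i"
        unfolding sumi using e(2) by (simp add: y_def field_simps)
      also have "\<dots> = (\<Sum>j\<in>J. x j * M' b0 a j)"
        by (simp add: M'_def right_diff_distrib sum_subtractf sum_distrib_left sum_distrib_right mult_ac)
      finally show "(\<Sum>j\<in>insert i J. y j * M b0 a j) = 0" using x a e(2) by simp
    qed
    from insert.prems(3)[OF this] show "\<forall>j\<in>J. x j = 0" using insert.hyps(2) by (auto simp: y_def split: if_splits)
  qed
  then obtain g where g: "polyfun n g" "g b0 \<noteq> 0"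
    "\<And>b y. g b \<noteq> 0 \<Longrightarrow> \<exists>z. \<forall>j\<in>J. (\<Sum>a\<in>A. z a * M' b a j) = y j" by blast
  show ?case
  proof (intro exI[of _ "\<lambda>b. g b * M b e i"] conjI allI impI)
    show "polyfun n (\<lambda>b. g b * M b e i)" using g(1) insert.prems(2) e(1) by (intro polyfun_mult) auto
    show "g b0 * M b0 e i \<noteq> 0" using g(2) e(2) by simp
    fix b y assume "g b * M b e i \<noteq> 0"
    then have b: "g b \<noteq> 0" "M b e i \<noteq> 0" by auto
    obtain z where z: "\<forall>j\<in>J. (\<Sum>a\<in>A. z a * M' b a j) = y j - y i / M b e i * M b e j"
      using g(3)[OF b(1), of "\<lambda>j. y j - y i / M b e i * M b e j"] by blast
    define \<sigma> where "\<sigma> = (\<Sum>a\<in>A. z a * M b a i)"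
    \<comment> \<open>Rows scaled by the pivot, with a correction in row e that brings column i to
      \<open>y i\<close>. What this correction adds in the columns of J was subtracted beforehand
      from the target for z.\<close>
    define w where "w a = M b e i * z a + (if a = e then y i / M b e i - \<sigma> else 0)" for a
    have w: "(\<Sum>a\<in>A. w a * M b a j) = M b e i * (\<Sum>a\<in>A. z a * M b a j) + (y i / M b e i - \<sigma>) * M b e j" for j
    proof -
      have "(\<Sum>a\<in>A. (if a = e then y i / M b e i - \<sigma> else 0) * M b a j) = (y i / M b e i - \<sigma>) * M b e j"
        using e(1) insert.prems(1) by (simp add: if_distrib[of "\<lambda>x. x * _"] sum.delta cong: if_cong)
      then show ?thesis by (simp add: w_def distrib_right sum.distrib sum_distrib_left mult.assoc)
    qed
    have "(\<Sum>a\<in>A. w a * M b a j) = y j" if "j \<in> insert i J" for j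
    proof (cases "j = i")
      case True
      then show ?thesis unfolding w using b(2) by (simp add: \<sigma>_def[symmetric] algebra_simps)
    next
      case False
      have "(\<Sum>a\<in>A. z a * M' b a j) = M b e i * (\<Sum>a\<in>A. z a * M b a j) - \<sigma> * M b e j"
        by (simp add: M'_def \<sigma>_def right_diff_distrib sum_subtractf sum_distrib_left sum_distrib_right mult_ac)
      then have "M b e i * (\<Sum>a\<in>A. z a * M b a j) - \<sigma> * M b e j = y j - y i / M b e i * M b e j"
        using z that False by simp
      then have "M b e i * (\<Sum>a\<in>A. z a * M b a j) = \<sigma> * M b e j + (y j - y i / M b e i * M b e j)"
        by (simp only: diff_eq_eq add.commute)
      then show ?thesis unfolding w by (simp add: left_diff_distrib)
    qed
    then show "\<exists>z. \<forall>j\<in>insert i J. (\<Sum>a\<in>A. z a * M b a j) = y j" by blast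
  qed
qed

text \<open>At \<open>b0\<close> a triangular system of forms suffices, ties in \<open>rnk\<close>
  counting as lower entries: in a linear relation between jets, the form belonging to a nonzero
  coefficient of maximal rank isolates that coefficient. So the jets are independent at
  \<open>b0\<close>, and \<open>full_rank_open\<close> carries this over to an open set.\<close>

theorem separates_jets_open:
  fixes b0 :: "nat \<Rightarrow> 'k::field" and rnk :: "nat \<times> (nat \<Rightarrow>\<^sub>0 nat) \<Rightarrow> nat"
  assumes Ss: "S \<le> s" and md: "m \<le> d"
    and tri: "\<And>i \<mu>. i < S \<Longrightarrow> \<mu> \<in> monomials N m \<Longrightarrow> \<exists>E\<in>form N d.
      Poly_Mapping.lookup (shift (param_pts N b0 i) E) (\<mu> + Poly_Mapping.single 0 (d - m)) \<noteq> 0 \<and>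
      (\<forall>i'<S. \<forall>\<mu>'\<in>monomials N m. (i', \<mu>') \<noteq> (i, \<mu>) \<longrightarrow> rnk (i', \<mu>') \<le> rnk (i, \<mu>) \<longrightarrow>
        Poly_Mapping.lookup (shift (param_pts N b0 i') E) (\<mu>' + Poly_Mapping.single 0 (d - m)) = 0)"
  shows "\<exists>g. polyfun (s * (N + 1)) g \<and> g b0 \<noteq> 0 \<and> (\<forall>b. g b \<noteq> 0 \<longrightarrow> separates_jets N S (param_pts N b) m d)"
proof -
  let ?J = "{..<S} \<times> monomials N m"
  define jet where "jet b j E = Poly_Mapping.lookup (shift (param_pts N b (fst j)) E) (snd j + Poly_Mapping.single 0 (d - m))"
    for b :: "nat \<Rightarrow> 'k" and j E
  define M where "M b \<alpha> j = jet b j (Poly_Mapping.single \<alpha> 1)" for b :: "nat \<Rightarrow> 'k" and \<alpha> j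
  have lin: "jet b j (\<Sum>\<alpha>\<in>monomials N d. Const (z \<alpha>) * Poly_Mapping.single \<alpha> 1) = (\<Sum>\<alpha>\<in>monomials N d. z \<alpha> * M b \<alpha> j)"
    for b j z
    by (simp add: jet_def M_def shift_simps lookup_sum lookup_Const_mult)
  have expand: "E = (\<Sum>\<alpha>\<in>monomials N d. Const (Poly_Mapping.lookup E \<alpha>) * Poly_Mapping.single \<alpha> 1)"
    if "E \<in> form N d" for E :: "'k mpoly"
    by (subst poly_mapping_sum_single, rule sum.mono_neutral_cong_left)
      (use that finite_monomials in \<open>auto simp: form_def in_keys_iff mult_single\<close>)
  have "\<exists>g. polyfun (s * (N + 1)) g \<and> g b0 \<noteq> 0 \<and>
    (\<forall>b. g b \<noteq> 0 \<longrightarrow> (\<forall>y. \<exists>z. \<forall>j\<in>?J. (\<Sum>\<alpha>\<in>monomials N d. z \<alpha> * M b \<alpha> j) = y j))"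
  proof (rule full_rank_open)
    show "polyfun (s * (N + 1)) (\<lambda>b. M b \<alpha> j)" if "\<alpha> \<in> monomials N d" "j \<in> ?J" for \<alpha> j
      unfolding M_def jet_def
      using that Ss form_poly_ring[OF form_single[OF that(1)]] by (intro polyfam_lookup polyfam_shift) auto
  next
    fix x assume x: "\<forall>\<alpha>\<in>monomials N d. (\<Sum>j\<in>?J. x j * M b0 \<alpha> j) = 0"
    have x_jet: "(\<Sum>j\<in>?J. x j * jet b0 j E) = 0" if "E \<in> form N d" for E
    proof -
      have "(\<Sum>j\<in>?J. x j * jet b0 j E) = (\<Sum>j\<in>?J. x j * (\<Sum>\<alpha>\<in>monomials N d. Poly_Mapping.lookup E \<alpha> * M b0 \<alpha> j))"
        by (subst expand[OF that]) (simp only: lin)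
      also have "\<dots> = (\<Sum>\<alpha>\<in>monomials N d. Poly_Mapping.lookup E \<alpha> * (\<Sum>j\<in>?J. x j * M b0 \<alpha> j))"
        unfolding sum_distrib_left by (subst sum.swap) (simp add: mult_ac)
      finally show ?thesis using x by simp
    qed
    show "\<forall>j\<in>?J. x j = 0"
    proof (rule ccontr)
      assume nz: "\<not> (\<forall>j\<in>?J. x j = 0)"
      let ?K = "{j \<in> ?J. x j \<noteq> 0}"
      have K: "finite (rnk ` ?K)" "rnk ` ?K \<noteq> {}" using nz finite_monomials by auto
      obtain j where j: "j \<in> ?K" "rnk j = Max (rnk ` ?K)" using Max_in[OF K] by auto
      have max: "rnk j' \<le> rnk j" if "j' \<in> ?K" for j'
        using Max_ge[OF K(1), of "rnk j'"] that unfolding j(2) by auto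
      obtain i \<mu> where i: "j = (i, \<mu>)" by force
      then obtain E where E: "E \<in> form N d" "jet b0 j E \<noteq> 0"
        "\<And>j'. j' \<in> ?J \<Longrightarrow> j' \<noteq> j \<Longrightarrow> rnk j' \<le> rnk j \<Longrightarrow> jet b0 j' E = 0"
        using tri[of i \<mu>] j(1) unfolding jet_def by auto
      have "0 = (\<Sum>j'\<in>?J. x j' * jet b0 j' E)" using x_jet[OF E(1)] by simp
      also have "\<dots> = (\<Sum>j'\<in>?J. if j' = j then x j * jet b0 j E else 0)"
        using max E(3) by (intro sum.cong) auto
      also have "\<dots> = x j * jet b0 j E" using j(1) by (simp add: sum.delta finite_monomials)
      finally show False using j(1) E(2) by simp
    qed
  qed (simp_all add: finite_monomials)
  then obtain g where g: "polyfun (s * (N + 1)) g" "g b0 \<noteq> 0"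
    "\<And>b y. g b \<noteq> 0 \<Longrightarrow> \<exists>z. \<forall>j\<in>?J. (\<Sum>\<alpha>\<in>monomials N d. z \<alpha> * M b \<alpha> j) = y j" by blast
  have "separates_jets N S (param_pts N b) m d" if b: "g b \<noteq> 0" for b
    unfolding separates_jets_def
  proof (intro allI impI ballI)
    fix i \<mu> assume i: "i < S" "\<mu> \<in> monomials N m"
    obtain z where z: "\<forall>j\<in>?J. (\<Sum>\<alpha>\<in>monomials N d. z \<alpha> * M b \<alpha> j) = (if j = (i, \<mu>) then 1 else 0)"
      using g(3)[OF b, of "\<lambda>j. if j = (i, \<mu>) then 1 else 0"] by blast
    define E where "E = (\<Sum>\<alpha>\<in>monomials N d. Const (z \<alpha>) * Poly_Mapping.single \<alpha> 1)"
    have E: "E \<in> form N d" unfolding E_def by (intro form_sum form_Const_mult form_single)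
    have jets: "jet b (k, \<kappa>) E = (if k = i \<and> \<kappa> = \<mu> then 1 else 0)" if "k < S" "\<kappa> \<in> monomials N m" for k \<kappa>
      using z that by (auto simp: E_def lin)
    let ?\<nu> = "\<mu> + Poly_Mapping.single 0 (d - m)"
    have \<nu>: "?\<nu> \<in> monomials N d" using i(2) md monomials_add[of \<mu> N m "Poly_Mapping.single 0 (d - m)" "d - m"]
      by (simp add: monomials_def)
    have "yord (m + 1) (shift (param_pts N b i) E - Poly_Mapping.single ?\<nu> 1)"
    proof (rule yord_from_jets[OF _ md])
      show "shift (param_pts N b i) E - Poly_Mapping.single ?\<nu> 1 \<in> form N d"
        by (intro form_diff shift_form E form_single \<nu>)
      fix \<kappa> assume "\<kappa> \<in> monomials N m"
      from jets[OF i(1) this]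
      show "Poly_Mapping.lookup (shift (param_pts N b i) E - Poly_Mapping.single ?\<nu> 1) (\<kappa> + Poly_Mapping.single 0 (d - m)) = 0"
        by (auto simp: jet_def lookup_minus lookup_single when_def)
    qed
    moreover have "ydeg ?\<nu> \<le> m" using i(2) mon_deg_eq_ydeg[of \<mu>] by (simp add: monomials_def)
    ultimately have "lead (param_pts N b i) ?\<nu> 1 E" unfolding lead_def by (elim yord_mono) simp
    moreover have "yord (m + 1) (shift (param_pts N b j) E)" if "j < S" "j \<noteq> i" for j
      using jets[OF that(1)] that(2) by (intro yord_from_jets[OF shift_form[OF E] md]) (auto simp: jet_def)
    ultimately show "\<exists>E\<in>form N d. lead (param_pts N b i) ?\<nu> 1 E \<and> (\<forall>j<S. j \<noteq> i \<longrightarrow> yord (m + 1) (shift (param_pts N b j) E))"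
      using E by blast
  qed
  with g(1,2) show ?thesis by blast
qed

subsection \<open>Choice of the parameters\<close>

text \<open>Serves the case k = 1, r = N - 2 of \<open>parameters_exist\<close>, where s <= 2^N - 1.
  At N = 4 it is an equality; at N = 3 it would read 8 <= 5, which is the source of the exceptional
  values of s.\<close>

lemma power_2_le_binomial: "4 \<le> N \<Longrightarrow> 2 ^ N \<le> ((2 * N - 2) choose N) + 1"
proof (induction N rule: dec_induct)
  case base
  show ?case by (simp add: numeral_eq_Suc)
next
  case (step N)
  define j where "j = N - 2"
  have j: "N = Suc (Suc j)" using step(1) by (simp add: j_def)
  have "(2 * Suc N - 2) choose Suc N = ((2 * N - 2) choose (N - 1)) + 2 * ((2 * N - 2) choose N) + ((2 * N - 2) choose Suc N)"
    by (simp add: j)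
  moreover have "1 \<le> (2 * N - 2) choose (N - 1)"
    unfolding One_nat_def Suc_le_eq by (rule zero_less_binomial) (simp add: j)
  ultimately show ?case using step by simp
qed

text \<open>With n = N k - 2 the binomial coefficient is the product of (n + i) / i for i = 1, ...,
  N. For 2 <= i < N a factor is at least k + 1, because k (N - i) >= 2. The last one falls short by
  2 / N, and the first, n + 1, makes up for it: this is \<open>quad\<close>.\<close>

lemma power_Suc_le_binomial:
  assumes "3 \<le> N" "2 \<le> k"
  shows "(k + 1) ^ N \<le> (N * k - 2 + N) choose N"
proof -
  have "2 \<le> N * k" using mult_le_mono[of 1 N 2 k] assms by simp
  define n where "n = N * k - 2"
  have n: "n + 2 = N * k" using \<open>2 \<le> N * k\<close> by (simp add: n_def)
  have step: "(k + 1) ^ j * (n + 1) \<le> (n + Suc j) choose Suc j" if "Suc j < N" for j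
    using that
  proof (induction j)
    case (Suc j)
    have "N - Suc (Suc j) \<ge> 1" using Suc.prems by simp
    then have "k * 1 \<le> k * (N - Suc (Suc j))" by (intro mult_le_mono2)
    then have "k * Suc (Suc j) + 2 \<le> k * N" using assms(2) Suc.prems by (simp add: diff_mult_distrib2)
    then have nj: "(k + 1) * Suc (Suc j) \<le> n + Suc (Suc j)" using n by (simp add: mult.commute)
    have "(k + 1) ^ Suc j * (n + 1) * Suc (Suc j) = ((k + 1) * Suc (Suc j)) * ((k + 1) ^ j * (n + 1))"
      by (simp only: power_Suc mult_ac)
    also have "\<dots> \<le> (n + Suc (Suc j)) * ((n + Suc j) choose Suc j)"
      using Suc by (intro mult_le_mono nj) simp
    also have "\<dots> = ((n + Suc (Suc j)) choose Suc (Suc j)) * Suc (Suc j)"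
      using Suc_times_binomial_eq[of "n + Suc j" "Suc j"] by (simp del: binomial_Suc_Suc)
    finally show ?case by (simp only: mult_le_cancel2)
  qed simp
  define j where "j = N - 2"
  have j: "N = Suc (Suc j)" using assms(1) by (simp add: j_def)
  have "k + 1 \<le> k * k" using mult_le_mono1[OF assms(2), of k] assms(2) by linarith
  then have "int k + 1 \<le> int k * int k" by (metis of_nat_1 of_nat_add of_nat_le_iff of_nat_mult)
  have quad: "N * (k + 1) ^ 2 \<le> (n + N) * (n + 1)"
  proof -
    have n': "int n = int N * int k - 2" using n by (metis add_diff_cancel_right' of_nat_add of_nat_mult of_nat_numeral)
    have "0 \<le> int N * ((int N - 3) * (int k * (int k + 1)))" using assms(1) by simp
    moreover have "0 \<le> int N * (2 * (int k * int k - int k - 1))" using \<open>int k + 1 \<le> int k * int k\<close> by simp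
    moreover have "(int n + int N) * (int n + 1) - int N * (int k + 1) ^ 2 =
      int N * ((int N - 3) * (int k * (int k + 1))) + int N * (2 * (int k * int k - int k - 1)) + 2"
      unfolding n' by (simp add: algebra_simps power2_eq_square)
    ultimately have "int N * (int k + 1) ^ 2 \<le> (int n + int N) * (int n + 1)" by linarith
    then have "int (N * (k + 1) ^ 2) \<le> int ((n + N) * (n + 1))"
      by (simp only: of_nat_mult of_nat_add of_nat_power of_nat_1)
    then show ?thesis by (simp only: of_nat_le_iff)
  qed
  have "(k + 1) ^ N * N = (k + 1) ^ j * (N * (k + 1) ^ 2)"
    unfolding j by (simp only: power_Suc power2_eq_square mult_ac)
  also have "\<dots> \<le> (k + 1) ^ j * ((n + N) * (n + 1))" by (intro mult_le_mono2 quad)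
  also have "\<dots> = (n + N) * ((k + 1) ^ j * (n + 1))" by (simp only: mult_ac)
  also have "\<dots> \<le> (n + N) * ((n + Suc j) choose Suc j)" by (intro mult_le_mono2 step) (simp add: j)
  also have "\<dots> = ((n + N) choose N) * N"
    using Suc_times_binomial_eq[of "n + Suc j" "Suc j"] by (simp add: j del: binomial_Suc_Suc)
  finally have "(k + 1) ^ N \<le> (n + N) choose N" using assms(1) by simp
  then show ?thesis by (simp add: n_def)
qed

text \<open>In the general case k is the integer N-th root of s and S = k^N. The strict inequality
  then means r + 1 < N k, and r = N k - 2 is the largest solution, giving the most forms.\<close>

lemma parameters_exist:
  assumes "3 \<le> N" "1 \<le> s"
  shows "\<exists>k S r. 1 \<le> k \<and> 1 \<le> S \<and> S \<le> s \<and> S \<le> k ^ N \<and> s \<le> ((r + N) choose N) \<and> (r + 1) * k ^ (N - 1) < N * S"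
proof (cases "N = 3 \<and> s \<le> 7")
  case True
  show ?thesis
  proof (cases "s \<le> 4")
    case True
    \<comment> \<open>Here k = S = r = 1.\<close>
    then show ?thesis using assms \<open>N = 3 \<and> s \<le> 7\<close>
      by (intro exI[of _ 1]) (simp add: numeral_eq_Suc)
  next
    case False
    \<comment> \<open>Here k = 2, S = 5, r = 2: the inequality is 3 * 4 < 3 * 5, and there are 10
      monomials of degree 2.\<close>
    then show ?thesis using \<open>N = 3 \<and> s \<le> 7\<close>
      by (intro exI[of _ 2] exI[of _ 5]) (simp add: numeral_eq_Suc)
  qed
next
  case False
  define k where "k = (LEAST k. s < Suc k ^ N)"
  have "s < 2 ^ s" by (rule less_exp)
  have "Suc s ^ 1 \<le> Suc s ^ N" using assms by (intro power_increasing) auto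
  then have "s < Suc s ^ N" by simp
  then have k1: "s < Suc k ^ N" unfolding k_def by (rule LeastI)
  have k0: "k \<noteq> 0" using k1 assms by (intro notI) simp
  then obtain k' where k': "k = Suc k'" by (metis not0_implies_Suc)
  have "\<not> s < Suc k' ^ N" using not_less_Least[of k' "\<lambda>k. s < Suc k ^ N"] k' by (simp add: k_def)
  then have k2: "k ^ N \<le> s" by (simp add: k')
  have Nk: "2 \<le> N * k" using mult_le_mono[of 2 N 1 k] assms k0 by simp
  have "s \<le> (N * k - 2 + N) choose N"
  proof (cases "k = 1")
    case True
    have "4 \<le> N" using False k1 True assms by (cases "N = 3") (auto simp: eval_nat_numeral)
    then have "2 ^ N \<le> ((2 * N - 2) choose N) + 1" by (rule power_2_le_binomial)
    moreover have "N * k - 2 + N = 2 * N - 2" using True assms by simp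
    moreover have "s < 2 ^ N" using k1 True by (simp add: numeral_2_eq_2)
    ultimately show ?thesis by simp
  next
    case False
    then show ?thesis using power_Suc_le_binomial[of N k] assms k0 k1 by simp
  qed
  moreover have "(N * k - 2 + 1) * k ^ (N - 1) < N * k ^ N"
  proof -
    have "(N * k - 2 + 1) * k ^ (N - 1) < (N * k) * k ^ (N - 1)"
      using Nk k0 by (intro mult_strict_right_mono) auto
    also have "\<dots> = N * k ^ N" using assms by (simp add: power_eq_if[of k N])
    finally show ?thesis .
  qed
  ultimately show ?thesis using k0 k2
    by (intro exI[of _ k] exI[of _ "k ^ N"] exI[of _ "N * k - 2"]) simp
qed

text \<open>The ratio k (m + N) / m tends to k, so the strict inequality with k persists for some m.
  This absorbs the extra degree k N spent on separating the grid points.\<close>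

lemma jet_order_exists:
  fixes N k S r q :: nat
  assumes "r * k ^ q < N * S"
  shows "\<exists>m\<ge>1. real r * real (k * (m + N)) ^ q < real N * real S * real m ^ q"
proof -
  have "(\<lambda>n. real r * (real k + real (k * N) / real (Suc n)) ^ q) \<longlonglongrightarrow> real r * (real k + 0) ^ q"
    by (intro tendsto_intros LIMSEQ_Suc[OF lim_const_over_n])
  moreover have "real r * (real k + 0) ^ q < real N * real S"
    using assms by (metis add.right_neutral of_nat_less_iff of_nat_mult of_nat_power)
  ultimately have "\<forall>\<^sub>F n in sequentially. real r * (real k + real (k * N) / real (Suc n)) ^ q < real N * real S"
    by (rule order_tendstoD(2))
  then obtain n where n: "real r * (real k + real (k * N) / real (Suc n)) ^ q < real N * real S"
    by (auto simp: eventually_sequentially)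
  have "real (k * (Suc n + N)) = real (Suc n) * (real k + real (k * N) / real (Suc n))"
    by (simp add: field_simps)
  then have "real r * real (k * (Suc n + N)) ^ q = (real r * (real k + real (k * N) / real (Suc n)) ^ q) * real (Suc n) ^ q"
    by (simp only: power_mult_distrib mult_ac)
  also have "\<dots> < (real N * real S) * real (Suc n) ^ q"
    by (rule mult_strict_right_mono[OF n]) simp
  finally show ?thesis by (intro exI[of _ "Suc n"]) simp
qed

subsection \<open>Special configurations of points\<close>

definition flatten :: "nat \<Rightarrow> (nat \<Rightarrow> nat \<Rightarrow> 'k) \<Rightarrow> nat \<Rightarrow> 'k" where
  "flatten N A l = A (l div (N + 1)) (l mod (N + 1))"

lemma param_pts_flatten: "j \<le> N \<Longrightarrow> param_pts N (flatten N A) i j = A i j"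
proof -
  assume "j \<le> N"
  then have "(i * Suc N + j) div Suc N = i" "(i * Suc N + j) mod Suc N = j"
    by (simp_all del: mult_Suc_right)
  then show ?thesis unfolding param_pts_def flatten_def Suc_eq_plus1 by simp
qed

definition lin :: "nat \<Rightarrow> 'k \<Rightarrow> 'k::field mpoly" where
  "lin j c = Var j - Const c * Var 0"

lemma lin_form: "j \<le> N \<Longrightarrow> lin j c \<in> form N 1"
  unfolding lin_def by (intro form_diff form_Const_mult form_Var) simp_all

lemma shift_lin:
  assumes "a 0 = 1" "j \<noteq> 0"
  shows "shift a (lin j c) = Var j + Const (a j - c) * Var 0"
proof -
  have "(Const 1 :: 'a mpoly) = 1" by simp
  then show ?thesis
    using assms by (simp add: lin_def shift_simps shift_var_def single_diff left_diff_distrib)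
qed

lemma restr_lin: "a 0 = 1 \<Longrightarrow> restr a (lin j c) = [:0, a j - c:]"
  by (simp add: lin_def restr_simps)

lemma restr_prod: "restr a (\<Prod>i\<in>S. f i) = (\<Prod>i\<in>S. restr a (f i))"
  unfolding restr_def by (rule poly_hom.psubst_prod)

lemma jet0_eq_0_iff:
  assumes "E \<in> form N r"
  shows "Poly_Mapping.lookup (shift a E) (Poly_Mapping.single 0 r) = 0 \<longleftrightarrow> restr a E = 0"
proof -
  have "Poly_Mapping.lookup (shift a E) (Poly_Mapping.single 0 d) = 0" if "d \<noteq> r" for d
  proof -
    have "Poly_Mapping.single 0 d \<notin> Poly_Mapping.keys (shift a E)"
      using shift_form[OF assms, of a] that by (auto simp: form_def monomials_def)
    then show ?thesis by (simp add: in_keys_iff)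
  qed
  then have "restr a E = monom (Poly_Mapping.lookup (shift a E) (Poly_Mapping.single 0 r)) r"
    by (intro poly_eqI) (simp add: coeff_restr)
  then show ?thesis by simp
qed

lemma of_nat_inj_CHAR_0:
  assumes "CHAR('k::field) = 0"
  shows "(of_nat a :: 'k) = of_nat b \<longleftrightarrow> a = b"
proof -
  have *: "a = b" if "(of_nat a :: 'k) = of_nat b" "a \<le> b" for a b
  proof -
    have "(of_nat (b - a) :: 'k) = 0" using that by (simp add: of_nat_diff)
    then have "CHAR('k) dvd b - a" by (simp only: of_nat_eq_0_iff_char_dvd)
    then show ?thesis using assms that by simp
  qed
  show ?thesis using *[of a b] *[of b a] by (metis nle_le)
qed

lemma infinite_UNIV_CHAR_0:
  assumes "CHAR('k::field) = 0"
  shows "infinite (UNIV :: 'k set)"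
proof
  assume "finite (UNIV :: 'k set)"
  moreover have "inj (of_nat :: nat \<Rightarrow> 'k)" using of_nat_inj_CHAR_0[OF assms] by (auto intro: injI)
  ultimately show False using finite_imageD[of of_nat UNIV] finite_subset[of "range of_nat"] infinite_UNIV_nat by blast
qed

text \<open>The points \<open>[1 : e\<^sub>1 : \<dots> : e\<^sub>N]\<close> with \<open>e\<close> running through exponents of degree at most \<open>r\<close>.\<close>
lemma separated_points_open:
  assumes char: "CHAR('k::field) = 0" and s: "s \<le> (r + N) choose N"
  shows "\<exists>g (b0 :: nat \<Rightarrow> 'k). polyfun (s * (N + 1)) g \<and> g b0 \<noteq> 0 \<and>
    (\<forall>b. g b \<noteq> 0 \<longrightarrow> separates_jets N s (param_pts N b) 0 r)"
proof -
  have "card {..<s} \<le> card (monomials N r)" using s by (simp add: card_monomials)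
  then obtain e where e: "e ` {..<s} \<subseteq> monomials N r" "inj_on e {..<s}"
    using card_le_inj[of "{..<s}" "monomials N r"] finite_monomials by auto
  define b0 :: "nat \<Rightarrow> 'k" where
    "b0 = flatten N (\<lambda>i j. if j = 0 then 1 else of_nat (Poly_Mapping.lookup (e i) j))"
  let ?A = "param_pts N b0"
  have A: "?A i 0 = 1" "j \<in> {1..N} \<Longrightarrow> ?A i j = of_nat (Poly_Mapping.lookup (e i) j)" for i j
    by (simp_all add: b0_def param_pts_flatten)
  \<comment> \<open>A Newton interpolation form: at the point belonging to e' it is nonzero exactly
    when e' dominates \<open>e i\<close> in the coordinates 1, ..., N.\<close>
  define E :: "nat \<Rightarrow> 'k mpoly" where
    "E i = Var 0 ^ Poly_Mapping.lookup (e i) 0 * (\<Prod>j\<in>{1..N}. \<Prod>c<Poly_Mapping.lookup (e i) j. lin j (of_nat c))" for i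
  have E: "E i \<in> form N r" if "i < s" for i
  proof -
    have ei: "Poly_Mapping.keys (e i) \<subseteq> {..N}" "mon_deg (e i) = r" using e(1) that by (auto simp: monomials_def)
    have "(\<Prod>j\<in>{1..N}. \<Prod>c<Poly_Mapping.lookup (e i) j. lin j (of_nat c)) \<in>
        form N (\<Sum>j\<in>{1..N}. \<Sum>c<Poly_Mapping.lookup (e i) j. 1)"
      by (intro form_prod lin_form) simp
    from form_mult[OF form_power[OF form_Var[of 0 N]] this, of "Poly_Mapping.lookup (e i) 0"]
    show ?thesis using ei(2) mon_deg_eq_ydeg[of "e i"] ydeg_eq_sum[OF ei(1)] unfolding E_def by (simp add: add.commute)
  qed
  have restr_E: "restr (?A i') (E i) = 0 \<longleftrightarrow>
      (\<exists>j\<in>{1..N}. Poly_Mapping.lookup (e i') j < Poly_Mapping.lookup (e i) j)" for i i'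
  proof -
    have "restr (?A i') (lin j (of_nat c)) = 0 \<longleftrightarrow> c = Poly_Mapping.lookup (e i') j" if "j \<in> {1..N}" for j c
      using A(1)[of i'] A(2)[OF that, of i'] of_nat_inj_CHAR_0[OF char, of "Poly_Mapping.lookup (e i') j" c]
      by (auto simp: restr_lin)
    then show ?thesis using A by (auto simp: E_def restr_simps restr_prod)
  qed
  have mono0: "monomials N 0 = {0}"
  proof -
    have "m = 0" if "mon_deg m = 0" for m :: "nat \<Rightarrow>\<^sub>0 nat"
      using that lookup_le_mon_deg[of m] by (intro poly_mapping_eqI) simp
    then show ?thesis by (auto simp: monomials_def)
  qed
  have "\<exists>g. polyfun (s * (N + 1)) g \<and> g b0 \<noteq> 0 \<and> (\<forall>b. g b \<noteq> 0 \<longrightarrow> separates_jets N s (param_pts N b) 0 r)"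
  \<comment> \<open>Domination together with \<open>ydeg (e i') \<le> ydeg (e i)\<close> forces
    equality, so the system is triangular with respect to \<open>ydeg\<close>.\<close>
  proof (rule separates_jets_open[where rnk = "\<lambda>(i, _). ydeg (e i)"])
    fix i \<mu> assume i: "i < s" and \<mu>: "\<mu> \<in> monomials N 0"
    have "restr (?A i) (E i) \<noteq> 0" by (simp add: restr_E)
    moreover have "restr (?A i') (E i) = 0" if "i' < s" "i' \<noteq> i" "ydeg (e i') \<le> ydeg (e i)" for i'
    proof (rule ccontr)
      assume "restr (?A i') (E i) \<noteq> 0"
      then have le: "Poly_Mapping.lookup (e i) j \<le> Poly_Mapping.lookup (e i') j" if "j \<in> {1..N}" for j
        using that by (auto simp: restr_E not_less)
      have k: "Poly_Mapping.keys (e i) \<subseteq> {..N}" "Poly_Mapping.keys (e i') \<subseteq> {..N}" "mon_deg (e i) = mon_deg (e i')"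
        using e(1) i that(1) by (auto simp: monomials_def)
      have sums: "(\<Sum>j\<in>{1..N}. Poly_Mapping.lookup (e i) j) = (\<Sum>j\<in>{1..N}. Poly_Mapping.lookup (e i') j)"
      proof (rule antisym)
        show "(\<Sum>j\<in>{1..N}. Poly_Mapping.lookup (e i) j) \<le> (\<Sum>j\<in>{1..N}. Poly_Mapping.lookup (e i') j)"
          by (rule sum_mono[OF le])
      qed (use that(3) ydeg_eq_sum[OF k(1)] ydeg_eq_sum[OF k(2)] in simp)
      have eq: "Poly_Mapping.lookup (e i) j = Poly_Mapping.lookup (e i') j" if "j \<in> {1..N}" for j
        using sum_mono_inv[OF sums le that] by simp
      have "e i = e i'"
      proof (rule poly_mapping_eqI)
        fix j
        consider "j = 0" | "j \<in> {1..N}" | "N < j" by fastforce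
        then show "Poly_Mapping.lookup (e i) j = Poly_Mapping.lookup (e i') j"
        proof cases
          case 1
          then show ?thesis
            using k(3) sums mon_deg_eq_ydeg[of "e i"] mon_deg_eq_ydeg[of "e i'"] ydeg_eq_sum[OF k(1)] ydeg_eq_sum[OF k(2)]
            by simp
        next
          case 3
          then have "j \<notin> Poly_Mapping.keys (e i)" "j \<notin> Poly_Mapping.keys (e i')" using k(1,2) by auto
          then show ?thesis by (simp add: in_keys_iff)
        qed (rule eq)
      qed
      then show False using e(2) i that(1,2) by (auto simp: inj_on_def)
    qed
    ultimately show "\<exists>E\<in>form N r.
      Poly_Mapping.lookup (shift (?A i) E) (\<mu> + Poly_Mapping.single 0 (r - 0)) \<noteq> 0 \<and>
      (\<forall>i'<s. \<forall>\<mu>'\<in>monomials N 0. (i', \<mu>') \<noteq> (i, \<mu>) \<longrightarrow>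
        (case (i', \<mu>') of (i, _) \<Rightarrow> ydeg (e i)) \<le> (case (i, \<mu>) of (i, _) \<Rightarrow> ydeg (e i)) \<longrightarrow>
        Poly_Mapping.lookup (shift (?A i') E) (\<mu>' + Poly_Mapping.single 0 (r - 0)) = 0)"
      using \<mu> jet0_eq_0_iff[OF E[OF i]] by (intro bexI[OF _ E[OF i]]) (auto simp: mono0)
  qed simp_all
  then show ?thesis by blast
qed

text \<open>\<open>lead\<close> up to a nonzero scalar and a power of x_0. Products then only add
  the exponents n, and the power of x_0 is recovered at the end from the degree.\<close>

definition yleading :: "(nat \<Rightarrow> 'k::field) \<Rightarrow> (nat \<Rightarrow>\<^sub>0 nat) \<Rightarrow> 'k mpoly \<Rightarrow> bool" where
  "yleading a n E \<longleftrightarrow> (\<exists>\<kappa> e. \<kappa> \<noteq> 0 \<and> lead a (n + Poly_Mapping.single 0 e) \<kappa> E)"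

lemma yleading_mult: "yleading a n E \<Longrightarrow> yleading a n' E' \<Longrightarrow> yleading a (n + n') (E * E')"
  unfolding yleading_def
proof (elim exE conjE)
  fix \<kappa> e \<kappa>' e'
  assume "\<kappa> \<noteq> 0" "\<kappa>' \<noteq> 0" "lead a (n + Poly_Mapping.single 0 e) \<kappa> E" "lead a (n' + Poly_Mapping.single 0 e') \<kappa>' E'"
  then show "\<exists>\<kappa> e. \<kappa> \<noteq> 0 \<and> lead a (n + n' + Poly_Mapping.single 0 e) \<kappa> (E * E')"
    using lead_mult[of a "n + Poly_Mapping.single 0 e" \<kappa> E "n' + Poly_Mapping.single 0 e'" \<kappa>' E']
    by (intro exI[of _ "\<kappa> * \<kappa>'"] exI[of _ "e + e'"]) (simp add: single_add add_ac)
qed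

lemma yleading_1: "yleading a 0 1"
  unfolding yleading_def by (intro exI[of _ 1] exI[of _ 0]) (simp add: lead_1)

lemma yleading_power: "yleading a (Poly_Mapping.single j 1) E \<Longrightarrow> yleading a (Poly_Mapping.single j n) (E ^ n)"
proof (induction n)
  case (Suc n)
  then show ?case using yleading_mult[of a "Poly_Mapping.single j 1" E "Poly_Mapping.single j n" "E ^ n"]
    by (simp flip: single_add)
qed (simp add: yleading_1)

lemma yleading_prod:
  "(\<And>i. i \<in> S \<Longrightarrow> yleading a (n i) (E i)) \<Longrightarrow> yleading a (\<Sum>i\<in>S. n i) (\<Prod>i\<in>S. E i)"
  by (induction S rule: infinite_finite_induct) (auto intro: yleading_1 yleading_mult)

lemma yleading_lin:
  assumes "a 0 = 1" "j \<noteq> 0"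
  shows "a j = c \<Longrightarrow> yleading a (Poly_Mapping.single j 1) (lin j c)"
    and "a j \<noteq> c \<Longrightarrow> yleading a 0 (lin j c)"
proof -
  assume "a j = c"
  then have "lead a (Poly_Mapping.single j 1 + Poly_Mapping.single 0 0) 1 (lin j c)"
    using assms by (simp add: lead_def shift_lin Var_def)
  then show "yleading a (Poly_Mapping.single j 1) (lin j c)"
    unfolding yleading_def by (intro exI[of _ 1] exI[of _ 0]) simp
next
  assume ne: "a j \<noteq> c"
  have "shift a (lin j c) - Poly_Mapping.single (Poly_Mapping.single 0 1) (a j - c) = Var j"
    using assms by (simp add: shift_lin) (simp add: Var_def mult_single)
  moreover have "yord 1 (Var j :: 'a mpoly)" unfolding Var_def using assms(2) by (intro yord_single) simp
  ultimately have "lead a (0 + Poly_Mapping.single 0 1) (a j - c) (lin j c)"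
    by (simp add: lead_def)
  with ne show "yleading a 0 (lin j c)"
    unfolding yleading_def by (intro exI[of _ "a j - c"] exI[of _ 1]) simp
qed

lemma yord_prod: "(\<And>i. i \<in> S \<Longrightarrow> yord (n i) (f i)) \<Longrightarrow> yord (\<Sum>i\<in>S. n i) (\<Prod>i\<in>S. f i)"
  by (induction S rule: infinite_finite_induct) (auto intro: yord_mult)

lemma yord_prod_1: "finite S \<Longrightarrow> i \<in> S \<Longrightarrow> yord 1 (f i) \<Longrightarrow> yord 1 (\<Prod>i\<in>S. f i)"
  using yord_mult[of 1 "f i" 0] by (simp add: prod.remove[of S i])

text \<open>Points of the grid \<open>{0, \<dots>, k - 1}\<^sup>N\<close>, which is cut out by \<open>N\<close> forms of degree \<open>k\<close>.\<close>
lemma grid_jets_open: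
  assumes char: "CHAR('k::field) = 0" and S: "S \<le> s" "S \<le> k ^ N" and k: "1 \<le> k"
  shows "\<exists>g (b0 :: nat \<Rightarrow> 'k). polyfun (s * (N + 1)) g \<and> g b0 \<noteq> 0 \<and>
    (\<forall>b. g b \<noteq> 0 \<longrightarrow> separates_jets N S (param_pts N b) m (k * (m + N)))"
proof -
  let ?d = "k * (m + N)"
  have "card {..<S} \<le> card ({1..N} \<rightarrow>\<^sub>E {..<k})" using S by (simp add: card_PiE)
  then obtain \<gamma> where \<gamma>: "\<gamma> ` {..<S} \<subseteq> {1..N} \<rightarrow>\<^sub>E {..<k}" "inj_on \<gamma> {..<S}"
    using card_le_inj[of "{..<S}" "{1..N} \<rightarrow>\<^sub>E {..<k}"] by (auto simp: finite_PiE)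
  have \<gamma>_less: "\<gamma> i j < k" if "i < S" "j \<in> {1..N}" for i j using \<gamma>(1) that by (auto simp: PiE_iff)
  have \<gamma>_ne: "\<exists>j\<in>{1..N}. \<gamma> i j \<noteq> \<gamma> i' j" if "i < S" "i' < S" "i \<noteq> i'" for i i'
  proof (rule ccontr)
    assume "\<not> ?thesis"
    then have "\<gamma> i = \<gamma> i'" using \<gamma>(1) that(1,2) by (intro PiE_ext[of _ "{1..N}" "\<lambda>_. {..<k}"]) auto
    then show False using \<gamma>(2) that by (auto simp: inj_on_def)
  qed
  define b0 :: "nat \<Rightarrow> 'k" where "b0 = flatten N (\<lambda>i j. if j = 0 then 1 else of_nat (\<gamma> i j))"
  let ?A = "param_pts N b0"
  have A: "?A i 0 = 1" "j \<in> {1..N} \<Longrightarrow> ?A i j = of_nat (\<gamma> i j)" for i j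
    by (simp_all add: b0_def param_pts_flatten)
  \<comment> \<open>\<open>f j\<close> vanishes at all chosen grid points, with leading jet a
    multiple of x_j. The form \<open>h i\<close> is nonzero at the i-th point and vanishes at the
    others.\<close>
  define f :: "nat \<Rightarrow> 'k mpoly" where "f j = (\<Prod>c<k. lin j (of_nat c))" for j
  define h :: "nat \<Rightarrow> 'k mpoly" where "h i = (\<Prod>j\<in>{1..N}. \<Prod>c\<in>{..<k} - {\<gamma> i j}. lin j (of_nat c))" for i
  have lead_lin: "yleading (?A i) (if c = \<gamma> i j then Poly_Mapping.single j 1 else 0) (lin j (of_nat c))" if "j \<in> {1..N}" for i j c
    using yleading_lin[of "?A i" j "of_nat c"] A that of_nat_inj_CHAR_0[OF char, of "\<gamma> i j" c] by auto
  have lead_rest: "yleading (?A i) 0 (\<Prod>c\<in>{..<k} - {\<gamma> i j}. lin j (of_nat c))" if "j \<in> {1..N}" for i j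
  proof -
    have "yleading (?A i) 0 (lin j (of_nat c))" if "c \<noteq> \<gamma> i j" for c
      using lead_lin[OF \<open>j \<in> {1..N}\<close>, of i c] that by simp
    then show ?thesis
      using yleading_prod[of "{..<k} - {\<gamma> i j}" "?A i" "\<lambda>_. 0" "\<lambda>c. lin j (of_nat c)"] by simp
  qed
  have lead_f: "yleading (?A i) (Poly_Mapping.single j 1) (f j)" if "i < S" "j \<in> {1..N}" for i j
    using yleading_mult[OF lead_lin[OF that(2), of i "\<gamma> i j"] lead_rest[OF that(2), of i]] \<gamma>_less[OF that]
    by (simp add: f_def prod.remove[of "{..<k}" "\<gamma> i j"])
  have lead_h: "yleading (?A i) 0 (h i)" for i
    using yleading_prod[of "{1..N}" "?A i" "\<lambda>_. 0"] lead_rest by (simp add: h_def)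
  have yord_lin: "yord 1 (shift (?A i) (lin j (of_nat (\<gamma> i j))))" if "j \<in> {1..N}" for i j
    using A that by (simp add: shift_lin) (simp add: Var_def yord_single)
  have yord_f: "yord 1 (shift (?A i) (f j))" if "i < S" "j \<in> {1..N}" for i j
    unfolding f_def shift_simps using yord_lin[OF that(2)] \<gamma>_less[OF that] by (intro yord_prod_1) auto
  have yord_h: "yord 1 (shift (?A i') (h i))" if i: "i < S" "i' < S" "i' \<noteq> i" for i i'
  proof -
    obtain j where j: "j \<in> {1..N}" "\<gamma> i' j \<noteq> \<gamma> i j" using \<gamma>_ne[OF i(2,1,3)] by auto
    have "yord 1 (\<Prod>c\<in>{..<k} - {\<gamma> i j}. shift (?A i') (lin j (of_nat c)))"
      using yord_lin[OF j(1), of i'] \<gamma>_less[OF i(2) j(1)] j(2) by (intro yord_prod_1) auto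
    then show ?thesis unfolding h_def shift_simps by (intro yord_prod_1[OF _ j(1)]) simp_all
  qed
  \<comment> \<open>\<open>F \<mu>\<close> has leading jet \<open>\<mu>\<close>, up to a scalar and
    powers of x_0, at every chosen point. Multiplying by \<open>h i\<close> keeps it at the i-th
    point and raises the order by one elsewhere; the power of x_0 fills up the degree.\<close>
  define F :: "(nat \<Rightarrow>\<^sub>0 nat) \<Rightarrow> 'k mpoly" where "F \<mu> = (\<Prod>j\<in>{1..N}. f j ^ Poly_Mapping.lookup \<mu> j)" for \<mu>
  define E :: "nat \<Rightarrow> (nat \<Rightarrow>\<^sub>0 nat) \<Rightarrow> 'k mpoly" where
    "E i \<mu> = Var 0 ^ (?d - k * ydeg \<mu> - N * (k - 1)) * (F \<mu> * h i)" for i \<mu>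
  have "\<exists>g. polyfun (s * (N + 1)) g \<and> g b0 \<noteq> 0 \<and>
    (\<forall>b. g b \<noteq> 0 \<longrightarrow> separates_jets N S (param_pts N b) m (k * (m + N)))"
  proof (rule separates_jets_open[OF S(1), where rnk = "\<lambda>(_, \<mu>). ydeg \<mu>"])
    show md: "m \<le> ?d" using mult_le_mono[OF k, of m "m + N"] by simp
    fix i \<mu> assume i: "i < S" and \<mu>: "\<mu> \<in> monomials N m"
    have \<mu>k: "Poly_Mapping.keys \<mu> \<subseteq> {..N}" "mon_deg \<mu> = m" using \<mu> by (auto simp: monomials_def)
    have y\<mu>: "ydeg \<mu> \<le> m" using \<mu>k(2) mon_deg_eq_ydeg[of \<mu>] by simp
    have E_form: "E i \<mu> \<in> form N ?d"
    proof -
      have lf: "lin j (of_nat c) \<in> (form N 1 :: 'k mpoly set)" if "j \<in> {1..N}" for j c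
        using that by (intro lin_form) simp
      have "f j \<in> form N k" if "j \<in> {1..N}" for j
        using form_prod[of "{..<k}" "\<lambda>c. lin j (of_nat c) :: 'k mpoly" N "\<lambda>_. 1"] lf[OF that] by (simp add: f_def)
      then have "F \<mu> \<in> form N (\<Sum>j\<in>{1..N}. Poly_Mapping.lookup \<mu> j * k)"
        unfolding F_def by (intro form_prod form_power) auto
      then have "F \<mu> \<in> form N (k * ydeg \<mu>)"
        using ydeg_eq_sum[OF \<mu>k(1)] by (simp add: sum_distrib_left mult.commute)
      moreover have "h i \<in> form N (\<Sum>j\<in>{1..N}. k - 1)"
        unfolding h_def
      proof (rule form_prod)
        fix j assume j: "j \<in> {1..N}"
        show "(\<Prod>c\<in>{..<k} - {\<gamma> i j}. lin j (of_nat c)) \<in> (form N (k - 1) :: 'k mpoly set)"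
          using form_prod[of "{..<k} - {\<gamma> i j}" "\<lambda>c. lin j (of_nat c) :: 'k mpoly" N "\<lambda>_. 1"] lf[OF j] \<gamma>_less[OF i j]
          by (simp add: card_Diff_singleton)
      qed
      ultimately have "Var 0 ^ (?d - k * ydeg \<mu> - N * (k - 1)) * (F \<mu> * h i) \<in>
          form N ((?d - k * ydeg \<mu> - N * (k - 1)) * 1 + (k * ydeg \<mu> + (\<Sum>j\<in>{1..N}. k - 1)))"
        by (intro form_mult form_power form_Var) simp_all
      \<comment> \<open>The origin of the degree k (m + N): at most k m for the jet, and at most N k
        for \<open>h i\<close>.\<close>
      moreover have "k * ydeg \<mu> + N * (k - 1) \<le> ?d"
      proof -
        have "N * (k - 1) \<le> N * k" by simp
        moreover have "k * ydeg \<mu> \<le> k * m" using y\<mu> by simp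
        ultimately show ?thesis unfolding distrib_left mult.commute[of k N] by linarith
      qed
      ultimately show ?thesis unfolding E_def by simp
    qed
    let ?n = "\<Sum>j\<in>{1..N}. Poly_Mapping.single j (Poly_Mapping.lookup \<mu> j)"
    have n: "Poly_Mapping.lookup ?n j = (if j \<in> {1..N} then Poly_Mapping.lookup \<mu> j else 0)" for j
      by (simp add: lookup_sum lookup_single when_def sum.delta)
    have \<mu>n: "\<mu> = ?n + Poly_Mapping.single 0 (Poly_Mapping.lookup \<mu> 0)"
    proof (rule poly_mapping_eqI)
      fix j
      show "Poly_Mapping.lookup \<mu> j = Poly_Mapping.lookup (?n + Poly_Mapping.single 0 (Poly_Mapping.lookup \<mu> 0)) j"
        unfolding lookup_add n
        using \<mu>k(1) by (cases "j \<le> N"; cases "j = 0") (auto simp: lookup_single when_def in_keys_iff)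
    qed
    have "yleading (?A i) ?n (F \<mu>)"
      unfolding F_def using lead_f[OF i] by (intro yleading_prod yleading_power) auto
    from yleading_mult[OF this lead_h[of i]] have "yleading (?A i) ?n (F \<mu> * h i)" by simp
    moreover have "yleading (?A i) 0 (Var 0 ^ e)" for e
    proof -
      have "lead (?A i) (Poly_Mapping.single 0 1) 1 (Var 0)"
      proof -
        have "shift (?A i) (Var 0) = Var 0" using A by (simp add: shift_var_def)
        then show ?thesis unfolding lead_def by (simp only:) (simp add: Var_def)
      qed
      then have "yleading (?A i) 0 (Var 0)" unfolding yleading_def by (intro exI[of _ 1]) simp
      then show ?thesis using yleading_prod[of "{..<e}" "?A i" "\<lambda>_. 0" "\<lambda>_. Var 0"] by simp
    qed
    ultimately have "yleading (?A i) (0 + ?n) (E i \<mu>)" unfolding E_def by (intro yleading_mult)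
    then obtain \<kappa> e where \<kappa>: "\<kappa> \<noteq> 0" "lead (?A i) (?n + Poly_Mapping.single 0 e) \<kappa> (E i \<mu>)"
      unfolding yleading_def by auto
    \<comment> \<open>A nonzero coefficient of a form of degree \<open>?d\<close> determines the
      unknown exponent e of x_0.\<close>
    have "?n + Poly_Mapping.single 0 e \<in> monomials N ?d"
      using lead_lookup[OF \<kappa>(2), of "?n + Poly_Mapping.single 0 e"] \<kappa>(1) shift_form[OF E_form, of "?A i"]
      by (auto simp: form_def in_keys_iff subset_iff)
    then have "mon_deg ?n + e = ?d" by (simp add: monomials_def)
    moreover have "mon_deg ?n + Poly_Mapping.lookup \<mu> 0 = m"
      using arg_cong[OF \<mu>n, of mon_deg] \<mu>k(2) by simp
    ultimately have e: "e = Poly_Mapping.lookup \<mu> 0 + (?d - m)" using md by linarith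
    have "?n + Poly_Mapping.single 0 e =
        (?n + Poly_Mapping.single 0 (Poly_Mapping.lookup \<mu> 0)) + Poly_Mapping.single 0 (?d - m)"
      by (simp only: e single_add add.assoc)
    then have \<nu>: "?n + Poly_Mapping.single 0 e = \<mu> + Poly_Mapping.single 0 (?d - m)"
      by (simp only: \<mu>n[symmetric])
    have leadE: "lead (?A i) (\<mu> + Poly_Mapping.single 0 (?d - m)) \<kappa> (E i \<mu>)"
      using \<kappa>(2) unfolding \<nu> .
    have yordE: "yord (ydeg \<mu> + 1) (shift (?A i') (E i \<mu>))" if "i' < S" "i' \<noteq> i" for i'
    proof -
      have "yord (\<Sum>j\<in>{1..N}. Poly_Mapping.lookup \<mu> j * 1) (shift (?A i') (F \<mu>))"
        unfolding F_def shift_simps using yord_f[OF that(1)] by (intro yord_prod yord_power)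
      then have "yord (ydeg \<mu>) (shift (?A i') (F \<mu>))" using ydeg_eq_sum[OF \<mu>k(1)] by simp
      from yord_mult[OF this yord_h[OF i that]] show ?thesis
        unfolding E_def shift_simps by (rule yord_mult_left)
    qed
    show "\<exists>E\<in>form N ?d. Poly_Mapping.lookup (shift (?A i) E) (\<mu> + Poly_Mapping.single 0 (?d - m)) \<noteq> 0 \<and>
      (\<forall>i'<S. \<forall>\<mu>'\<in>monomials N m. (i', \<mu>') \<noteq> (i, \<mu>) \<longrightarrow>
        (case (i', \<mu>') of (_, \<mu>) \<Rightarrow> ydeg \<mu>) \<le> (case (i, \<mu>) of (_, \<mu>) \<Rightarrow> ydeg \<mu>) \<longrightarrow>
        Poly_Mapping.lookup (shift (?A i') E) (\<mu>' + Poly_Mapping.single 0 (?d - m)) = 0)"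
    proof (intro bexI[OF _ E_form] conjI allI impI ballI)
      show "Poly_Mapping.lookup (shift (?A i) (E i \<mu>)) (\<mu> + Poly_Mapping.single 0 (?d - m)) \<noteq> 0"
        using lead_lookup[OF leadE, of "\<mu> + Poly_Mapping.single 0 (?d - m)"] \<kappa>(1) by simp
      fix i' \<mu>' assume *: "i' < S" "\<mu>' \<in> monomials N m" "(i', \<mu>') \<noteq> (i, \<mu>)"
        "(case (i', \<mu>') of (_, \<mu>) \<Rightarrow> ydeg \<mu>) \<le> (case (i, \<mu>) of (_, \<mu>) \<Rightarrow> ydeg \<mu>)"
      show "Poly_Mapping.lookup (shift (?A i') (E i \<mu>)) (\<mu>' + Poly_Mapping.single 0 (?d - m)) = 0"
      proof (cases "i' = i")
        case True
        then show ?thesis using * lead_lookup[OF leadE, of "\<mu>' + Poly_Mapping.single 0 (?d - m)"] by auto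
      next
        case False
        then show ?thesis using * yordE[of i'] by (simp add: yord_lookup)
      qed
    qed
  qed
  then show ?thesis by blast
qed

subsection \<open>Resurgence\<close>

lemma separated_points_of_jets:
  assumes A0: "\<And>i. i < s \<Longrightarrow> A i 0 \<noteq> 0" and sep: "separates_jets N s A 0 r"
  shows "\<exists>u. separated_points N s r A u"
proof -
  have "0 \<in> monomials N 0" by (simp add: monomials_def)
  then have "\<forall>i. \<exists>E. i < s \<longrightarrow> E \<in> form N r \<and> lead (A i) (Poly_Mapping.single 0 r) 1 E \<and>
      (\<forall>j<s. j \<noteq> i \<longrightarrow> yord 1 (shift (A j) E))"
    using sep unfolding separates_jets_def by fastforce
  from choice[OF this] obtain u where u: "\<And>i. i < s \<Longrightarrow> u i \<in> form N r"
    "\<And>i. i < s \<Longrightarrow> lead (A i) (Poly_Mapping.single 0 r) 1 (u i)"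
    "\<And>i j. i < s \<Longrightarrow> j < s \<Longrightarrow> j \<noteq> i \<Longrightarrow> yord 1 (shift (A j) (u i))"
    by blast
  have "separated_points N s r A u"
  proof
    fix i j assume ij: "i < s" "j < s"
    show "Poly_Mapping.lookup (shift (A j) (u i)) (Poly_Mapping.single 0 r) = (if i = j then 1 else 0)"
    proof (cases "i = j")
      case True
      then show ?thesis using lead_lookup[OF u(2)[OF ij(1)], of "Poly_Mapping.single 0 r"] by simp
    next
      case False
      then show ?thesis using u(3)[OF ij] by (simp add: yord_lookup)
    qed
  qed (use A0 u(1) in auto)
  then show ?thesis by blast
qed

lemma symb_pow_imp:
  assumes "F \<in> symb_pow N s A a" "i < s"
  shows "F \<in> poly_ring N" and "yord a (shift (A i) F)"
proof -
  have F: "F \<in> ideal_pow N (points_ideal N {A i}) a" using assms by (auto simp: symb_pow_def)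
  have "points_ideal N {A i} \<subseteq> poly_ring N" by (auto simp: points_ideal_iff)
  then show "F \<in> poly_ring N" using F ideal_pow_poly_ring by blast
  show "yord a (shift (A i) F)"
    using F by (rule yord_ideal_pow[rotated]) (simp add: points_ideal_iff restr_eq_0_iff)
qed

text \<open>The bound \<open>reg / \<alpha>\<close> on the resurgence, where the Waldschmidt constant \<open>\<alpha>\<close> is at least
  \<open>S (m / d)\<^sup>k\<close> and the regularity is at most \<open>r + 1\<close>.\<close>
lemma resurgence_le:
  fixes A :: "nat \<Rightarrow> nat \<Rightarrow> 'k::field"
  assumes s: "1 \<le> s" and pts: "separated_points N s r A u"
    and jets: "separates_jets N S A m d" and S: "1 \<le> S" "S \<le> s" and m: "1 \<le> m" "m < d" and N: "N = Suc k"
  shows "resurgence N s A \<le> ereal (max 1 (real (r + 1) * real d ^ k / (real S * real m ^ k)))"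
  unfolding resurgence_def
proof (rule Sup_least)
  interpret separated_points N s r A u by fact
  \<comment> \<open>The maximum with 1 ensures b <= a in the case to be refuted, so that order a at
    the points implies order b.\<close>
  let ?\<rho> = "max 1 (real (r + 1) * real d ^ k / (real S * real m ^ k))"
  fix z assume "z \<in> {ereal (real a / real b) |a b. b \<ge> 1 \<and>
    \<not> symb_pow N s A a \<subseteq> ideal_pow N (points_ideal N (pts_set s A)) b}"
  then obtain a b where ab: "z = ereal (real a / real b)" "b \<ge> 1"
    "\<not> symb_pow N s A a \<subseteq> ideal_pow N (points_ideal N (pts_set s A)) b" by auto
  obtain F where F: "F \<in> symb_pow N s A a" "F \<notin> ideal_pow N (points_ideal N (A ` {..<s})) b"
    using ab(3) by (auto simp: pts_set_def)
  note poly = symb_pow_imp(1)[OF F(1), of 0] and ord = symb_pow_imp(2)[OF F(1)]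
  have FR: "F \<in> poly_ring N" using poly s by simp
  have pos: "0 < real S * real m ^ k" using S m by simp
  have "real a / real b \<le> ?\<rho>"
  proof (rule ccontr)
    assume "\<not> real a / real b \<le> ?\<rho>"
    then have gt: "1 < real a / real b" "real (r + 1) * real d ^ k / (real S * real m ^ k) < real a / real b"
      by auto
    have "b \<le> a" using gt(1) ab(2) by (simp add: less_divide_eq)
    have cross: "real b * real (r + 1) * real d ^ k < real S * real a * real m ^ k"
      using gt(2) pos ab(2) by (simp add: field_simps)
    \<comment> \<open>Each nonzero homogeneous component of F again has order at least a at the
      points, so the degree bound applies to every term of F.\<close>
    have "F \<in> high N (b * (r + 1))"
      unfolding high_def
    proof (rule CollectI, rule subsetI, rule CollectI, rule conjI)
      fix \<mu> assume \<mu>: "\<mu> \<in> Poly_Mapping.keys F"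
      then show "Poly_Mapping.keys \<mu> \<subseteq> {..N}" using FR by (simp add: poly_ring_def)
      let ?t = "mon_deg \<mu>"
      let ?G = "hom_comp ?t F"
      have "Poly_Mapping.lookup ?G \<mu> \<noteq> 0" using \<mu> by (simp add: lookup_hom_comp in_keys_iff)
      then have "?G \<noteq> 0" by auto
      moreover have "yord a (shift (A i) ?G)" if "i < S" for i
        using ord[of i] that S(2) hom_comp_shift[OF FR, of ?t "A i"] yord_hom_comp[of a "shift (A i) F" ?t] by simp
      ultimately have le: "real S * real a * real m ^ k \<le> real ?t * real d ^ k"
        using degree_lower_bound[OF jets N m hom_comp_form[OF FR]] by blast
      show "b * (r + 1) \<le> ?t"
      proof (rule ccontr)
        assume "\<not> b * (r + 1) \<le> ?t"
        then have "real ?t \<le> real b * real (r + 1)" by (metis nle_le of_nat_le_iff of_nat_mult)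
        then have "real ?t * real d ^ k \<le> real b * real (r + 1) * real d ^ k" by (rule mult_right_mono) simp
        then show False using le cross by linarith
      qed
    qed
    then have "F \<in> ideal_pow N (points_ideal N (A ` {..<s})) b"
      using ord \<open>b \<le> a\<close> by (intro symbolic_in_ordinary) (auto intro: yord_mono)
    then show False using F(2) by simp
  qed
  then show "z \<le> ereal ?\<rho>" unfolding ab(1) by (simp only: ereal_less_eq)
qed

theorem theorem4p2:
  fixes N s :: nat
  assumes "CHAR('k::field) = 0"
    and "N \<ge> 3"
    and "s \<ge> 1"
  shows "\<exists>U :: (nat \<Rightarrow> 'k) set. zariski_open (s * (N + 1)) U \<and> U \<noteq> {} \<and>
           (\<forall>b\<in>U. distinct_proj_points N s (param_pts N b) \<and>
                   resurgence N s (param_pts N b) < ereal (real N))"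
proof -
  obtain q where N: "N = Suc q" using assms(2) by (cases N) auto
  obtain k S r where par: "1 \<le> k" "1 \<le> S" "S \<le> s" "S \<le> k ^ N" "s \<le> (r + N) choose N"
    "(r + 1) * k ^ (N - 1) < N * S"
    using parameters_exist[OF assms(2,3)] by blast
  obtain m where m: "1 \<le> m" "real (r + 1) * real (k * (m + N)) ^ q < real N * real S * real m ^ q"
    using jet_order_exists[of "r + 1" k q N S] par(6) N by auto
  let ?d = "k * (m + N)" and ?n = "s * (N + 1)"
  have md: "m < ?d" using assms(2) by (intro less_le_trans[OF _ mult_le_mono1[OF par(1), of "m + N"]]) simp
  obtain g1 and b1 :: "nat \<Rightarrow> 'k" where g1: "polyfun ?n g1" "g1 b1 \<noteq> 0"
    "\<And>b. g1 b \<noteq> 0 \<Longrightarrow> separates_jets N s (param_pts N b) 0 r"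
    using separated_points_open[OF assms(1) par(5)] by blast
  obtain g2 and b2 :: "nat \<Rightarrow> 'k" where g2: "polyfun ?n g2" "g2 b2 \<noteq> 0"
    "\<And>b. g2 b \<noteq> 0 \<Longrightarrow> separates_jets N S (param_pts N b) m ?d"
    using grid_jets_open[OF assms(1) par(3,4,1)] by blast
  \<comment> \<open>Nonzero coordinates a_{i0} place all points in the chart where
    \<open>shift\<close> is invertible.\<close>
  define g3 where "g3 b = (\<Prod>i<s. b (i * (N + 1)))" for b :: "nat \<Rightarrow> 'k"
  have g3: "polyfun ?n g3"
    unfolding g3_def
  proof (rule polyfun_prod, rule polyfun_coord)
    fix i assume "i \<in> {..<s}"
    then show "i * (N + 1) < ?n" by (intro mult_less_mono1) simp_all
  qed
  have inf: "infinite (UNIV :: 'k set)" by (rule infinite_UNIV_CHAR_0[OF assms(1)])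
  obtain b4 where b4: "g1 b4 * g2 b4 \<noteq> 0"
    using polyfun_common_nonzero[OF inf g1(1,2) g2(1,2)] by blast
  define g where "g b = g1 b * g2 b * g3 b" for b
  \<comment> \<open>The constant vector 1 is a point where \<open>g3\<close> does not vanish; the
    witnesses for the three conditions are merged pairwise.\<close>
  have "\<exists>b. g1 b * g2 b * g3 b \<noteq> 0"
    using polyfun_common_nonzero[OF inf polyfun_mult[OF g1(1) g2(1)] b4 g3, of "\<lambda>_. 1"] by (simp add: g3_def)
  then obtain b5 where b5: "g b5 \<noteq> 0" by (auto simp: g_def)
  have "polyfun ?n g" unfolding g_def by (intro polyfun_mult g1 g2 g3)
  then obtain f where f: "\<forall>m\<in>Poly_Mapping.keys f. Poly_Mapping.keys m \<subseteq> {..<?n}" "\<And>b. g b = poly_eval b f"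
    unfolding polyfun_def by blast
  let ?U = "{b. g b \<noteq> 0}"
  have "zariski_open ?n ?U"
    unfolding zariski_open_def using f by (intro exI[of _ "{f}"]) auto
  moreover have "?U \<noteq> {}" using b5 by blast
  moreover have "distinct_proj_points N s (param_pts N b) \<and> resurgence N s (param_pts N b) < ereal (real N)"
    if "b \<in> ?U" for b
  proof -
    let ?A = "param_pts N b"
    have gb: "g1 b \<noteq> 0" "g2 b \<noteq> 0" "g3 b \<noteq> 0" using that by (auto simp: g_def)
    have A0: "?A i 0 \<noteq> 0" if "i < s" for i
      using gb(3) that by (auto simp: g3_def param_pts_def)
    obtain u where u: "separated_points N s r ?A u"
      using separated_points_of_jets[OF A0 g1(3)[OF gb(1)]] by blast
    have "distinct_proj_points N s ?A"
      unfolding distinct_proj_points_def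
      using A0 separated_points.not_proportional[OF u] by blast
    moreover have "resurgence N s ?A < ereal (real N)"
    proof (rule le_less_trans)
      show "resurgence N s ?A \<le> ereal (max 1 (real (r + 1) * real ?d ^ q / (real S * real m ^ q)))"
        by (rule resurgence_le[OF assms(3) u g2(3)[OF gb(2)] par(2,3) m(1) md N])
      have "0 < real S * real m ^ q" using par(2) m(1) by simp
      then have "real (r + 1) * real ?d ^ q / (real S * real m ^ q) < real N"
        using m(2) by (simp add: divide_less_eq mult.assoc)
      then have "max 1 (real (r + 1) * real ?d ^ q / (real S * real m ^ q)) < real N" using assms(2) by simp
      then show "ereal (max 1 (real (r + 1) * real ?d ^ q / (real S * real m ^ q))) < ereal (real N)"
        by (simp only: less_ereal.simps)
    qed
    ultimately show ?thesis by blast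
  qed
  ultimately show ?thesis by blast
qed

end
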